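(* Let $\gamma>0$ and consider the equation $i\partial_tu=\Pi(|u|^2u)$, $u(0,\cdot)=u_0$. The following local well-posedness results hold. (i) For any $p\in[1,\infty]$, the equation is locally well-posed in $\mathcal F_\gamma\cap L^p(S_\gamma)$: for any $u_0\in\mathcal F_\gamma\cap L^p(S_\gamma)$ there exist $T>0$ and a unique solution $u\in\mathcal C([0,T],\mathcal F_\gamma\cap L^p(S_\gamma))$, which depends smoothly on $u_0$. (ii) For any $p\in[1,\infty]$ and $\alpha\ge0$, the equation is locally well-posed in $L^{p,\alpha}(S_\gamma)$: for any $u_0\in\mathcal F_\gamma\cap L^{p,\alpha}(S_\gamma)$ there exist $T>0$ and a unique solution $u\in\mathcal C([0,T],\mathcal F_\gamma\cap L^{p,\alpha}(S_\gamma))$, which depends smoothly on $u_0$. (iii) Writing $u=\sum_{k\in\mathbb Z}\lambda_k\psi_k$, the equation (in the coordinates $(\lambda_k)$) is locally well-posed in $\ell^{\infty,\alpha}$ for every $\alpha\ge0$.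
   Context: $L$ is Lebesgue measure on $\mathbb C$. For a function $u$ on $\mathbb C$ of at most polynomial growth, $[\Pi u](z)=\frac1\pi e^{-|z|^2/2}\int_{\mathbb C}e^{\overline w z-|w|^2/2}u(w)\,dL(w)$. $\widetilde{\mathcal E}$ is the set of functions $u(z)=e^{-|z|^2/2}f(z)$ with $f$ entire such that $|u(z)|\lesssim\langle z\rangle^M$ for some $M$; $R_\alpha u(z)=e^{(\alpha\overline z-\overline\alpha z)/2}u(z+\alpha)$; $\mathcal F_\gamma=\{u\in\widetilde{\mathcal E}:R_\gamma u=u\}$; $S_\gamma=\{z\in\mathbb C:-\gamma/2<\mathrm{Re}\,z\le\gamma/2\}$. Norms: $\|u\|_{L^{p,\alpha}(S_\gamma)}=\|\langle z\rangle^\alpha u\|_{L^p(S_\gamma)}$ and $\|(\lambda_k)\|_{\ell^{\infty,\alpha}}=\sup_{k\in\mathbb Z}\langle k\rangle^\alpha|\lambda_k|$. The functions $\psi_k$ are $$\psi_k(z)=\Big(\frac2{\pi\gamma^2}\Big)^{1/4}\exp\Big(-\frac{\pi^2k^2}{\gamma^2}+\frac{2ik\pi}\gamma z+\frac{z^2}2-\frac{|z|^2}2\Big),\quad k\in\mathbb Z,$$ and in the coordinates $(\lambda_k)$ the equation reads, for $n\in\mathbb Z$, $$i\frac{d}{dt}\lambda_n=\sum_{k-\ell+m=n}\frac1{\gamma\sqrt\pi}\exp\Big(-\frac{\pi^2}{\gamma^2}\big((\ell-k)^2+(\ell-m)^2\big)\Big)\lambda_k\overline{\lambda_\ell}\lambda_m,$$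 the sum being over $k,\ell,m\in\mathbb Z$. Locally well-posed in (iii) means, as in (i)-(ii), existence on some $[0,T]$, $T>0$, of a unique solution in $\mathcal C([0,T],\ell^{\infty,\alpha})$ depending smoothly on the data. *)

theory Defs
  imports
    "HOL-Analysis.Analysis"
    "HOL-Probability.Essential_Supremum"
    "HOL-Library.Function_Algebras"
begin

instantiation "fun" :: (type, real_vector) real_vector
begin

definition scaleR_fun :: "real \<Rightarrow> ('a \<Rightarrow> 'b) \<Rightarrow> 'a \<Rightarrow> 'b" where
  "scaleR_fun c f = (\<lambda>x. c *\<^sub>R f x)"

instance
  by standard (simp_all add: scaleR_fun_def plus_fun_def fun_eq_iff scaleR_add_right scaleR_add_left)

end


section \<open>Function spaces\<close>

definition bracket :: "'a::real_normed_vector \<Rightarrow> real" where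
  "bracket z = sqrt (1 + (norm z)\<^sup>2)"

definition bargmann_proj :: "(complex \<Rightarrow> complex) \<Rightarrow> complex \<Rightarrow> complex" where
  "bargmann_proj u z =
     complex_of_real (1 / pi * exp (- (cmod z)\<^sup>2 / 2)) *
     (LINT w|lebesgue. exp (cnj w * z - complex_of_real ((cmod w)\<^sup>2 / 2)) * u w)"

definition E_tilde :: "(complex \<Rightarrow> complex) set" where
  "E_tilde = {u.
     (\<exists>f. f holomorphic_on UNIV \<and> (\<forall>z. u z = complex_of_real (exp (- (cmod z)\<^sup>2 / 2)) * f z)) \<and>
     (\<exists>M C. \<forall>z. cmod (u z) \<le> C * bracket z powr M)}"

definition mag_trans :: "complex \<Rightarrow> (complex \<Rightarrow> complex) \<Rightarrow> complex \<Rightarrow> complex" where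
  "mag_trans \<alpha> u z = exp ((\<alpha> * cnj z - cnj \<alpha> * z) / 2) * u (z + \<alpha>)"

definition F_per :: "real \<Rightarrow> (complex \<Rightarrow> complex) set" where
  "F_per \<gamma> = {u \<in> E_tilde. mag_trans (complex_of_real \<gamma>) u = u}"

definition strip :: "real \<Rightarrow> complex set" where
  "strip \<gamma> = {z. - \<gamma> / 2 < Re z \<and> Re z \<le> \<gamma> / 2}"

definition Lp_space :: "ennreal \<Rightarrow> complex set \<Rightarrow> (complex \<Rightarrow> complex) set" where
  "Lp_space p S = {u \<in> borel_measurable (lebesgue_on S).
     if p = \<infinity> then esssup (lebesgue_on S) (\<lambda>z. ennreal (cmod (u z))) < \<infinity>
     else integrable (lebesgue_on S) (\<lambda>z. cmod (u z) powr enn2real p)}"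

definition Lp_norm :: "ennreal \<Rightarrow> complex set \<Rightarrow> (complex \<Rightarrow> complex) \<Rightarrow> real" where
  "Lp_norm p S u =
     (if p = \<infinity> then enn2real (esssup (lebesgue_on S) (\<lambda>z. ennreal (cmod (u z))))
      else (LINT z|lebesgue_on S. cmod (u z) powr enn2real p) powr (1 / enn2real p))"

definition weighted :: "real \<Rightarrow> (complex \<Rightarrow> complex) \<Rightarrow> complex \<Rightarrow> complex" where
  "weighted \<alpha> u z = complex_of_real (bracket z powr \<alpha>) * u z"

definition wLp_space :: "ennreal \<Rightarrow> real \<Rightarrow> complex set \<Rightarrow> (complex \<Rightarrow> complex) set" where
  "wLp_space p \<alpha> S = {u. weighted \<alpha> u \<in> Lp_space p S}"

definition wLp_norm :: "ennreal \<Rightarrow> real \<Rightarrow> complex set \<Rightarrow> (complex \<Rightarrow> complex) \<Rightarrow> real" where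
  "wLp_norm p \<alpha> S u = Lp_norm p S (weighted \<alpha> u)"

definition linf_space :: "real \<Rightarrow> (int \<Rightarrow> complex) set" where
  "linf_space \<alpha> = {l. bdd_above (range (\<lambda>k. bracket (real_of_int k) powr \<alpha> * cmod (l k)))}"

definition linf_norm :: "real \<Rightarrow> (int \<Rightarrow> complex) \<Rightarrow> real" where
  "linf_norm \<alpha> l = (SUP k. bracket (real_of_int k) powr \<alpha> * cmod (l k))"


section \<open>The equations\<close>

definition cubic :: "(complex \<Rightarrow> complex) \<Rightarrow> complex \<Rightarrow> complex" where
  "cubic u = bargmann_proj (\<lambda>w. complex_of_real ((cmod (u w))\<^sup>2) * u w)"

text \<open>
  The nonlinearity of the equation for the coefficients of \<open>u = (\<Sum>k. \<lambda>\<^sub>k \<psi>\<^sub>k)\<close>, where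
  \<open>\<psi>\<^sub>k(z) = (2 / (\<pi> \<gamma>^2))^(1/4) exp (- \<pi>^2 k^2 / \<gamma>^2 + 2 i k \<pi> z / \<gamma> + z^2 / 2 - |z|^2 / 2)\<close>
  is an orthonormal family on the strip.  The factor in front of \<open>\<lambda>\<^sub>k cnj \<lambda>\<^sub>l \<lambda>\<^sub>m\<close> is the integral
  of \<open>\<psi>\<^sub>k cnj \<psi>\<^sub>l \<psi>\<^sub>m cnj \<psi>\<^sub>n\<close> over the strip, which vanishes unless \<open>k - l + m = n\<close>.
\<close>

definition cubic_coord :: "real \<Rightarrow> (int \<Rightarrow> complex) \<Rightarrow> int \<Rightarrow> complex" where
  "cubic_coord \<gamma> c n =
     (\<Sum>\<^sub>\<infinity>(k, l, m) \<in> {(k, l, m). k - l + m = n}.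
        complex_of_real (1 / (\<gamma> * sqrt pi) *
          exp (- (pi\<^sup>2 / \<gamma>\<^sup>2) * ((real_of_int (l - k))\<^sup>2 + (real_of_int (l - m))\<^sup>2)))
        * c k * cnj (c l) * c m)"


section \<open>Smooth maps and local well-posedness\<close>

text \<open>
  A normed space is given by a carrier \<open>X\<close> and a norm \<open>N\<close>, which is only relevant on \<open>X\<close>.
  Spaces are regarded as real normed spaces: \<open>u \<mapsto> |u|\<^sup>2 u\<close> is not complex differentiable.
\<close>

definition bounded_multilinear_on ::
  "'a::real_vector set \<Rightarrow> ('a \<Rightarrow> real) \<Rightarrow> 'b::real_vector set \<Rightarrow> ('b \<Rightarrow> real) \<Rightarrow> nat \<Rightarrow> ('a list \<Rightarrow> 'b) \<Rightarrow> bool"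
where
  "bounded_multilinear_on X NX Y NY n A \<longleftrightarrow>
     (\<forall>hs. length hs = n \<and> set hs \<subseteq> X \<longrightarrow> A hs \<in> Y) \<and>
     (\<forall>hs i a b x y. length hs = n \<and> set hs \<subseteq> X \<and> i < n \<and> x \<in> X \<and> y \<in> X \<longrightarrow>
        A (hs[i := a *\<^sub>R x + b *\<^sub>R y]) = a *\<^sub>R A (hs[i := x]) + b *\<^sub>R A (hs[i := y])) \<and>
     (\<exists>C. \<forall>hs. length hs = n \<and> set hs \<subseteq> X \<longrightarrow> NY (A hs) \<le> C * prod_list (map NX hs))"

text \<open>
  \<open>F\<close> is of class \<open>C\<^sup>\<infinity>\<close>, in the sense of Frechet, on the open subset \<open>U\<close> of \<open>X\<close>.  Iterated
  derivatives, elements of \<open>L(X, L(X, \<dots>, L(X, Y)))\<close>, are identified with bounded multilinear maps: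
  \<open>D x [h\<^sub>1, \<dots>, h\<^sub>n]\<close> is the \<open>n\<close>-th derivative of \<open>F\<close> at \<open>x\<close> in the directions \<open>h\<^sub>1, \<dots>, h\<^sub>n\<close>.  The last
  clause says that the \<open>(n+1)\<close>-st derivative is the Frechet derivative of the \<open>n\<close>-th one, with
  respect to the operator norm.
\<close>

definition smooth_map_on ::
  "'a::real_vector set \<Rightarrow> ('a \<Rightarrow> real) \<Rightarrow> 'b::real_vector set \<Rightarrow> ('b \<Rightarrow> real) \<Rightarrow> 'a set \<Rightarrow> ('a \<Rightarrow> 'b) \<Rightarrow> bool"
where
  "smooth_map_on X NX Y NY U F \<longleftrightarrow>
     (\<exists>D :: 'a \<Rightarrow> 'a list \<Rightarrow> 'b.
        (\<forall>x\<in>U. D x [] = F x) \<and>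
        (\<forall>x\<in>U. \<forall>n. bounded_multilinear_on X NX Y NY n (D x)) \<and>
        (\<forall>x\<in>U. \<forall>n. \<forall>\<epsilon>>0. \<exists>\<delta>>0. \<forall>h\<in>X. NX h < \<delta> \<and> x + h \<in> U \<longrightarrow>
           (\<forall>hs. length hs = n \<and> set hs \<subseteq> X \<longrightarrow>
              NY (D (x + h) hs - D x hs - D x (h # hs)) \<le> \<epsilon> * NX h * prod_list (map NX hs))))"

text \<open>\<open>C([0,T], X)\<close>; values at times outside \<open>[0,T]\<close> are irrelevant.\<close>

definition path_space :: "real \<Rightarrow> 'a::real_vector set \<Rightarrow> ('a \<Rightarrow> real) \<Rightarrow> (real \<Rightarrow> 'a) set" where
  "path_space T X N = {u. (\<forall>t\<in>{0..T}. u t \<in> X) \<and>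
     (\<forall>t\<in>{0..T}. ((\<lambda>s. N (u s - u t)) \<longlongrightarrow> 0) (at t within {0..T}))}"

definition path_norm :: "real \<Rightarrow> ('a \<Rightarrow> real) \<Rightarrow> (real \<Rightarrow> 'a) \<Rightarrow> real" where
  "path_norm T N u = (SUP t\<in>{0..T}. N (u t))"

text \<open>
  \<open>u \<in> C([0,T], X)\<close> solves \<open>i \<partial>\<^sub>t u = G(u)\<close>, \<open>u(0) = u\<^sub>0\<close>.  The index \<open>z\<close> is the space variable, or the
  index of the coordinate for the equation in \<open>(\<lambda>\<^sub>k)\<close>; time derivatives are one-sided at \<open>0\<close> and \<open>T\<close>.
\<close>

definition solves ::
  "('i \<Rightarrow> complex) set \<Rightarrow> (('i \<Rightarrow> complex) \<Rightarrow> real) \<Rightarrow> (('i \<Rightarrow> complex) \<Rightarrow> 'i \<Rightarrow> complex) \<Rightarrow>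
   real \<Rightarrow> ('i \<Rightarrow> complex) \<Rightarrow> (real \<Rightarrow> 'i \<Rightarrow> complex) \<Rightarrow> bool"
where
  "solves X N G T u0 u \<longleftrightarrow>
     u \<in> path_space T X N \<and> u 0 = u0 \<and>
     (\<forall>t\<in>{0..T}. \<forall>z. \<exists>d. ((\<lambda>s. u s z) has_vector_derivative d) (at t within {0..T}) \<and>
        \<i> * d = G (u t) z)"

text \<open>
  Smooth dependence on the data: the existence time \<open>T\<close> is uniform for data \<open>v\<close> in a ball around
  \<open>u\<^sub>0\<close>, and the map \<open>\<Phi>\<close> from data to solutions is smooth from this ball to \<open>C([0,T], X)\<close>.
\<close>

definition locally_well_posed ::
  "('i \<Rightarrow> complex) set \<Rightarrow> (('i \<Rightarrow> complex) \<Rightarrow> real) \<Rightarrow> (('i \<Rightarrow> complex) \<Rightarrow> 'i \<Rightarrow> complex) \<Rightarrow> bool"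
where
  "locally_well_posed X N G \<longleftrightarrow>
     (\<forall>u0\<in>X. \<exists>T>0. \<exists>r>0. \<exists>\<Phi> :: ('i \<Rightarrow> complex) \<Rightarrow> real \<Rightarrow> 'i \<Rightarrow> complex.
        (\<forall>v\<in>X. N (v - u0) < r \<longrightarrow>
           solves X N G T v (\<Phi> v) \<and>
           (\<forall>w. solves X N G T v w \<longrightarrow> (\<forall>t\<in>{0..T}. w t = \<Phi> v t))) \<and>
        smooth_map_on X N (path_space T X N) (path_norm T N) {v \<in> X. N (v - u0) < r} \<Phi>)"

end

theory Submission
  imports Defs "HOL-Complex_Analysis.Complex_Analysis" "HOL-Probability.Distributions"
    "HOL-Real_Asymp.Real_Asymp"
begin

text \<open>
  Each space \<open>X\<close> of the theorem is a complex vector space of functions on which point evaluations are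
  bounded and bounded pointwise limits stay in \<open>X\<close> without increasing the norm (Fatou property; this
  replaces completeness).  The nonlinearity is \<open>G u = T u u u\<close> for a bounded real-trilinear map \<open>T\<close> on \<open>X\<close>.
  The solution with data \<open>v\<close> is a power series \<open>\<Sum>n. t ^ n \<cdot> M\<^sub>n (v, \<dots>, v)\<close> whose coefficients are bounded
  \<open>(2 n + 1)\<close>-linear maps, with bounds taken from the scalar equation \<open>y' = y ^ 3 / 2\<close>; it converges on a
  time interval uniform on balls and can be differentiated term by term in \<open>v\<close>.  Uniqueness is Gronwall's lemma.

  For sequences, \<open>T\<close> is bounded by Peetre's inequality and the Gaussian decay of the kernel.  For functions on
  the strip, the mean value property and periodicity turn the \<open>L\<^sup>p\<close> norm into a weighted sup bound, so
  that in \<open>T u v w = \<Pi> (u \<cdot> cnj v \<cdot> w)\<close> two factors can be taken out; what remains is the convolution of \<open>|u|\<close>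
  with a Gaussian, which is bounded by Jensen's inequality.
\<close>

section \<open>Power series of multilinear maps\<close>

text \<open>A contraction argument would give existence and uniqueness, but
  \<open>smooth_map_on\<close> asks for Frechet derivatives of every order, with remainders in
  operator norm. A series of multilinear terms in the data yields them all by inserting directions
  into slots. Rescaled by the bound \<open>C\<close> of \<open>T\<close> and by the size of the
  data, the scalar majorant solves \<open>y' = C * y ^ 3\<close>, \<open>y 0 = N v\<close>; it
  equals \<open>N v * (1 - 2 * C * (N v)^2 * t) powr (- 1/2)\<close>, whence the condition
  \<open>2 * C * \<rho>^2 * R \<le> 1/2\<close> on the existence time. In \<open>solves\<close> the
  time derivative is taken pointwise in space, so estimates in \<open>N\<close> have to be recovered
  from point values: Riemann sums stay in \<open>X\<close>, and the Fatou property carries their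
  bounds to the limit. On the strip the projection integrates over the whole plane, while the norm
  sees one period and the weight \<open>bracket z\<close> is not periodic. A weight in
  \<open>Im z\<close> alone is equivalent on the strip and makes the weighted modulus of
  \<open>u\<close> periodic, so that every translate of the strip can be compared with the strip
  itself.\<close>

lemma scaleR_fun_apply [simp]: "(c *\<^sub>R f) x = c *\<^sub>R f x"
  by (simp add: scaleR_fun_def)

lemma sum_fun_apply: "(\<Sum>i\<in>A. f i) x = (\<Sum>i\<in>A. f i x)"
  by (induction A rule: infinite_finite_induct) auto

lemma sum_lincomb:
  fixes f :: "'a \<Rightarrow> 'b::real_vector"
  assumes "\<And>i. i \<in> A \<Longrightarrow> f i = a *\<^sub>R g i + b *\<^sub>R h i"
  shows "sum f A = a *\<^sub>R sum g A + b *\<^sub>R sum h A"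
  using assms by (simp add: sum.distrib scaleR_sum_right)

text \<open>The axiom \<open>eval\<close> makes \<open>N\<close> definite and links norm estimates
  to the pointwise derivatives in \<open>solves\<close>. The axiom \<open>fatou\<close> asks for a
  common bound and not for convergence in norm, so it serves partial sums of series and Riemann sums
  alike.\<close>

locale banach_fun =
  fixes X :: "('i \<Rightarrow> complex) set" and N :: "('i \<Rightarrow> complex) \<Rightarrow> real" and E :: "'i \<Rightarrow> real"
  assumes zero_mem: "0 \<in> X"
    and add_mem: "f \<in> X \<Longrightarrow> g \<in> X \<Longrightarrow> f + g \<in> X"
    and cmult_mem: "f \<in> X \<Longrightarrow> (\<lambda>z. c * f z) \<in> X"
    and N_nonneg: "f \<in> X \<Longrightarrow> 0 \<le> N f"
    and N_add: "f \<in> X \<Longrightarrow> g \<in> X \<Longrightarrow> N (f + g) \<le> N f + N g"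
    and N_cmult_le: "f \<in> X \<Longrightarrow> N (\<lambda>z. c * f z) \<le> cmod c * N f"
    and eval: "f \<in> X \<Longrightarrow> cmod (f z) \<le> E z * N f"
    and fatou: "(\<And>n::nat. gs n \<in> X) \<Longrightarrow> (\<And>n. N (gs n) \<le> B) \<Longrightarrow> (\<And>z. (\<lambda>n. gs n z) \<longlonglongrightarrow> f z)
                  \<Longrightarrow> f \<in> X \<and> N f \<le> B"
begin

text \<open>The reverse inequality is \<open>N_cmult_le\<close> for the scalar
  \<open>inverse c\<close>, applied to \<open>c * f\<close>.\<close>

lemma N_cmult:
  assumes f: "f \<in> X"
  shows "N (\<lambda>z. c * f z) = cmod c * N f"
proof (cases "c = 0")
  case True
  then show ?thesis using N_cmult_le[OF f, of 0] N_nonneg[OF cmult_mem[OF f, of 0]] by simp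
next
  case False
  then have "N f \<le> cmod (inverse c) * N (\<lambda>z. c * f z)"
    using N_cmult_le[OF cmult_mem[OF f, of c], of "inverse c"] by (simp add: field_simps)
  then have "cmod c * N f \<le> N (\<lambda>z. c * f z)"
    using False by (simp add: norm_inverse norm_divide field_simps)
  then show ?thesis using N_cmult_le[OF f, of c] by simp
qed

lemma scaleR_mem: "f \<in> X \<Longrightarrow> r *\<^sub>R f \<in> X"
  using cmult_mem[of f "of_real r"] by (simp add: scaleR_fun_def scaleR_conv_of_real)

lemma N_scaleR: "f \<in> X \<Longrightarrow> N (r *\<^sub>R f) = \<bar>r\<bar> * N f"
  using N_cmult[of f "of_real r"] by (simp add: scaleR_fun_def scaleR_conv_of_real)

lemma N_zero: "N 0 = 0"
  using N_scaleR[OF zero_mem, of 0] by simp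

lemma uminus_mem: "f \<in> X \<Longrightarrow> - f \<in> X"
  using scaleR_mem[of f "-1"] by simp

lemma diff_mem: "f \<in> X \<Longrightarrow> g \<in> X \<Longrightarrow> f - g \<in> X"
  using add_mem[of f "-g"] uminus_mem[of g] by simp

lemma N_uminus: "f \<in> X \<Longrightarrow> N (- f) = N f"
  using N_scaleR[of f "-1"] by simp

lemma N_diff: "f \<in> X \<Longrightarrow> g \<in> X \<Longrightarrow> N (f - g) \<le> N f + N g"
  using N_add[of f "-g"] uminus_mem[of g] N_uminus[of g] by simp

lemma N_minus_commute: "f \<in> X \<Longrightarrow> g \<in> X \<Longrightarrow> N (f - g) = N (g - f)"
  using N_uminus[OF diff_mem[of f g]] by simp

lemma sum_mem: "(\<And>i. i \<in> A \<Longrightarrow> f i \<in> X) \<Longrightarrow> sum f A \<in> X"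
  by (induction A rule: infinite_finite_induct) (auto intro: zero_mem add_mem)

lemma N_sum: "(\<And>i. i \<in> A \<Longrightarrow> f i \<in> X) \<Longrightarrow> N (sum f A) \<le> (\<Sum>i\<in>A. N (f i))"
proof (induction A rule: infinite_finite_induct)
  case (insert x F)
  have "N (f x + sum f F) \<le> N (f x) + N (sum f F)" using insert.prems by (intro N_add sum_mem) auto
  also have "\<dots> \<le> N (f x) + (\<Sum>i\<in>F. N (f i))" using insert.prems insert.IH by simp
  finally show ?case using insert.hyps by (simp del: plus_fun_apply)
qed (auto simp: N_zero)

lemma eval_abs: assumes "f \<in> X" shows "cmod (f z) \<le> \<bar>E z\<bar> * N f"
  using eval[OF assms, of z] mult_right_mono[of "E z" "\<bar>E z\<bar>" "N f"] N_nonneg[OF assms] by linarith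

lemma N_eq_0: assumes "f \<in> X" "N f = 0" shows "f = 0"
  using eval[OF assms(1)] assms(2) by (auto simp: fun_eq_iff)

text \<open>The partial sums have norm at most \<open>suminf B\<close> and converge pointwise
  because evaluation is bounded, so the Fatou property applies to them.\<close>

lemma series:
  assumes "\<And>n::nat. g n \<in> X" "\<And>n. N (g n) \<le> B n" "summable B"
  shows "(\<lambda>z. \<Sum>n. g n z) \<in> X" "N (\<lambda>z. \<Sum>n. g n z) \<le> suminf B" "summable (\<lambda>n. norm (g n z))"
proof -
  have B0: "0 \<le> B n" for n using assms(1,2) N_nonneg order_trans by blast
  have s: "summable (\<lambda>n. norm (g n z))" for z
  proof (rule summable_comparison_test)
    show "\<exists>n0. \<forall>n\<ge>n0. norm (norm (g n z)) \<le> \<bar>E z\<bar> * B n"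
      using order_trans[OF eval_abs[OF assms(1)] mult_left_mono[OF assms(2) abs_ge_zero]] by auto
    show "summable (\<lambda>n. \<bar>E z\<bar> * B n)" using assms(3) by (rule summable_mult)
  qed
  have "(\<lambda>z. \<Sum>n. g n z) \<in> X \<and> N (\<lambda>z. \<Sum>n. g n z) \<le> suminf B"
  proof (rule fatou[of "\<lambda>n. \<Sum>i<n. g i"])
    show "(\<Sum>i<n. g i) \<in> X" for n using assms(1) by (intro sum_mem)
    show "N (\<Sum>i<n. g i) \<le> suminf B" for n
    proof -
      have "N (\<Sum>i<n. g i) \<le> (\<Sum>i<n. N (g i))" using assms(1) by (intro N_sum)
      also have "\<dots> \<le> (\<Sum>i<n. B i)" using assms(2) by (intro sum_mono)
      also have "\<dots> \<le> suminf B" using assms(3) B0 by (intro sum_le_suminf) auto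
      finally show ?thesis .
    qed
    show "(\<lambda>n. (\<Sum>i<n. g i) z) \<longlonglongrightarrow> (\<Sum>n. g n z)" for z
      using summable_LIMSEQ[OF summable_norm_cancel[OF s[of z]]] by (simp add: sum_fun_apply)
  qed
  then show "(\<lambda>z. \<Sum>n. g n z) \<in> X" "N (\<lambda>z. \<Sum>n. g n z) \<le> suminf B" by auto
  show "summable (\<lambda>n. norm (g n z))" by (rule s)
qed

end

lemma prod_list_nonneg_real: "(\<And>x. x \<in> set xs \<Longrightarrow> 0 \<le> f x) \<Longrightarrow> 0 \<le> prod_list (map f xs)" for f :: "'a \<Rightarrow> real"
  by (induction xs) auto

text \<open>The value \<open>0\<close> outside \<open>[0,R]\<close>, where the series may diverge, makes \<open>power_path R f\<close> linear in \<open>f\<close> at all times.\<close>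

definition power_path :: "real \<Rightarrow> (nat \<Rightarrow> 'i \<Rightarrow> complex) \<Rightarrow> real \<Rightarrow> 'i \<Rightarrow> complex" where
  "power_path R f t = (if t \<in> {0..R} then (\<lambda>z. \<Sum>n. of_real (t ^ n) * f n z) else 0)"

context banach_fun
begin

lemma power_path_at:
  assumes "\<And>n. f n \<in> X" "\<And>n. N (f n) * R ^ n \<le> B n" "summable B" "t \<in> {0..R}"
  shows "power_path R f t \<in> X" "N (power_path R f t) \<le> suminf B"
    "summable (\<lambda>n. norm (of_real (t ^ n) * f n z))"
proof -
  have mem: "(\<lambda>z. of_real (t ^ n) * f n z) \<in> X" for n using assms(1) by (rule cmult_mem)
  have le: "N (\<lambda>z. of_real (t ^ n) * f n z) \<le> B n" for n
  proof -
    have "N (\<lambda>z. of_real (t ^ n) * f n z) = t ^ n * N (f n)"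
      using assms(4) by (subst N_cmult[OF assms(1)]) (auto simp: norm_power)
    also have "\<dots> \<le> R ^ n * N (f n)"
      using assms(4) N_nonneg[OF assms(1)] by (intro mult_right_mono power_mono) auto
    also have "\<dots> \<le> B n" using assms(2) by (simp add: mult.commute)
    finally show ?thesis .
  qed
  show "power_path R f t \<in> X" "N (power_path R f t) \<le> suminf B"
    "summable (\<lambda>n. norm (of_real (t ^ n) * f n z))"
    using series[OF mem le assms(3)] assms(4) by (auto simp: power_path_def)
qed

lemma path_norm_power_path:
  assumes "\<And>n. f n \<in> X" "\<And>n. N (f n) * R ^ n \<le> B n" "summable B" "R > 0"
  shows "path_norm R N (power_path R f) \<le> suminf B"
  unfolding path_norm_def using assms power_path_at[OF assms(1-3)] by (intro cSUP_least) auto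

lemma power_path_lincomb:
  assumes "\<And>n. f n \<in> X" "\<And>n. N (f n) * R ^ n \<le> B n" "summable B"
    and "\<And>n. g n \<in> X" "\<And>n. N (g n) * R ^ n \<le> B' n" "summable B'"
  shows "power_path R (\<lambda>n. a *\<^sub>R f n + b *\<^sub>R g n) = a *\<^sub>R power_path R f + b *\<^sub>R power_path R g"
proof (intro ext)
  fix t z
  show "power_path R (\<lambda>n. a *\<^sub>R f n + b *\<^sub>R g n) t z = (a *\<^sub>R power_path R f + b *\<^sub>R power_path R g) t z"
  proof (cases "t \<in> {0..R}")
    case True
    note 1 = summable_norm_cancel[OF power_path_at(3)[OF assms(1-3) True, of z]]
    note 2 = summable_norm_cancel[OF power_path_at(3)[OF assms(4-6) True, of z]]
    have "(\<lambda>n. a *\<^sub>R (of_real (t ^ n) * f n z) + b *\<^sub>R (of_real (t ^ n) * g n z)) sums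
       (a *\<^sub>R (\<Sum>n. of_real (t ^ n) * f n z) + b *\<^sub>R (\<Sum>n. of_real (t ^ n) * g n z))"
      by (intro sums_add sums_scaleR_right summable_sums 1 2)
    then have "(\<lambda>n. of_real (t ^ n) * (a *\<^sub>R f n + b *\<^sub>R g n) z) sums
       (a *\<^sub>R (\<Sum>n. of_real (t ^ n) * f n z) + b *\<^sub>R (\<Sum>n. of_real (t ^ n) * g n z))"
      by (simp add: algebra_simps)
    then show ?thesis using True by (simp add: power_path_def sums_iff)
  qed (auto simp: power_path_def)
qed

text \<open>The path is Lipschitz in time with constant \<open>(\<Sum>n. real n * B n) / R\<close>,
  because \<open>|s ^ n - t ^ n| * N (f n)\<close> is at most \<open>n * |s - t| / R * B n\<close>.
  This is what the second summability assumption is for.\<close>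

lemma power_path_mem:
  assumes "\<And>n. f n \<in> X" "\<And>n. N (f n) * R ^ n \<le> B n" "summable B" "summable (\<lambda>n. real n * B n)" "R > 0"
  shows "power_path R f \<in> path_space R X N"
proof -
  have lim: "((\<lambda>s. N (power_path R f s - power_path R f t)) \<longlongrightarrow> 0) (at t within {0..R})"
    if t: "t \<in> {0..R}" for t
  proof (rule tendsto_sandwich)
    let ?S = "suminf (\<lambda>n. real n * B n)"
    show "\<forall>\<^sub>F s in at t within {0..R}. N (power_path R f s - power_path R f t) \<le> \<bar>s - t\<bar> / R * ?S"
      unfolding eventually_at_filter
    proof (intro always_eventually allI impI)
      fix s assume s: "s \<in> {0..R}"
      let ?g = "\<lambda>n z. of_real (s ^ n - t ^ n) * f n z"
      have g: "?g n \<in> X" for n by (rule cmult_mem[OF assms(1)])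
      have gN: "N (?g n) \<le> \<bar>s - t\<bar> / R * (real n * B n)" for n
      proof -
        \<comment> \<open>Division by \<open>R\<close> moves both times into the unit interval,
          where \<open>norm_power_diff\<close> applies.\<close>
        have "norm ((s/R)^n - (t/R)^n) \<le> n * norm (s/R - t/R)"
          using s t assms(5) by (intro norm_power_diff) auto
        then have "\<bar>s ^ n - t ^ n\<bar> / R ^ n \<le> n * (\<bar>s - t\<bar> / R)"
          using assms(5) by (simp add: power_divide diff_divide_distrib[symmetric])
        then have le: "\<bar>s ^ n - t ^ n\<bar> \<le> n * (\<bar>s - t\<bar> / R) * R ^ n"
          using assms(5) by (simp add: pos_divide_le_eq)
        have "N (?g n) = \<bar>s ^ n - t ^ n\<bar> * N (f n)"
          by (subst N_cmult[OF assms(1)]) (simp flip: of_real_power of_real_diff)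
        also have "\<dots> \<le> n * (\<bar>s - t\<bar> / R) * R ^ n * N (f n)"
          using le N_nonneg[OF assms(1)] by (rule mult_right_mono)
        also have "\<dots> = n * (\<bar>s - t\<bar> / R) * (N (f n) * R ^ n)" by simp
        also have "\<dots> \<le> n * (\<bar>s - t\<bar> / R) * B n"
          using assms(2,5) by (intro mult_left_mono) auto
        finally show ?thesis by (simp add: algebra_simps)
      qed
      have "power_path R f s - power_path R f t = (\<lambda>z. \<Sum>n. ?g n z)"
      proof
        fix z
        show "(power_path R f s - power_path R f t) z = (\<Sum>n. ?g n z)"
          using suminf_diff[OF summable_norm_cancel[OF power_path_at(3)[OF assms(1-3) s, of z]]
               summable_norm_cancel[OF power_path_at(3)[OF assms(1-3) t, of z]]] s t
          by (simp add: power_path_def algebra_simps)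
      qed
      moreover have "N (\<lambda>z. \<Sum>n. ?g n z) \<le> (\<Sum>n. \<bar>s - t\<bar> / R * (real n * B n))"
        by (rule series(2)[OF g gN summable_mult[OF assms(4)]])
      moreover have "(\<Sum>n. \<bar>s - t\<bar> / R * (real n * B n)) = \<bar>s - t\<bar> / R * ?S"
        by (rule suminf_mult[OF assms(4)])
      ultimately show "N (power_path R f s - power_path R f t) \<le> \<bar>s - t\<bar> / R * ?S" by simp
    qed
    show "\<forall>\<^sub>F s in at t within {0..R}. 0 \<le> N (power_path R f s - power_path R f t)"
      unfolding eventually_at_filter
      using power_path_at(1)[OF assms(1-3)] t by (auto intro!: always_eventually N_nonneg diff_mem)
    have "((\<lambda>s. \<bar>s - t\<bar> / R * ?S) \<longlongrightarrow> \<bar>t - t\<bar> / R * ?S) (at t within {0..R})"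
      using assms(5) by (intro tendsto_intros) auto
    then show "((\<lambda>s. \<bar>s - t\<bar> / R * ?S) \<longlongrightarrow> 0) (at t within {0..R})" by simp
  qed simp
  show ?thesis unfolding path_space_def using lim power_path_at(1)[OF assms(1-3)] by auto
qed

section \<open>Bounded multilinear maps and the derivatives of their diagonals\<close>

text \<open>A slot is marked by splitting the list around it, not by an index, because arguments are
  inserted and distributed below by \<open>take\<close> and \<open>drop\<close>. Lists of a length
  other than \<open>m\<close> are unconstrained.\<close>

definition multilin :: "nat \<Rightarrow> real \<Rightarrow> (('i \<Rightarrow> complex) list \<Rightarrow> 'i \<Rightarrow> complex) \<Rightarrow> bool" where
  "multilin m A M \<longleftrightarrow> 0 \<le> A \<and>
     (\<forall>xs. length xs = m \<and> set xs \<subseteq> X \<longrightarrow> M xs \<in> X \<and> N (M xs) \<le> A * prod_list (map N xs)) \<and>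
     (\<forall>ys zs a b x y. Suc (length ys + length zs) = m \<and> set ys \<subseteq> X \<and> set zs \<subseteq> X \<and> x \<in> X \<and> y \<in> X \<longrightarrow>
        M (ys @ (a *\<^sub>R x + b *\<^sub>R y) # zs) = a *\<^sub>R M (ys @ x # zs) + b *\<^sub>R M (ys @ y # zs))"

lemma multilinI:
  assumes "0 \<le> A"
    "\<And>xs. length xs = m \<Longrightarrow> set xs \<subseteq> X \<Longrightarrow> M xs \<in> X"
    "\<And>xs. length xs = m \<Longrightarrow> set xs \<subseteq> X \<Longrightarrow> N (M xs) \<le> A * prod_list (map N xs)"
    "\<And>ys zs a b x y. Suc (length ys + length zs) = m \<Longrightarrow> set ys \<subseteq> X \<Longrightarrow> set zs \<subseteq> X \<Longrightarrow> x \<in> X \<Longrightarrow> y \<in> X \<Longrightarrow>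
        M (ys @ (a *\<^sub>R x + b *\<^sub>R y) # zs) = a *\<^sub>R M (ys @ x # zs) + b *\<^sub>R M (ys @ y # zs)"
  shows "multilin m A M"
  using assms unfolding multilin_def by blast

lemma multilinD:
  assumes "multilin m A M"
  shows "0 \<le> A"
    "length xs = m \<Longrightarrow> set xs \<subseteq> X \<Longrightarrow> M xs \<in> X"
    "length xs = m \<Longrightarrow> set xs \<subseteq> X \<Longrightarrow> N (M xs) \<le> A * prod_list (map N xs)"
    "Suc (length ys + length zs) = m \<Longrightarrow> set ys \<subseteq> X \<Longrightarrow> set zs \<subseteq> X \<Longrightarrow> x \<in> X \<Longrightarrow> y \<in> X \<Longrightarrow>
        M (ys @ (a *\<^sub>R x + b *\<^sub>R y) # zs) = a *\<^sub>R M (ys @ x # zs) + b *\<^sub>R M (ys @ y # zs)"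
  using assms unfolding multilin_def by blast+

lemma multilin_insert:
  assumes "multilin (Suc m) A M" "k \<in> X" "i \<le> m"
  shows "multilin m (A * N k) (\<lambda>l. M (take i l @ k # drop i l))"
proof (rule multilinI)
  show "0 \<le> A * N k" using multilinD(1)[OF assms(1)] N_nonneg[OF assms(2)] by simp
next
  fix xs assume xs: "length xs = m" "set xs \<subseteq> X"
  have 1: "length (take i xs @ k # drop i xs) = Suc m" "set (take i xs @ k # drop i xs) \<subseteq> X"
    using xs assms by (auto dest: in_set_takeD in_set_dropD)
  show "M (take i xs @ k # drop i xs) \<in> X" using multilinD(2)[OF assms(1) 1] .
  have "prod_list (map N xs) = prod_list (map N (take i xs)) * prod_list (map N (drop i xs))"
    by (metis append_take_drop_id map_append prod_list.append)
  then show "N (M (take i xs @ k # drop i xs)) \<le> A * N k * prod_list (map N xs)"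
    using multilinD(3)[OF assms(1) 1] by (simp add: ac_simps)
next
  fix ys zs :: "('i \<Rightarrow> complex) list" and a b x y
  assume h: "Suc (length ys + length zs) = m" "set ys \<subseteq> X" "set zs \<subseteq> X" "x \<in> X" "y \<in> X"
  show "M (take i (ys @ (a *\<^sub>R x + b *\<^sub>R y) # zs) @ k # drop i (ys @ (a *\<^sub>R x + b *\<^sub>R y) # zs)) =
    a *\<^sub>R M (take i (ys @ x # zs) @ k # drop i (ys @ x # zs)) + b *\<^sub>R M (take i (ys @ y # zs) @ k # drop i (ys @ y # zs))"
  proof (cases "i \<le> length ys")
    case True
    have "set (take i ys @ k # drop i ys) \<subseteq> X"
      using h assms by (auto dest: in_set_takeD in_set_dropD)
    from multilinD(4)[OF assms(1) _ this h(3-5), of a b] True h(1) show ?thesis by simp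
  next
    case False
    then obtain j where i: "i = length ys + Suc j" by (metis add.commute add_Suc_right less_natE not_le)
    have "set (take j zs @ k # drop j zs) \<subseteq> X"
      using h assms by (auto dest: in_set_takeD in_set_dropD)
    from multilinD(4)[OF assms(1) _ h(2) this h(4,5), of a b] i h(1) assms(3) show ?thesis
      by (simp add: i)
  qed
qed

lemma multilin_Cons:
  assumes "multilin (Suc m) A M" "k \<in> X"
  shows "multilin m (A * N k) (\<lambda>l. M (k # l))"
  using multilin_insert[OF assms, of 0] by simp

text \<open>The derivative of \<open>x \<mapsto> M (x, \<dots>, x)\<close> inserts the direction into each slot in turn.  The directions are
  listed in reverse order, the last one taken coming last, so that the remainder estimate follows by
  induction without any symmetry of the higher derivatives.\<close>

fun deriv_form :: "nat \<Rightarrow> (('i \<Rightarrow> complex) list \<Rightarrow> 'i \<Rightarrow> complex) \<Rightarrow> ('i \<Rightarrow> complex) \<Rightarrow>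
    ('i \<Rightarrow> complex) list \<Rightarrow> 'i \<Rightarrow> complex" where
  "deriv_form m M x [] = M (replicate m x)"
| "deriv_form m M x (k # rs) = (\<Sum>i<m. deriv_form (m - 1) (\<lambda>l. M (take i l @ k # drop i l)) x rs)"

lemma replicate_sub: "x \<in> X \<Longrightarrow> set (replicate m x) \<subseteq> X" by auto

text \<open>Each direction goes into at most \<open>m\<close> slots, which costs one factor
  \<open>m\<close> per derivative. The degree drops at each step, and \<open>1 \<le> \<rho>\<close>
  allows the power of \<open>\<rho>\<close> to be raised back to \<open>m\<close>.\<close>

lemma deriv_form_bound:
  assumes "multilin m A M" "x \<in> X" "N x \<le> \<rho>" "1 \<le> \<rho>" "set rs \<subseteq> X"
  shows "deriv_form m M x rs \<in> X \<and>
     N (deriv_form m M x rs) \<le> A * real m ^ length rs * \<rho> ^ m * prod_list (map N rs)"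
  using assms(1,5)
proof (induction rs arbitrary: m A M)
  case Nil
  have "N x ^ m \<le> \<rho> ^ m" using assms(3) N_nonneg[OF assms(2)] by (rule power_mono)
  then have "A * N x ^ m \<le> A * \<rho> ^ m" using multilinD(1)[OF Nil(1)] by (rule mult_left_mono)
  then show ?case
    using multilinD(2,3)[OF Nil(1) length_replicate replicate_sub[OF assms(2)]]
    by (simp add: prod_list_replicate)
next
  case (Cons k rs)
  show ?case
  proof (cases m)
    case 0
    then show ?thesis by (simp del: zero_fun_apply add: zero_mem N_zero)
  next
    case (Suc m')
    let ?P = "prod_list (map N rs)"
    have k: "k \<in> X" "set rs \<subseteq> X" using Cons by auto
    have P: "0 \<le> ?P" using k(2) by (intro prod_list_nonneg_real N_nonneg) auto
    note A = multilinD(1)[OF Cons.prems(1)]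
    have IH: "deriv_form m' (\<lambda>l. M (take i l @ k # drop i l)) x rs \<in> X \<and>
       N (deriv_form m' (\<lambda>l. M (take i l @ k # drop i l)) x rs) \<le> A * N k * real m' ^ length rs * \<rho> ^ m' * ?P"
      if "i < m" for i
      using that Suc k multilin_insert[of m' A M k i] Cons.prems(1) by (intro Cons.IH) auto
    have "N (deriv_form m M x (k # rs)) \<le> (\<Sum>i<m. N (deriv_form m' (\<lambda>l. M (take i l @ k # drop i l)) x rs))"
      using IH Suc by (simp del: sum.lessThan_Suc) (intro N_sum, auto)
    also have "\<dots> \<le> (\<Sum>i<m. A * N k * real m' ^ length rs * \<rho> ^ m' * ?P)"
      using IH by (intro sum_mono) auto
    also have "\<dots> = (A * N k * real m * ?P) * (real m' ^ length rs * \<rho> ^ m')" by simp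
    also have "\<dots> \<le> (A * N k * real m * ?P) * (real m ^ length rs * \<rho> ^ m)"
      using A P N_nonneg[OF k(1)] Suc assms(4)
      by (intro mult_left_mono mult_mono power_mono power_increasing) auto
    finally have "N (deriv_form m M x (k # rs)) \<le> A * real m ^ length (k # rs) * \<rho> ^ m * prod_list (map N (k # rs))"
      by (simp add: ac_simps)
    moreover have "deriv_form m M x (k # rs) \<in> X"
      using IH Suc by (simp del: sum.lessThan_Suc) (intro sum_mem, auto)
    ultimately show ?thesis by simp
  qed
qed

lemma deriv_form_lincomb:
  assumes "\<And>l. length l = m \<Longrightarrow> set l \<subseteq> X \<Longrightarrow> M l = a *\<^sub>R M1 l + b *\<^sub>R M2 l" "x \<in> X" "set rs \<subseteq> X"
  shows "deriv_form m M x rs = a *\<^sub>R deriv_form m M1 x rs + b *\<^sub>R deriv_form m M2 x rs"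
  using assms(1,3)
proof (induction rs arbitrary: m M M1 M2)
  case Nil
  show ?case using Nil(1)[OF length_replicate replicate_sub[OF assms(2)]] by simp
next
  case (Cons k rs)
  have "deriv_form (m - 1) (\<lambda>l. M (take i l @ k # drop i l)) x rs =
     a *\<^sub>R deriv_form (m - 1) (\<lambda>l. M1 (take i l @ k # drop i l)) x rs + b *\<^sub>R deriv_form (m - 1) (\<lambda>l. M2 (take i l @ k # drop i l)) x rs"
    if "i < m" for i
    using that Cons.prems(2) by (intro Cons.IH Cons.prems(1)) (auto dest: in_set_takeD in_set_dropD)
  then show ?case unfolding append_Nil append_Cons deriv_form.simps by (intro sum_lincomb) simp
qed

text \<open>Induction on the directions before the varied one. Once that one is reached, linearity
  is that of the form \<open>M\<close> in the slot being filled, and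
  \<open>deriv_form_lincomb\<close> carries it through the remaining derivatives.\<close>

lemma deriv_form_linear:
  assumes "multilin m A M" "x \<in> X" "set ps \<subseteq> X" "set qs \<subseteq> X" "u \<in> X" "v \<in> X"
  shows "deriv_form m M x (ps @ (a *\<^sub>R u + b *\<^sub>R v) # qs) =
     a *\<^sub>R deriv_form m M x (ps @ u # qs) + b *\<^sub>R deriv_form m M x (ps @ v # qs)"
  using assms(1,3)
proof (induction ps arbitrary: m A M)
  case Nil
  have "deriv_form (m - 1) (\<lambda>l. M (take i l @ (a *\<^sub>R u + b *\<^sub>R v) # drop i l)) x qs =
     a *\<^sub>R deriv_form (m - 1) (\<lambda>l. M (take i l @ u # drop i l)) x qs + b *\<^sub>R deriv_form (m - 1) (\<lambda>l. M (take i l @ v # drop i l)) x qs"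
    if "i < m" for i
    using that assms
    by (intro deriv_form_lincomb multilinD(4)[OF Nil(1)]) (auto dest: in_set_takeD in_set_dropD)
  then show ?case unfolding append_Nil append_Cons deriv_form.simps by (intro sum_lincomb) simp
next
  case (Cons k ps)
  have "deriv_form (m - 1) (\<lambda>l. M (take i l @ k # drop i l)) x (ps @ (a *\<^sub>R u + b *\<^sub>R v) # qs) =
     a *\<^sub>R deriv_form (m - 1) (\<lambda>l. M (take i l @ k # drop i l)) x (ps @ u # qs)
     + b *\<^sub>R deriv_form (m - 1) (\<lambda>l. M (take i l @ k # drop i l)) x (ps @ v # qs)"
    if "i < m" for i
    using that Cons.prems multilin_insert[of "m - 1" A M k i] by (intro Cons.IH[of _ "A * N k"]) auto
  then show ?case unfolding append_Nil append_Cons deriv_form.simps by (intro sum_lincomb) simp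
qed


lemma multilin_add_Cons:
  assumes "multilin (Suc m) A M" "x \<in> X" "h \<in> X" "set l \<subseteq> X" "length l = m"
  shows "M ((x + h) # l) = M (x # l) + M (h # l)"
  using multilinD(4)[OF assms(1), of "[]" l x h 1 1] assms by (simp del: plus_fun_apply)

text \<open>Telescoping in the first slot: the difference is that of the form with
  \<open>x + h\<close> frozen there, plus the term with \<open>h\<close> in the first slot and
  \<open>x\<close> elsewhere. Each of the \<open>m\<close> slots contributes one factor
  \<open>N h\<close>.\<close>

lemma diagonal_diff_bound:
  assumes "multilin m A M" "x \<in> X" "h \<in> X" "N x \<le> \<rho>" "N (x + h) \<le> \<rho>" "1 \<le> \<rho>"
  shows "N (M (replicate m (x + h)) - M (replicate m x)) \<le> A * real m * \<rho> ^ m * N h"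
  using assms(1)
proof (induction m arbitrary: A M)
  case 0
  then show ?case by (simp add: N_zero del: zero_fun_apply)
next
  case (Suc m)
  let ?r' = "replicate m (x + h)" and ?r = "replicate m x"
  have xh: "x + h \<in> X" using assms by (intro add_mem)
  have Nh: "0 \<le> N h" and Nx: "0 \<le> N x" using assms N_nonneg by auto
  note A = multilinD(1)[OF Suc.prems]
  have eq: "M (replicate (Suc m) (x + h)) - M (replicate (Suc m) x)
      = (M ((x + h) # ?r') - M ((x + h) # ?r)) + M (h # ?r)"
    using multilin_add_Cons[OF Suc.prems assms(2,3) replicate_sub[OF assms(2)]] by (simp add: algebra_simps)
  have m1: "M ((x + h) # ?r') \<in> X" "M ((x + h) # ?r) \<in> X" "M (h # ?r) \<in> X"
    using xh assms by (auto intro!: multilinD(2)[OF Suc.prems])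
  have 1: "N (M ((x + h) # ?r') - M ((x + h) # ?r)) \<le> A * N (x + h) * real m * \<rho> ^ m * N h"
    using Suc.IH[OF multilin_Cons[OF Suc.prems xh]] .
  also have "\<dots> \<le> A * \<rho> * real m * \<rho> ^ m * N h"
    using A Nh assms by (intro mult_right_mono mult_left_mono) auto
  finally have 1: "N (M ((x + h) # ?r') - M ((x + h) # ?r)) \<le> A * \<rho> * real m * \<rho> ^ m * N h" .
  have "N (M (h # ?r)) \<le> A * (N h * N x ^ m)"
    using multilinD(3)[OF Suc.prems, of "h # ?r"] assms(2,3) replicate_sub[OF assms(2)]
    by (simp add: prod_list_replicate)
  also have "\<dots> \<le> A * (N h * \<rho> ^ Suc m)"
    using A Nh order_trans[OF power_mono[OF assms(4) Nx] power_increasing[of m "Suc m" \<rho>]] assms(6)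
    by (intro mult_left_mono) auto
  finally have 2: "N (M (h # ?r)) \<le> A * (N h * \<rho> ^ Suc m)" .
  have "N (M (replicate (Suc m) (x + h)) - M (replicate (Suc m) x))
      \<le> A * \<rho> * real m * \<rho> ^ m * N h + A * (N h * \<rho> ^ Suc m)"
    unfolding eq using N_add[OF diff_mem[OF m1(1,2)] m1(3)] 1 2 by linarith
  also have "\<dots> = A * real (Suc m) * \<rho> ^ Suc m * N h" by (simp add: algebra_simps)
  finally show ?case .
qed

text \<open>Splitting off the first slot, the derivative either puts \<open>h\<close> there or
  differentiates the form with \<open>x\<close> frozen there. What is left over is the remainder for
  that smaller form, plus a diagonal difference of the form with \<open>h\<close> frozen, which is
  again of second order in \<open>h\<close>.\<close>

lemma diagonal_remainder_bound:
  assumes "multilin m A M" "x \<in> X" "h \<in> X" "N x \<le> \<rho>" "N (x + h) \<le> \<rho>" "1 \<le> \<rho>"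
  shows "N (M (replicate m (x + h)) - M (replicate m x) - deriv_form m M x [h])
           \<le> A * (real m)\<^sup>2 * \<rho> ^ m * (N h)\<^sup>2"
  using assms(1)
proof (induction m arbitrary: A M)
  case 0
  then show ?case by (simp add: N_zero del: zero_fun_apply)
next
  case (Suc m)
  let ?r' = "replicate m (x + h)" and ?r = "replicate m x" and ?Mx = "\<lambda>l. M (x # l)"
  have xh: "x + h \<in> X" using assms by (intro add_mem)
  have Nh: "0 \<le> N h" and Nx: "0 \<le> N x" using assms N_nonneg by auto
  note A = multilinD(1)[OF Suc.prems]
  note mx = multilin_Cons[OF Suc.prems assms(2)] and mh = multilin_Cons[OF Suc.prems assms(3)]
  have D: "deriv_form (Suc m) M x [h] = M (h # ?r) + deriv_form m ?Mx x [h]"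
  proof -
    have "deriv_form (Suc m) M x [h] = (\<Sum>i<Suc m. M (take i ?r @ h # drop i ?r))" by simp
    also have "\<dots> = M (h # ?r) + (\<Sum>i<m. M (take (Suc i) ?r @ h # drop (Suc i) ?r))"
      by (subst sum.lessThan_Suc_shift) simp
    also have "(\<Sum>i<m. M (take (Suc i) ?r @ h # drop (Suc i) ?r)) = deriv_form m ?Mx x [h]"
      unfolding deriv_form.simps by (intro sum.cong refl) (cases m; auto)
    finally show ?thesis .
  qed
  have eq: "M (replicate (Suc m) (x + h)) - M (replicate (Suc m) x) - deriv_form (Suc m) M x [h]
      = (?Mx ?r' - ?Mx ?r - deriv_form m ?Mx x [h]) + (M (h # ?r') - M (h # ?r))"
    unfolding D using multilin_add_Cons[OF Suc.prems assms(2,3) replicate_sub[OF xh]] by (simp add: algebra_simps)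
  have dm: "deriv_form m ?Mx x [h] \<in> X"
    using deriv_form_bound[OF mx assms(2,4,6), of "[h]"] assms(3) by simp
  have m1: "M (x # ?r') \<in> X" "M (x # ?r) \<in> X" "M (h # ?r') \<in> X" "M (h # ?r) \<in> X"
    using xh assms by (auto intro!: multilinD(2)[OF Suc.prems])
  have "N (?Mx ?r' - ?Mx ?r - deriv_form m ?Mx x [h]) \<le> A * N x * (real m)\<^sup>2 * \<rho> ^ m * (N h)\<^sup>2"
    using Suc.IH[OF mx] .
  also have "\<dots> \<le> A * \<rho> * (real m)\<^sup>2 * \<rho> ^ m * (N h)\<^sup>2"
    using A Nh assms by (intro mult_right_mono mult_left_mono) auto
  finally have 1: "N (?Mx ?r' - ?Mx ?r - deriv_form m ?Mx x [h]) \<le> A * \<rho> * (real m)\<^sup>2 * \<rho> ^ m * (N h)\<^sup>2" .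
  have "N (M (h # ?r') - M (h # ?r)) \<le> A * N h * real m * \<rho> ^ m * N h"
    using diagonal_diff_bound[OF mh assms(2-6)] .
  \<comment> \<open>The factor \<open>m\<close> is enlarged to \<open>2 * m + 1\<close> so that it
    completes \<open>m^2\<close> to \<open>(m + 1)^2\<close>.\<close>
  also have "\<dots> \<le> A * N h * (2 * real m + 1) * \<rho> ^ Suc m * N h"
    using A Nh assms by (intro mult_right_mono mult_mono mult_left_mono power_increasing) auto
  finally have 2: "N (M (h # ?r') - M (h # ?r)) \<le> A * N h * (2 * real m + 1) * \<rho> ^ Suc m * N h" .
  have "N (M (replicate (Suc m) (x + h)) - M (replicate (Suc m) x) - deriv_form (Suc m) M x [h])
      \<le> A * \<rho> * (real m)\<^sup>2 * \<rho> ^ m * (N h)\<^sup>2 + A * N h * (2 * real m + 1) * \<rho> ^ Suc m * N h"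
    unfolding eq using N_add[OF diff_mem[OF diff_mem[OF m1(1,2)] dm] diff_mem[OF m1(3,4)]] 1 2 by linarith
  also have "\<dots> = A * (real (Suc m))\<^sup>2 * \<rho> ^ Suc m * (N h)\<^sup>2"
    by (simp add: algebra_simps power2_eq_square)
  finally show ?case .
qed

text \<open>The exponent of \<open>m\<close> counts one factor for each direction in
  \<open>rs\<close> and two for the quadratic remainder on the diagonal, which is the base case of
  the induction.\<close>

lemma deriv_form_remainder_bound:
  assumes "multilin m A M" "x \<in> X" "h \<in> X" "N x \<le> \<rho>" "N (x + h) \<le> \<rho>" "1 \<le> \<rho>" "set rs \<subseteq> X"
  shows "N (deriv_form m M (x + h) rs - deriv_form m M x rs - deriv_form m M x (rs @ [h]))
           \<le> A * real m ^ (length rs + 2) * \<rho> ^ m * ((N h)\<^sup>2 * prod_list (map N rs))"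
  using assms(1,7)
proof (induction rs arbitrary: m A M)
  case Nil
  then show ?case using diagonal_remainder_bound[OF Nil(1) assms(2-6)]
    by (simp add: ac_simps power2_eq_square[of "real m"] del: deriv_form.simps(2) plus_fun_apply minus_apply)
next
  case (Cons k rs)
  have xh: "x + h \<in> X" using assms by (intro add_mem)
  show ?case
  proof (cases m)
    case 0
    then show ?thesis by (simp add: N_zero del: zero_fun_apply)
  next
    case (Suc m')
    let ?P = "(N h)\<^sup>2 * prod_list (map N rs)"
    let ?I = "\<lambda>i l. M (take i l @ k # drop i l)"
    have k: "k \<in> X" "set rs \<subseteq> X" using Cons by auto
    have P: "0 \<le> ?P" using k(2) by (intro mult_nonneg_nonneg prod_list_nonneg_real N_nonneg) auto
    note A = multilinD(1)[OF Cons.prems(1)]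
    have ml: "multilin m' (A * N k) (?I i)" if "i < m" for i
      using that Suc Cons.prems(1) k(1) by (intro multilin_insert) auto
    let ?d = "\<lambda>i. deriv_form m' (?I i) (x + h) rs - deriv_form m' (?I i) x rs - deriv_form m' (?I i) x (rs @ [h])"
    have mem: "?d i \<in> X" if "i < m" for i
      using deriv_form_bound[OF ml[OF that] xh assms(5,6) k(2)]
        deriv_form_bound[OF ml[OF that] assms(2,4,6) k(2)]
        deriv_form_bound[OF ml[OF that] assms(2,4,6), of "rs @ [h]"] k assms(3)
      by (auto intro!: diff_mem)
    have IH: "N (?d i) \<le> A * N k * real m' ^ (length rs + 2) * \<rho> ^ m' * ?P" if "i < m" for i
      by (rule Cons.IH[OF ml[OF that] k(2)])
    have eq: "deriv_form m M (x + h) (k # rs) - deriv_form m M x (k # rs) - deriv_form m M x ((k # rs) @ [h])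
       = (\<Sum>i<m. ?d i)"
      using Suc by (simp add: sum_subtractf del: sum.lessThan_Suc plus_fun_apply minus_apply)
    have "N (\<Sum>i<m. ?d i) \<le> (\<Sum>i<m. N (?d i))" using mem by (intro N_sum) auto
    also have "\<dots> \<le> (\<Sum>i<m. A * N k * real m' ^ (length rs + 2) * \<rho> ^ m' * ?P)"
      using IH by (intro sum_mono) auto
    also have "\<dots> = (A * N k * real m * ?P) * (real m' ^ (length rs + 2) * \<rho> ^ m')" by simp
    also have "\<dots> \<le> (A * N k * real m * ?P) * (real m ^ (length rs + 2) * \<rho> ^ m)"
      using A P N_nonneg[OF k(1)] Suc assms(6)
      by (intro mult_left_mono mult_mono power_mono power_increasing) auto
    finally show ?thesis unfolding eq by (simp add: ac_simps del: plus_fun_apply minus_apply)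
  qed
qed

section \<open>Smooth dependence of a power series on the data\<close>

lemma power_path_diff:
  assumes "\<And>n. f n \<in> X" "\<And>n. N (f n) * R ^ n \<le> B n" "summable B"
    and "\<And>n. g n \<in> X" "\<And>n. N (g n) * R ^ n \<le> B' n" "summable B'"
  shows "power_path R (\<lambda>n. f n - g n) = power_path R f - power_path R g"
  using power_path_lincomb[OF assms, of 1 "-1"] by simp

text \<open>The series is differentiated term by term. A derivative of order \<open>k\<close>
  multiplies the bound of the \<open>n\<close>-th term by \<open>m n ^ k\<close>, and its remainder
  by two further powers, so summability for every \<open>k\<close> is exactly what all orders
  require.\<close>

lemma power_path_smooth:
  fixes m :: "nat \<Rightarrow> nat"
  assumes M: "\<And>n. multilin (m n) (A n) (M n)" and m: "\<And>n. n \<le> m n"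
    and \<rho>: "1 \<le> \<rho>" and R: "R > 0"
    and summ: "\<And>k. summable (\<lambda>n. A n * real (m n) ^ k * \<rho> ^ m n * R ^ n)"
    and U: "U \<subseteq> {v \<in> X. N v \<le> \<rho>}"
  shows "smooth_map_on X N (path_space R X N) (path_norm R N) U
           (\<lambda>v. power_path R (\<lambda>n. M n (replicate (m n) v)))"
proof -
  let ?W = "\<lambda>k n. A n * real (m n) ^ k * \<rho> ^ m n * R ^ n"
  \<comment> \<open>\<open>smooth_map_on\<close> puts the newest direction first, whereas
    \<open>deriv_form\<close> expects it last; hence the reversal.\<close>
  let ?d = "\<lambda>x hs n. deriv_form (m n) (M n) x (rev hs)"
  let ?D = "\<lambda>x hs. power_path R (?d x hs)"
  let ?P = "\<lambda>hs. prod_list (map N hs)"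
  have A: "0 \<le> A n" for n using multilinD(1)[OF M] .
  have P: "0 \<le> ?P hs" if "set hs \<subseteq> X" for hs
    using that by (intro prod_list_nonneg_real N_nonneg) auto
  have Prev: "?P (rev hs) = ?P hs" for hs by (induction hs) auto
  have d: "?d x hs n \<in> X" "N (?d x hs n) * R ^ n \<le> ?W (length hs) n * ?P hs"
    if "x \<in> U" "set hs \<subseteq> X" for x hs n
  proof -
    have *: "?d x hs n \<in> X \<and> N (?d x hs n) \<le> A n * real (m n) ^ length (rev hs) * \<rho> ^ m n * ?P (rev hs)"
      using that U \<rho> by (intro deriv_form_bound[OF M]) auto
    then show "?d x hs n \<in> X" by simp
    from * show "N (?d x hs n) * R ^ n \<le> ?W (length hs) n * ?P hs"
      unfolding Prev length_rev using R by (auto dest!: mult_right_mono[where c = "R ^ n"] simp: ac_simps)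
  qed
  have summP: "summable (\<lambda>n. ?W k n * c)" for k c using summ by (rule summable_mult2)
  have summn: "summable (\<lambda>n. real n * (?W k n * ?P hs))" if "set hs \<subseteq> X" for k hs
  proof (rule summable_comparison_test)
    \<comment> \<open>The factor \<open>n\<close> that continuity in time demands is absorbed, by
      \<open>n \<le> m n\<close>, into one more power of the degree.\<close>
    have "real n * (?W k n * ?P hs) \<le> ?W (Suc k) n * ?P hs" for n
    proof -
      have "real n * (?W k n * ?P hs) \<le> real (m n) * (?W k n * ?P hs)"
        using A P[OF that] \<rho> R m by (intro mult_right_mono mult_nonneg_nonneg) auto
      then show ?thesis by (simp add: ac_simps)
    qed
    moreover have "0 \<le> real n * (?W k n * ?P hs)" for n
      using A P[OF that] \<rho> R by (intro mult_nonneg_nonneg) auto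
    ultimately show "\<exists>n0. \<forall>n\<ge>n0. norm (real n * (?W k n * ?P hs)) \<le> ?W (Suc k) n * ?P hs" by simp
    show "summable (\<lambda>n. ?W (Suc k) n * ?P hs)" by (rule summP)
  qed
  have mem: "?D x hs \<in> path_space R X N" if "x \<in> U" "set hs \<subseteq> X" for x hs
    by (rule power_path_mem[OF d[OF that] summP summn[OF that(2)] R])
  have multilin: "bounded_multilinear_on X N (path_space R X N) (path_norm R N) k (?D x)" if x: "x \<in> U" for x k
    unfolding bounded_multilinear_on_def
  proof (intro conjI allI impI exI)
    fix hs assume "length hs = k \<and> set hs \<subseteq> X"
    then show "?D x hs \<in> path_space R X N" by (intro mem x) auto
  next
    fix hs :: "('i \<Rightarrow> complex) list" and i a b u v
    assume h: "length hs = k \<and> set hs \<subseteq> X \<and> i < k \<and> u \<in> X \<and> v \<in> X"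
    then have sub: "set (rev (drop (Suc i) hs)) \<subseteq> X" "set (rev (take i hs)) \<subseteq> X"
      by (auto dest: in_set_takeD in_set_dropD)
    have upd: "rev (hs[i := z]) = rev (drop (Suc i) hs) @ z # rev (take i hs)" for z
      using h by (simp add: upd_conv_take_nth_drop)
    have set_upd: "set (hs[i := z]) \<subseteq> X" if "z \<in> X" for z
      using h that set_update_subset_insert[of hs i z] by auto
    have lin: "?d x (hs[i := a *\<^sub>R u + b *\<^sub>R v]) = (\<lambda>n. a *\<^sub>R ?d x (hs[i := u]) n + b *\<^sub>R ?d x (hs[i := v]) n)"
    proof
      fix n show "?d x (hs[i := a *\<^sub>R u + b *\<^sub>R v]) n = a *\<^sub>R ?d x (hs[i := u]) n + b *\<^sub>R ?d x (hs[i := v]) n"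
        unfolding upd using sub h x U by (intro deriv_form_linear[OF M]) auto
    qed
    show "?D x (hs[i := a *\<^sub>R u + b *\<^sub>R v]) = a *\<^sub>R ?D x (hs[i := u]) + b *\<^sub>R ?D x (hs[i := v])"
      unfolding lin
      using h by (intro power_path_lincomb[OF d[OF x set_upd] summP d[OF x set_upd] summP]) auto
  next
    fix hs assume h: "length hs = k \<and> set hs \<subseteq> X"
    have "path_norm R N (?D x hs) \<le> (\<Sum>n. ?W (length hs) n * ?P hs)"
      using h by (intro path_norm_power_path[OF d[OF x] summP R]) auto
    also have "\<dots> = suminf (?W k) * ?P hs"
      using h suminf_mult2[OF summ] by simp
    finally show "path_norm R N (?D x hs) \<le> suminf (?W k) * ?P hs" .
  qed
  have rem: "path_norm R N (?D (x + h) hs - ?D x hs - ?D x (h # hs)) \<le> suminf (?W (length hs + 2)) * ((N h)\<^sup>2 * ?P hs)"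
    if "x \<in> U" "x + h \<in> U" "h \<in> X" "set hs \<subseteq> X" for x h hs
  proof -
    have hhs: "set (h # hs) \<subseteq> X" using that by auto
    let ?B = "\<lambda>n. ?W (length hs) n * ?P hs"
    let ?e = "\<lambda>n. ?d (x + h) hs n - ?d x hs n"
    have e: "?e n \<in> X" "N (?e n) * R ^ n \<le> ?B n + ?B n" for n
    proof -
      show "?e n \<in> X" by (intro diff_mem d that)
      have "N (?e n) \<le> N (?d (x + h) hs n) + N (?d x hs n)" by (intro N_diff d that)
      then have "N (?e n) * R ^ n \<le> N (?d (x + h) hs n) * R ^ n + N (?d x hs n) * R ^ n"
        using R mult_right_mono[of _ _ "R ^ n"] by (simp only: distrib_right[symmetric]) simp
      then show "N (?e n) * R ^ n \<le> ?B n + ?B n"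
        using d(2)[OF that(2,4), of n] d(2)[OF that(1,4), of n] by linarith
    qed
    have eq: "?D (x + h) hs - ?D x hs - ?D x (h # hs) = power_path R (\<lambda>n. ?e n - ?d x (h # hs) n)"
      unfolding power_path_diff[OF d[OF that(2,4)] summP d[OF that(1,4)] summP]
        power_path_diff[OF e summable_add[OF summP summP] d[OF that(1) hhs] summP] ..
    have "path_norm R N (power_path R (\<lambda>n. ?e n - ?d x (h # hs) n)) \<le> (\<Sum>n. ?W (length hs + 2) n * ((N h)\<^sup>2 * ?P hs))"
    proof (rule path_norm_power_path[OF _ _ summP R])
      fix n
      show "?e n - ?d x (h # hs) n \<in> X" by (intro diff_mem e d that hhs)
      have "N (?e n - ?d x (h # hs) n) \<le> A n * real (m n) ^ (length hs + 2) * \<rho> ^ m n * ((N h)\<^sup>2 * ?P hs)"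
        using deriv_form_remainder_bound[OF M, of x h \<rho> "rev hs" n] that U \<rho> by (auto simp: Prev)
      then show "N (?e n - ?d x (h # hs) n) * R ^ n \<le> ?W (length hs + 2) n * ((N h)\<^sup>2 * ?P hs)"
        using R by (auto dest!: mult_right_mono[where c = "R ^ n"] simp: ac_simps)
    qed
    also have "\<dots> = suminf (?W (length hs + 2)) * ((N h)\<^sup>2 * ?P hs)"
      by (rule suminf_mult2[OF summ, symmetric])
    finally show ?thesis unfolding eq .
  qed
  show ?thesis unfolding smooth_map_on_def
  proof (intro exI[of _ ?D] conjI ballI allI impI)
    fix x assume "x \<in> U" show "?D x [] = power_path R (\<lambda>n. M n (replicate (m n) x))" by simp
  next
    fix x k assume "x \<in> U" then show "bounded_multilinear_on X N (path_space R X N) (path_norm R N) k (?D x)"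
      by (rule multilin)
  next
    fix x k and \<epsilon> :: real assume x: "x \<in> U" and \<epsilon>: "\<epsilon> > 0"
    let ?S = "suminf (?W (k + 2))"
    have S: "0 \<le> ?S" using A \<rho> R by (intro suminf_nonneg[OF summ] mult_nonneg_nonneg) auto
    show "\<exists>\<delta>>0. \<forall>h\<in>X. N h < \<delta> \<and> x + h \<in> U \<longrightarrow> (\<forall>hs. length hs = k \<and> set hs \<subseteq> X \<longrightarrow>
      path_norm R N (?D (x + h) hs - ?D x hs - ?D x (h # hs)) \<le> \<epsilon> * N h * ?P hs)"
    \<comment> \<open>The remainder is at most \<open>?S * (N h)^2\<close> times the norms of the
      directions, so one factor \<open>N h\<close> has to compensate for \<open>?S\<close>; the
      added \<open>1\<close> keeps the divisor positive.\<close>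
    proof (intro exI[of _ "\<epsilon> / (?S + 1)"] conjI ballI impI allI)
      show "0 < \<epsilon> / (?S + 1)" using S \<epsilon> by simp
    next
      fix h hs assume h: "h \<in> X" "N h < \<epsilon> / (?S + 1) \<and> x + h \<in> U" and hs: "length hs = k \<and> set hs \<subseteq> X"
      have "?S * N h \<le> (?S + 1) * N h" using N_nonneg[OF h(1)] by (intro mult_right_mono) auto
      also have "\<dots> \<le> \<epsilon>" using h(2) S by (simp add: pos_less_divide_eq ac_simps)
      finally have "?S * N h * (N h * ?P hs) \<le> \<epsilon> * (N h * ?P hs)"
        using P hs N_nonneg[OF h(1)] by (intro mult_right_mono) auto
      then show "path_norm R N (?D (x + h) hs - ?D x hs - ?D x (h # hs)) \<le> \<epsilon> * N h * ?P hs"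
        using rem[of x h hs] x h hs by (simp add: power2_eq_square ac_simps)
    qed
  qed
qed

end

section \<open>Norm estimates from pointwise time derivatives\<close>

text \<open>The fundamental theorem of calculus, stated with finite sums: these remain in the space
  \<open>X\<close>, so the Fatou property can be applied to them.\<close>

lemma riemann_sum_tendsto:
  fixes F f :: "real \<Rightarrow> 'a::real_normed_vector"
  assumes b: "0 \<le> b" and D: "\<And>s. s \<in> {0..b} \<Longrightarrow> (F has_vector_derivative f s) (at s within {0..b})"
    and cont: "continuous_on {0..b} f"
  shows "(\<lambda>n. \<Sum>i<n. (b / real n) *\<^sub>R f (real i * b / real n)) \<longlonglongrightarrow> F b - F 0"
proof (rule LIMSEQ_I)
  fix r :: real assume r: "r > 0"
  have "uniformly_continuous_on {0..b} f" by (rule compact_uniformly_continuous[OF cont]) simp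
  \<comment> \<open>Dividing by \<open>b + 1\<close> gives \<open>b * \<epsilon> < r\<close> and
    also covers \<open>b = 0\<close>.\<close>
  moreover define \<epsilon> where "\<epsilon> = r / (b + 1)"
  moreover have \<epsilon>: "\<epsilon> > 0" "b * \<epsilon> < r" using b r by (auto simp: \<epsilon>_def field_simps)
  ultimately obtain \<delta> where \<delta>: "\<delta> > 0"
    "\<And>x y. x \<in> {0..b} \<Longrightarrow> y \<in> {0..b} \<Longrightarrow> dist y x < \<delta> \<Longrightarrow> dist (f y) (f x) < \<epsilon>"
    unfolding uniformly_continuous_on_def by metis
  obtain n0 :: nat where n0: "b / \<delta> < real n0" using reals_Archimedean2 by blast
  have "norm ((\<Sum>i<n. (b / real n) *\<^sub>R f (real i * b / real n)) - (F b - F 0)) < r" if n: "n \<ge> Suc n0" for n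
  proof -
    let ?x = "\<lambda>i. real i * b / real n"
    have npos: "real n > 0" using n by simp
    have h: "b / n < \<delta>"
    proof -
      have "b / \<delta> < real n" using n0 n by linarith
      then show ?thesis using \<delta>(1) npos by (simp add: field_simps)
    qed
    have step: "norm ((b / n) *\<^sub>R f (?x i) - (F (?x (Suc i)) - F (?x i))) \<le> \<epsilon> * (b / n)" if i: "i < n" for i
    proof -
      have x: "0 \<le> ?x i" "?x i \<le> ?x (Suc i)" "?x (Suc i) \<le> b" "?x (Suc i) - ?x i = b / n"
        using b npos i mult_left_mono[of "1 + real i" "real n" b] by (auto simp: field_simps)
      let ?S = "{?x i..?x (Suc i)}"
      have sub: "?S \<subseteq> {0..b}" using x by auto
      \<comment> \<open>Mean value inequality for \<open>F s - s *\<^sub>R f (?x i)\<close>: its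
        derivative \<open>f s - f (?x i)\<close> is at most \<open>\<epsilon>\<close> on the
        subinterval by uniform continuity.\<close>
      have "norm ((F (?x (Suc i)) - ?x (Suc i) *\<^sub>R f (?x i)) - (F (?x i) - ?x i *\<^sub>R f (?x i)))
          \<le> \<epsilon> * norm (?x (Suc i) - ?x i)"
      proof (rule differentiable_bound[where S = ?S and f' = "\<lambda>s v. v *\<^sub>R (f s - f (?x i))"])
        show "convex ?S" by simp
        show "((\<lambda>s. F s - s *\<^sub>R f (?x i)) has_derivative (\<lambda>v. v *\<^sub>R (f s - f (?x i)))) (at s within ?S)"
          if "s \<in> ?S" for s
        proof -
          have "(F has_vector_derivative f s) (at s within ?S)"
            using D[of s] that sub by (intro has_vector_derivative_within_subset[OF D sub]) auto
          then have "((\<lambda>s. F s - s *\<^sub>R f (?x i)) has_vector_derivative (f s - f (?x i))) (at s within ?S)"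
            by (auto intro!: derivative_eq_intros)
          then show ?thesis by (simp add: has_vector_derivative_def)
        qed
        show "onorm (\<lambda>v. v *\<^sub>R (f s - f (?x i))) \<le> \<epsilon>" if "s \<in> ?S" for s
        proof -
          have "dist s (?x i) < \<delta>" using that h x(4) by (auto simp: dist_real_def)
          then have "dist (f s) (f (?x i)) < \<epsilon>" using that sub x by (intro \<delta>(2)) auto
          then show ?thesis by (simp add: onorm_scaleR_left onorm_id bounded_linear_ident dist_norm)
        qed
        show "?x (Suc i) \<in> ?S" "?x i \<in> ?S" using x by auto
      qed
      then have A: "norm ((F (?x (Suc i)) - ?x (Suc i) *\<^sub>R f (?x i)) - (F (?x i) - ?x i *\<^sub>R f (?x i)))
          \<le> \<epsilon> * (b / n)" unfolding x(4) using b by simp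
      have B: "(F (?x (Suc i)) - ?x (Suc i) *\<^sub>R f (?x i)) - (F (?x i) - ?x i *\<^sub>R f (?x i))
          = - ((b / n) *\<^sub>R f (?x i) - (F (?x (Suc i)) - F (?x i)))"
        by (simp add: x(4)[symmetric] scaleR_diff_left)
      show ?thesis using A unfolding B norm_minus_cancel .
    qed
    have "F b - F 0 = (\<Sum>i<n. F (?x (Suc i)) - F (?x i))"
      using npos by (subst sum_lessThan_telescope) auto
    then have "norm ((\<Sum>i<n. (b / n) *\<^sub>R f (?x i)) - (F b - F 0))
        = norm (\<Sum>i<n. (b / n) *\<^sub>R f (?x i) - (F (?x (Suc i)) - F (?x i)))"
      by (simp add: sum_subtractf)
    also have "\<dots> \<le> (\<Sum>i<n. \<epsilon> * (b / n))" using step by (intro sum_norm_le) auto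
    also have "\<dots> = b * \<epsilon>" using npos by simp
    finally show ?thesis using \<epsilon> by simp
  qed
  then show "\<exists>no. \<forall>n\<ge>no. norm ((\<Sum>i<n. (b / real n) *\<^sub>R f (real i * b / real n)) - (F b - F 0)) < r" by blast
qed

context banach_fun
begin

text \<open>The Riemann sums of \<open>e\<close> lie in \<open>X\<close>, are bounded in norm by
  those of \<open>q\<close>, and converge pointwise to \<open>F b - F 0\<close>.\<close>

lemma mean_value_bound:
  assumes b: "0 \<le> b"
    and F: "\<And>s. s \<in> {0..b} \<Longrightarrow> F s \<in> X" and e: "\<And>s. s \<in> {0..b} \<Longrightarrow> e s \<in> X"
    and D: "\<And>s z. s \<in> {0..b} \<Longrightarrow> ((\<lambda>s. F s z) has_vector_derivative e s z) (at s within {0..b})"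
    and cont: "\<And>z. continuous_on {0..b} (\<lambda>s. e s z)"
    and le: "\<And>s. s \<in> {0..b} \<Longrightarrow> N (e s) \<le> q s"
    and Q: "\<And>s. s \<in> {0..b} \<Longrightarrow> (Q has_vector_derivative q s) (at s within {0..b})"
    and contq: "continuous_on {0..b} q"
  shows "N (F b - F 0) \<le> Q b - Q 0"
proof (rule field_le_epsilon)
  fix r :: real assume r: "r > 0"
  let ?x = "\<lambda>n i. real i * b / real n"
  let ?g = "\<lambda>n. \<Sum>i<n. (b / real n) *\<^sub>R e (?x n i)"
  have x: "?x n i \<in> {0..b}" if "i < n" for i n :: nat
    using that b by (auto simp: field_simps mult_left_mono)
  have g: "?g n \<in> X" for n using x by (intro sum_mem scaleR_mem e) auto
  have gN: "N (?g n) \<le> (\<Sum>i<n. (b / real n) *\<^sub>R q (?x n i))" for n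
  proof -
    have "N (?g n) \<le> (\<Sum>i<n. N ((b / real n) *\<^sub>R e (?x n i)))"
      using x by (intro N_sum scaleR_mem e) auto
    also have "\<dots> \<le> (\<Sum>i<n. (b / real n) *\<^sub>R q (?x n i))"
      using x b by (intro sum_mono) (auto simp: N_scaleR[OF e] simp del: divide_le_eq intro!: mult_left_mono divide_right_mono le)
    finally show ?thesis .
  qed
  have "eventually (\<lambda>n. (\<Sum>i<n. (b / real n) *\<^sub>R q (?x n i)) < Q b - Q 0 + r) sequentially"
    using r by (intro order_tendstoD(2)[OF riemann_sum_tendsto[OF b Q contq]]) auto
  then obtain n0 where n0: "\<And>n. n \<ge> n0 \<Longrightarrow> (\<Sum>i<n. (b / real n) *\<^sub>R q (?x n i)) < Q b - Q 0 + r"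
    unfolding eventually_sequentially by blast
  \<comment> \<open>The sums of \<open>q\<close> only approach \<open>Q b - Q 0\<close>. The slack
    \<open>r\<close> and the removal of the first \<open>n0\<close> sums give the single bound that
    \<open>fatou\<close> requires.\<close>
  have "F b - F 0 \<in> X \<and> N (F b - F 0) \<le> Q b - Q 0 + r"
  proof (rule fatou[of "\<lambda>n. ?g (n + n0)"])
    show "?g (n + n0) \<in> X" for n by (rule g)
    show "N (?g (n + n0)) \<le> Q b - Q 0 + r" for n using gN[of "n + n0"] n0[of "n + n0"] by linarith
    fix z
    have "(\<lambda>n. ?g n z) \<longlonglongrightarrow> (F b - F 0) z"
      using riemann_sum_tendsto[OF b D cont, of z] by (simp add: sum_fun_apply)
    then show "(\<lambda>n. ?g (n + n0) z) \<longlonglongrightarrow> (F b - F 0) z" by (rule LIMSEQ_ignore_initial_segment)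
  qed
  then show "N (F b - F 0) \<le> Q b - Q 0 + r" by simp
qed

lemma path_bounded:
  assumes "w \<in> path_space R X N"
  shows "\<exists>r. \<forall>t\<in>{0..R}. N (w t) \<le> r"
proof -
  have wX: "\<And>t. t \<in> {0..R} \<Longrightarrow> w t \<in> X"
    and lim: "\<And>t. t \<in> {0..R} \<Longrightarrow> ((\<lambda>s. N (w s - w t)) \<longlongrightarrow> 0) (at t within {0..R})"
    using assms by (auto simp: path_space_def)
  have "continuous_on {0..R} (\<lambda>s. N (w s))"
    unfolding continuous_on_def
  proof
    fix t assume t: "t \<in> {0..R}"
    have "((\<lambda>s. N (w s) - N (w t)) \<longlongrightarrow> 0) (at t within {0..R})"
    proof (rule Lim_null_comparison[OF _ lim[OF t]])
      have "norm (N (w s) - N (w t)) \<le> N (w s - w t)" if "s \<in> {0..R}" for s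
        using N_add[OF diff_mem[OF wX[OF that] wX[OF t]] wX[OF t]] N_add[OF diff_mem[OF wX[OF t] wX[OF that]] wX[OF that]]
          N_minus_commute[OF wX[OF t] wX[OF that]] by simp
      then show "\<forall>\<^sub>F s in at t within {0..R}. norm (N (w s) - N (w t)) \<le> N (w s - w t)"
        by (auto simp: eventually_at_filter intro: always_eventually)
    qed
    then show "((\<lambda>s. N (w s)) \<longlongrightarrow> N (w t)) (at t within {0..R})" by (simp add: LIM_zero_iff)
  qed
  then have "bounded ((\<lambda>s. N (w s)) ` {0..R})"
    by (intro compact_imp_bounded compact_continuous_image) auto
  then obtain r where "\<forall>x\<in>(\<lambda>s. N (w s)) ` {0..R}. norm x \<le> r" unfolding bounded_iff by blast
  then have "\<forall>t\<in>{0..R}. N (w t) \<le> r" by force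
  then show ?thesis by blast
qed

lemma multilin_mono:
  assumes "multilin m A M" "A \<le> B"
  shows "multilin m B M"
proof (rule multilinI)
  show "0 \<le> B" using multilinD(1)[OF assms(1)] assms(2) by simp
  show "N (M xs) \<le> B * prod_list (map N xs)" if "length xs = m" "set xs \<subseteq> X" for xs
  proof -
    have "A * prod_list (map N xs) \<le> B * prod_list (map N xs)"
      using that assms(2) by (intro mult_right_mono prod_list_nonneg_real N_nonneg) auto
    then show ?thesis using multilinD(3)[OF assms(1) that] by linarith
  qed
qed (use multilinD[OF assms(1)] in auto)

lemma multilin_sum:
  assumes "\<And>i. i \<in> I \<Longrightarrow> multilin m (A i) (M i)"
  shows "multilin m (sum A I) (\<lambda>l. \<Sum>i\<in>I. M i l)"
proof (rule multilinI)
  show "0 \<le> sum A I" using multilinD(1)[OF assms] by (intro sum_nonneg)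
  fix xs assume xs: "length xs = m" "set xs \<subseteq> X"
  show "(\<Sum>i\<in>I. M i xs) \<in> X" using multilinD(2)[OF assms] xs by (intro sum_mem) auto
  have "N (\<Sum>i\<in>I. M i xs) \<le> (\<Sum>i\<in>I. N (M i xs))" using multilinD(2)[OF assms] xs by (intro N_sum) auto
  also have "\<dots> \<le> (\<Sum>i\<in>I. A i * prod_list (map N xs))" using multilinD(3)[OF assms] xs by (intro sum_mono) auto
  finally show "N (\<Sum>i\<in>I. M i xs) \<le> sum A I * prod_list (map N xs)" by (simp add: sum_distrib_right)
next
  fix ys zs :: "('i \<Rightarrow> complex) list" and a b x y
  assume h: "Suc (length ys + length zs) = m" "set ys \<subseteq> X" "set zs \<subseteq> X" "x \<in> X" "y \<in> X"
  show "(\<Sum>i\<in>I. M i (ys @ (a *\<^sub>R x + b *\<^sub>R y) # zs)) = a *\<^sub>R (\<Sum>i\<in>I. M i (ys @ x # zs)) + b *\<^sub>R (\<Sum>i\<in>I. M i (ys @ y # zs))"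
    using multilinD(4)[OF assms h] by (intro sum_lincomb)
qed

lemma multilin_cmult:
  assumes "multilin m A M"
  shows "multilin m (cmod c * A) (\<lambda>l z. c * M l z)"
proof (rule multilinI)
  show "0 \<le> cmod c * A" using multilinD(1)[OF assms] by simp
  fix xs assume xs: "length xs = m" "set xs \<subseteq> X"
  show "(\<lambda>z. c * M xs z) \<in> X" using multilinD(2)[OF assms] xs by (intro cmult_mem) auto
  show "N (\<lambda>z. c * M xs z) \<le> cmod c * A * prod_list (map N xs)"
    using multilinD(3)[OF assms xs] unfolding N_cmult[OF multilinD(2)[OF assms xs]] mult.assoc
    by (intro mult_left_mono) auto
next
  fix ys zs :: "('i \<Rightarrow> complex) list" and a b x y
  assume h: "Suc (length ys + length zs) = m" "set ys \<subseteq> X" "set zs \<subseteq> X" "x \<in> X" "y \<in> X"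
  show "(\<lambda>z. c * M (ys @ (a *\<^sub>R x + b *\<^sub>R y) # zs) z) = a *\<^sub>R (\<lambda>z. c * M (ys @ x # zs) z) + b *\<^sub>R (\<lambda>z. c * M (ys @ y # zs) z)"
    unfolding multilinD(4)[OF assms h] by (simp add: fun_eq_iff algebra_simps)
qed

end

text \<open>Here \<open>2 * n + 1\<close> is the degree in the data of the \<open>n\<close>-th term
  of the solution and \<open>k\<close> the number of derivatives taken.\<close>

lemma summable_poly_geometric:
  fixes x :: real assumes "\<bar>x\<bar> < 1"
  shows "summable (\<lambda>n. real (2 * n + 1) ^ k * x ^ n)"
proof (cases "x = 0")
  case True
  then show ?thesis by (intro summable_finite[of "{0}"]) auto
next
  case False
  have "summable (\<lambda>n. norm (real (2 * n + 1) ^ k * x ^ n))"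
  proof (rule ratio_test_convergence)
    show "\<forall>\<^sub>F n in sequentially. 0 < norm (real (2 * n + 1) ^ k * x ^ n)"
      using False by (auto intro!: always_eventually)
    have "(\<lambda>n. (real (2 * n + 1) / real (2 * Suc n + 1)) ^ k / \<bar>x\<bar>) \<longlonglongrightarrow> 1 ^ k / \<bar>x\<bar>"
    proof (intro tendsto_intros)
      show "(\<lambda>n. real (2 * n + 1) / real (2 * Suc n + 1)) \<longlonglongrightarrow> 1" by real_asymp
    qed (use False in auto)
    moreover have "norm (real (2 * n + 1) ^ k * x ^ n) / norm (real (2 * Suc n + 1) ^ k * x ^ Suc n)
       = (real (2 * n + 1) / real (2 * Suc n + 1)) ^ k / \<bar>x\<bar>" for n
      using False by (simp add: power_divide norm_mult norm_power abs_mult power_abs field_simps)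
    ultimately have lim: "(\<lambda>n. norm (real (2 * n + 1) ^ k * x ^ n) / norm (real (2 * Suc n + 1) ^ k * x ^ Suc n)) \<longlonglongrightarrow> 1 / \<bar>x\<bar>"
      by simp
    have "liminf (\<lambda>n. ereal (norm (real (2 * n + 1) ^ k * x ^ n) / norm (real (2 * Suc n + 1) ^ k * x ^ Suc n))) = ereal (1 / \<bar>x\<bar>)"
      using lim by (intro lim_imp_Liminf) (auto simp del: ereal_divide)
    then show "1 < liminf (\<lambda>n. ereal (norm (real (2 * n + 1) ^ k * x ^ n) / norm (real (2 * Suc n + 1) ^ k * x ^ Suc n)))"
      using assms False by (simp add: field_simps del: ereal_divide)
  qed
  then show ?thesis by (rule summable_norm_cancel)
qed

section \<open>The abstract cubic equation\<close>

text \<open>\<open>inv_sqrt_coeff n\<close> is the coefficient of \<open>x ^ n\<close> in \<open>(1 - x) powr (- 1/2)\<close>, the solution of \<open>y' = y ^ 3 / 2\<close>,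
  \<open>y 0 = 1\<close>.\<close>

definition inv_sqrt_coeff :: "nat \<Rightarrow> real" where
  "inv_sqrt_coeff n = (- 1) ^ n * (- 1 / 2 gchoose n)"

lemma inv_sqrt_coeff_0 [simp]: "inv_sqrt_coeff 0 = 1"
  by (simp add: inv_sqrt_coeff_def)

lemma inv_sqrt_coeff_Suc: "inv_sqrt_coeff (Suc n) = (real n + 1 / 2) / (real n + 1) * inv_sqrt_coeff n"
proof -
  have "(- 1 / 2) * (- 1 / 2 gchoose n) = real n * (- 1 / 2 gchoose n) + real (Suc n) * ((- 1 / 2 :: real) gchoose (Suc n))"
    by (rule gbinomial_mult_1)
  then have "real (Suc n) * ((- 1 / 2 :: real) gchoose (Suc n)) = - (real n + 1 / 2) * (- 1 / 2 gchoose n)"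
    by (simp add: algebra_simps)
  then have "((- 1 / 2 :: real) gchoose (Suc n)) = - (real n + 1 / 2) * (- 1 / 2 gchoose n) / real (Suc n)"
    by (metis nonzero_mult_div_cancel_left of_nat_Suc of_nat_neq_0)
  then have "inv_sqrt_coeff (Suc n) = (- 1) ^ Suc n * (- (real n + 1 / 2) * (- 1 / 2 gchoose n) / real (Suc n))"
    by (simp only: inv_sqrt_coeff_def)
  then show ?thesis by (simp add: inv_sqrt_coeff_def divide_simps algebra_simps)
qed

lemma inv_sqrt_coeff_bounds: "0 \<le> inv_sqrt_coeff n \<and> inv_sqrt_coeff n \<le> 1"
proof (induction n)
  case (Suc n)
  define x where "x = (real n + 1 / 2) / (real n + 1)"
  have "0 \<le> x" "x \<le> 1" by (auto simp: x_def)
  then show ?case unfolding inv_sqrt_coeff_Suc x_def[symmetric] using Suc by (simp add: mult_le_one)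
qed simp

text \<open>The identity \<open>y ^ 3 = 2 * y'\<close> for \<open>y = (1 - x) powr (- 1/2)\<close>,
  read off at \<open>x ^ n\<close>. Two Vandermonde convolutions lead from the exponent
  \<open>- 1/2\<close> to \<open>- 1\<close> and then to \<open>- 3/2\<close>, and absorption plays
  the part of differentiation.\<close>

lemma inv_sqrt_coeff_convolution:
  "(\<Sum>j\<le>n. \<Sum>k\<le>n - j. inv_sqrt_coeff j * inv_sqrt_coeff k * inv_sqrt_coeff (n - j - k))
     = 2 * (real n + 1) * inv_sqrt_coeff (Suc n)"
proof -
  let ?g = "\<lambda>a n. (a::real) gchoose n"
  have 1: "(\<Sum>k\<le>m. inv_sqrt_coeff k * inv_sqrt_coeff (m - k)) = (- 1) ^ m * ?g (- 1) m" for m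
  proof -
    have "(\<Sum>k\<le>m. inv_sqrt_coeff k * inv_sqrt_coeff (m - k))
       = (\<Sum>k\<le>m. (- 1) ^ m * (?g (- 1 / 2) k * ?g (- 1 / 2) (m - k)))"
    proof (rule sum.cong)
      fix k assume "k \<in> {..m}"
      then have *: "(- 1 :: real) ^ k * (- 1) ^ (m - k) = (- 1) ^ m" by (simp flip: power_add)
      then show "inv_sqrt_coeff k * inv_sqrt_coeff (m - k) = (- 1) ^ m * (?g (- 1 / 2) k * ?g (- 1 / 2) (m - k))"
        unfolding inv_sqrt_coeff_def by (simp only: ac_simps flip: *)
    qed simp
    also have "\<dots> = (- 1) ^ m * ?g (- 1) m"
      using gbinomial_Vandermonde[of "- 1 / 2 :: real" "- 1 / 2" m]
      by (simp add: sum_distrib_left[symmetric] atMost_atLeast0)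
    finally show ?thesis .
  qed
  have "(\<Sum>j\<le>n. \<Sum>k\<le>n - j. inv_sqrt_coeff j * inv_sqrt_coeff k * inv_sqrt_coeff (n - j - k))
     = (\<Sum>j\<le>n. inv_sqrt_coeff j * ((- 1) ^ (n - j) * ?g (- 1) (n - j)))"
    by (simp add: 1[symmetric] sum_distrib_left mult.assoc)
  also have "\<dots> = (\<Sum>j\<le>n. (- 1) ^ n * (?g (- 1 / 2) j * ?g (- 1) (n - j)))"
  proof (rule sum.cong)
    fix k assume "k \<in> {..n}"
    then have *: "(- 1 :: real) ^ k * (- 1) ^ (n - k) = (- 1) ^ n" by (simp flip: power_add)
    then show "inv_sqrt_coeff k * ((- 1) ^ (n - k) * ?g (- 1) (n - k)) = (- 1) ^ n * (?g (- 1 / 2) k * ?g (- 1) (n - k))"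
      unfolding inv_sqrt_coeff_def by (simp only: ac_simps flip: *)
  qed simp
  also have "\<dots> = (- 1) ^ n * ?g (- 3 / 2) n"
    using gbinomial_Vandermonde[of "- 1 / 2 :: real" "- 1" n]
    by (simp add: sum_distrib_left[symmetric] atMost_atLeast0)
  also have "\<dots> = 2 * (real n + 1) * inv_sqrt_coeff (Suc n)"
  proof -
    have "?g (- 3 / 2) n = - 2 * ((real n + 1) * ?g (- 1 / 2) (Suc n))"
      using gbinomial_absorption[of n "- 1 / 2 :: real"] by (simp add: algebra_simps)
    then show ?thesis by (simp add: inv_sqrt_coeff_def)
  qed
  finally show ?thesis .
qed

locale cubic_space = banach_fun X N E
  for X :: "('i \<Rightarrow> complex) set" and N :: "('i \<Rightarrow> complex) \<Rightarrow> real" and E :: "'i \<Rightarrow> real" +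
  fixes T :: "('i \<Rightarrow> complex) \<Rightarrow> ('i \<Rightarrow> complex) \<Rightarrow> ('i \<Rightarrow> complex) \<Rightarrow> 'i \<Rightarrow> complex" and C :: real
  assumes T_mem: "u \<in> X \<Longrightarrow> v \<in> X \<Longrightarrow> w \<in> X \<Longrightarrow> T u v w \<in> X"
    and T_bound: "u \<in> X \<Longrightarrow> v \<in> X \<Longrightarrow> w \<in> X \<Longrightarrow> N (T u v w) \<le> C * (N u * N v * N w)"
    and C_nonneg: "0 \<le> C"
    and T_lin1: "u \<in> X \<Longrightarrow> u' \<in> X \<Longrightarrow> v \<in> X \<Longrightarrow> w \<in> X \<Longrightarrow>
      T (a *\<^sub>R u + b *\<^sub>R u') v w = a *\<^sub>R T u v w + b *\<^sub>R T u' v w"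
    and T_lin2: "u \<in> X \<Longrightarrow> v \<in> X \<Longrightarrow> v' \<in> X \<Longrightarrow> w \<in> X \<Longrightarrow>
      T u (a *\<^sub>R v + b *\<^sub>R v') w = a *\<^sub>R T u v w + b *\<^sub>R T u v' w"
    and T_lin3: "u \<in> X \<Longrightarrow> v \<in> X \<Longrightarrow> w \<in> X \<Longrightarrow> w' \<in> X \<Longrightarrow>
      T u v (a *\<^sub>R w + b *\<^sub>R w') = a *\<^sub>R T u v w + b *\<^sub>R T u v w'"
begin

lemma T_diff:
  assumes "u \<in> X" "u' \<in> X" "v \<in> X" "w \<in> X"
  shows "T (u - u') v w = T u v w - T u' v w" "T v (u - u') w = T v u w - T v u' w"
    "T v w (u - u') = T v w u - T v w u'"
  using T_lin1[OF assms, of 1 "-1"] T_lin2[OF assms(3,1,2,4), of 1 "-1"] T_lin3[OF assms(3,4,1,2), of 1 "-1"]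
  by simp_all

lemma T_sum:
  assumes "\<And>i. i \<in> I \<Longrightarrow> f i \<in> X" "v \<in> X" "w \<in> X"
  shows "T (sum f I) v w = (\<Sum>i\<in>I. T (f i) v w)" "T v (sum f I) w = (\<Sum>i\<in>I. T v (f i) w)"
    "T v w (sum f I) = (\<Sum>i\<in>I. T v w (f i))"
proof -
  have z: "T 0 v w = 0" "T v 0 w = 0" "T v w 0 = 0"
    using T_diff[OF zero_mem zero_mem assms(2,3)] by simp_all
  have add: "T (u + u') v w = T u v w + T u' v w" "T v (u + u') w = T v u w + T v u' w"
    "T v w (u + u') = T v w u + T v w u'" if "u \<in> X" "u' \<in> X" for u u'
    using T_lin1[OF that assms(2,3), of 1 1] T_lin2[OF assms(2) that assms(3), of 1 1]
      T_lin3[OF assms(2,3) that, of 1 1] by (simp_all del: plus_fun_apply)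
  have "T (sum f I) v w = (\<Sum>i\<in>I. T (f i) v w) \<and> T v (sum f I) w = (\<Sum>i\<in>I. T v (f i) w)
    \<and> T v w (sum f I) = (\<Sum>i\<in>I. T v w (f i))"
    using assms(1)
  proof (induction I rule: infinite_finite_induct)
    case (insert x F)
    then show ?case by (simp add: add sum_mem del: plus_fun_apply)
  qed (simp_all add: z del: zero_fun_apply)
  then show "T (sum f I) v w = (\<Sum>i\<in>I. T (f i) v w)" "T v (sum f I) w = (\<Sum>i\<in>I. T v (f i) w)"
    "T v w (sum f I) = (\<Sum>i\<in>I. T v w (f i))" by auto
qed

text \<open>The arguments \<open>u\<close> are replaced by \<open>v\<close> one at a time, which
  gives three terms, each containing one difference and two factors of norm at most
  \<open>r\<close>.\<close>

lemma T_diff_bound: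
  assumes "u \<in> X" "v \<in> X" "N u \<le> r" "N v \<le> r"
  shows "N (T u u u - T v v v) \<le> 3 * C * r\<^sup>2 * N (u - v)"
proof -
  have d: "u - v \<in> X" by (intro diff_mem assms)
  have r: "0 \<le> r" using N_nonneg[OF assms(1)] assms(3) by simp
  have eq: "T u u u - T v v v = T (u - v) u u + (T v (u - v) u + T v v (u - v))"
    using assms by (simp add: T_diff)
  have b: "C * (N a * N b * N c) \<le> C * r\<^sup>2 * N (u - v)"
    if "N a * N b * N c \<le> r * r * N (u - v)" for a b c
    using mult_left_mono[OF that C_nonneg] by (simp add: power2_eq_square ac_simps)
  note nn = N_nonneg[OF d] N_nonneg[OF assms(1)] N_nonneg[OF assms(2)]
  have rr: "N a * N b \<le> r * r" if "N a \<le> r" "N b \<le> r" "0 \<le> N b" for a b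
    using that r by (intro mult_mono) auto
  have "N (T (u - v) u u) \<le> C * r\<^sup>2 * N (u - v)"
    using mult_right_mono[OF rr[OF assms(3,3) nn(2)] nn(1)]
    by (intro order_trans[OF T_bound[OF d assms(1,1)] b]) (simp add: ac_simps)
  moreover have "N (T v (u - v) u) \<le> C * r\<^sup>2 * N (u - v)"
    using mult_right_mono[OF rr[OF assms(4,3) nn(2)] nn(1)]
    by (intro order_trans[OF T_bound[OF assms(2) d assms(1)] b]) (simp add: ac_simps)
  moreover have "N (T v v (u - v)) \<le> C * r\<^sup>2 * N (u - v)"
    using mult_right_mono[OF rr[OF assms(4,4) nn(3)] nn(1)]
    by (intro order_trans[OF T_bound[OF assms(2,2) d] b]) (simp add: ac_simps)
  moreover have "N (T u u u - T v v v) \<le> N (T (u - v) u u) + (N (T v (u - v) u) + N (T v v (u - v)))"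
    unfolding eq using assms d
    by (intro order_trans[OF N_add add_left_mono[OF N_add]] T_mem add_mem)
  ultimately show ?thesis by linarith
qed

text \<open>The list is cut into three consecutive blocks of lengths \<open>m1\<close>,
  \<open>m2\<close>, \<open>m3\<close>. The varied slot falls into one of them, and linearity of
  \<open>T\<close> in the corresponding argument is combined with that of the inner form.\<close>

lemma multilin_T:
  assumes M: "multilin m1 A1 M1" "multilin m2 A2 M2" "multilin m3 A3 M3"
  shows "multilin (m1 + m2 + m3) (C * (A1 * A2 * A3))
    (\<lambda>l. T (M1 (take m1 l)) (M2 (take m2 (drop m1 l))) (M3 (drop (m1 + m2) l)))"
proof (rule multilinI)
  show "0 \<le> C * (A1 * A2 * A3)" using C_nonneg multilinD(1)[OF M(1)] multilinD(1)[OF M(2)] multilinD(1)[OF M(3)] by simp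
next
  fix xs assume xs: "length xs = m1 + m2 + m3" "set xs \<subseteq> X"
  let ?a = "take m1 xs" and ?b = "take m2 (drop m1 xs)" and ?c = "drop (m1 + m2) xs"
  have l: "length ?a = m1" "length ?b = m2" "length ?c = m3" using xs by auto
  have s: "set ?a \<subseteq> X" "set ?b \<subseteq> X" "set ?c \<subseteq> X" using xs(2) by (auto dest!: in_set_takeD in_set_dropD)
  have mem: "M1 ?a \<in> X" "M2 ?b \<in> X" "M3 ?c \<in> X"
    using multilinD(2)[OF M(1) l(1) s(1)] multilinD(2)[OF M(2) l(2) s(2)] multilinD(2)[OF M(3) l(3) s(3)] by auto
  show "T (M1 ?a) (M2 ?b) (M3 ?c) \<in> X" by (intro T_mem mem)
  let ?P = "\<lambda>l. prod_list (map N l)"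
  have P: "0 \<le> ?P l" if "set l \<subseteq> X" for l using that by (intro prod_list_nonneg_real N_nonneg) auto
  have "xs = ?a @ ?b @ ?c" by (simp add: take_add[symmetric] flip: append_assoc)
  then have prod: "?P xs = ?P ?a * (?P ?b * ?P ?c)" by (metis map_append prod_list.append)
  have "N (T (M1 ?a) (M2 ?b) (M3 ?c)) \<le> C * (N (M1 ?a) * N (M2 ?b) * N (M3 ?c))" by (intro T_bound mem)
  also have "\<dots> \<le> C * ((A1 * ?P ?a) * (A2 * ?P ?b) * (A3 * ?P ?c))"
    using multilinD(3)[OF M(1) l(1) s(1)] multilinD(3)[OF M(2) l(2) s(2)] multilinD(3)[OF M(3) l(3) s(3)]
      multilinD(1)[OF M(1)] multilinD(1)[OF M(2)] multilinD(1)[OF M(3)] P[OF s(1)] P[OF s(2)] P[OF s(3)] C_nonneg mem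
    by (intro mult_left_mono mult_mono) (auto intro!: N_nonneg)
  finally show "N (T (M1 ?a) (M2 ?b) (M3 ?c)) \<le> C * (A1 * A2 * A3) * ?P xs"
    unfolding prod by (simp add: ac_simps)
next
  fix ys zs :: "('i \<Rightarrow> complex) list" and a b x y
  assume h: "Suc (length ys + length zs) = m1 + m2 + m3" "set ys \<subseteq> X" "set zs \<subseteq> X" "x \<in> X" "y \<in> X"
  note sub = order_trans[OF set_take_subset] order_trans[OF set_drop_subset]
  define g where "g l = T (M1 (take m1 l)) (M2 (take m2 (drop m1 l))) (M3 (drop (m1 + m2) l))" for l
  have memI: "M1 l \<in> X" if "length l = m1" "set l \<subseteq> X" for l using multilinD(2)[OF M(1) that] .
  have memI2: "M2 l \<in> X" if "length l = m2" "set l \<subseteq> X" for l using multilinD(2)[OF M(2) that] .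
  have memI3: "M3 l \<in> X" if "length l = m3" "set l \<subseteq> X" for l using multilinD(2)[OF M(3) that] .
  consider "length ys < m1" | "m1 \<le> length ys" "length ys < m1 + m2" | "m1 + m2 \<le> length ys" by linarith
  then have "g (ys @ (a *\<^sub>R x + b *\<^sub>R y) # zs) = a *\<^sub>R g (ys @ x # zs) + b *\<^sub>R g (ys @ y # zs)"
  proof cases
    case 1
    then obtain j where j: "m1 = length ys + Suc j" by (metis add.commute add_Suc_right less_natE)
    have g: "g (ys @ z # zs) = T (M1 (ys @ z # take j zs)) (M2 (take m2 (drop j zs))) (M3 (drop (j + m2) zs))" for z
      by (simp add: g_def j)
    have lin: "M1 (ys @ (a *\<^sub>R x + b *\<^sub>R y) # take j zs) = a *\<^sub>R M1 (ys @ x # take j zs) + b *\<^sub>R M1 (ys @ y # take j zs)"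
      using h j by (intro multilinD(4)[OF M(1)] sub) auto
    show ?thesis unfolding g lin
      by (intro T_lin1 memI memI2 memI3) (use h j in \<open>auto dest!: in_set_takeD in_set_dropD\<close>)
  next
    case 2
    then obtain j where j: "m1 + m2 = length ys + Suc j" by (metis add.commute add_Suc_right less_natE)
    define p q where "p = take m1 ys" and "q = drop m1 ys"
    have pq: "ys = p @ q" "length p = m1" "m2 = length q + Suc j" "set p \<subseteq> X" "set q \<subseteq> X"
      using 2 j h(2) by (auto simp: p_def q_def dest!: in_set_takeD in_set_dropD)
    have g: "g (ys @ z # zs) = T (M1 p) (M2 (q @ z # take j zs)) (M3 (drop j zs))" for z
      by (simp add: g_def pq(1) pq(2)[symmetric] pq(3))
    have lin: "M2 (q @ (a *\<^sub>R x + b *\<^sub>R y) # take j zs) = a *\<^sub>R M2 (q @ x # take j zs) + b *\<^sub>R M2 (q @ y # take j zs)"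
      using h j pq by (intro multilinD(4)[OF M(2)] sub) auto
    show ?thesis unfolding g lin
      by (intro T_lin2 memI memI2 memI3) (use h j pq in \<open>auto dest!: in_set_takeD in_set_dropD\<close>)
  next
    case 3
    define p q r where "p = take m1 ys" and "q = take m2 (drop m1 ys)" and "r = drop (m1 + m2) ys"
    have pq: "ys = p @ q @ r" "length p = m1" "length q = m2" "set p \<subseteq> X" "set q \<subseteq> X" "set r \<subseteq> X"
      using 3 h(2) by (auto simp: p_def q_def r_def take_add[symmetric] dest!: in_set_takeD in_set_dropD simp flip: append_assoc)
    have g: "g (ys @ z # zs) = T (M1 p) (M2 q) (M3 (r @ z # zs))" for z
      by (simp add: g_def pq(1) pq(2)[symmetric] pq(3)[symmetric])
    have len: "Suc (length r + length zs) = m3" using h pq by simp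
    have lin: "M3 (r @ (a *\<^sub>R x + b *\<^sub>R y) # zs) = a *\<^sub>R M3 (r @ x # zs) + b *\<^sub>R M3 (r @ y # zs)"
      using h pq len by (intro multilinD(4)[OF M(3)]) auto
    show ?thesis unfolding g lin
      by (intro T_lin3 memI memI2 memI3) (use h pq len in auto)
  qed
  then show "T (M1 (take m1 (ys @ (a *\<^sub>R x + b *\<^sub>R y) # zs))) (M2 (take m2 (drop m1 (ys @ (a *\<^sub>R x + b *\<^sub>R y) # zs)))) (M3 (drop (m1 + m2) (ys @ (a *\<^sub>R x + b *\<^sub>R y) # zs))) =
      a *\<^sub>R T (M1 (take m1 (ys @ x # zs))) (M2 (take m2 (drop m1 (ys @ x # zs)))) (M3 (drop (m1 + m2) (ys @ x # zs))) +
      b *\<^sub>R T (M1 (take m1 (ys @ y # zs))) (M2 (take m2 (drop m1 (ys @ y # zs)))) (M3 (drop (m1 + m2) (ys @ y # zs)))"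
    unfolding g_def .
qed

text \<open>Inserting \<open>u = (\<Sum>n. t ^ n * p n)\<close> into the equation gives
  \<open>(n + 1) * p (n + 1) = - \<i>\<close> times the sum of \<open>T (p j) (p k) (p l)\<close>
  over \<open>j + k + l = n\<close>. So \<open>p n\<close> has degree \<open>2 * n + 1\<close> in
  the data. Each factor gets its own block of the argument list, which makes the map multilinear
  without symmetrisation.\<close>

fun coef :: "nat \<Rightarrow> ('i \<Rightarrow> complex) list \<Rightarrow> 'i \<Rightarrow> complex" where
  "coef 0 l = hd l"
| "coef (Suc n) l = (\<lambda>z. - \<i> / of_nat (Suc n) *
     (\<Sum>j\<le>n. \<Sum>k\<le>n - j. T (coef j (take (2 * j + 1) l)) (coef k (take (2 * k + 1) (drop (2 * j + 1) l)))
        (coef (n - j - k) (drop ((2 * j + 1) + (2 * k + 1)) l))) z)"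

text \<open>The bounds satisfy the recursion of the majorant: the triple products sum to
  \<open>C * (2 * C) ^ p * 2 * (p + 1) * inv_sqrt_coeff (p + 1)\<close> by
  \<open>inv_sqrt_coeff_convolution\<close>, and the division by \<open>p + 1\<close> leaves the
  next constant.\<close>

lemma multilin_coef: "multilin (2 * n + 1) ((2 * C) ^ n * inv_sqrt_coeff n) (coef n)"
proof (induction n rule: less_induct)
  case (less n)
  show ?case
  proof (cases n)
    case 0
    show ?thesis unfolding 0
    proof (rule multilinI)
      fix xs :: "('i \<Rightarrow> complex) list" assume "length xs = 2 * 0 + 1" "set xs \<subseteq> X"
      then show "coef 0 xs \<in> X" "N (coef 0 xs) \<le> (2 * C) ^ 0 * inv_sqrt_coeff 0 * prod_list (map N xs)"
        by (cases xs; auto)+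
    qed auto
  next
    case (Suc p)
    let ?A = "\<lambda>n. (2 * C) ^ n * inv_sqrt_coeff n"
    let ?g = "\<lambda>j k l. T (coef j (take (2 * j + 1) l)) (coef k (take (2 * k + 1) (drop (2 * j + 1) l)))
        (coef (p - j - k) (drop ((2 * j + 1) + (2 * k + 1)) l))"
    have "multilin (2 * n + 1) (C * (?A j * ?A k * ?A (p - j - k))) (?g j k)"
      if "j \<le> p" "k \<le> p - j" for j k
    proof -
      have "2 * j + 1 + (2 * k + 1) + (2 * (p - j - k) + 1) = 2 * n + 1" using that Suc by simp
      moreover have "multilin (2 * j + 1 + (2 * k + 1) + (2 * (p - j - k) + 1)) (C * (?A j * ?A k * ?A (p - j - k))) (?g j k)"
        using that Suc by (intro multilin_T less) auto
      ultimately show ?thesis by (simp only:)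
    qed
    then have "multilin (2 * n + 1) (\<Sum>j\<le>p. \<Sum>k\<le>p - j. C * (?A j * ?A k * ?A (p - j - k)))
        (\<lambda>l. \<Sum>j\<le>p. \<Sum>k\<le>p - j. ?g j k l)"
      by (intro multilin_sum) auto
    note ml = multilin_cmult[OF this, of "- \<i> / of_nat (Suc p)"]
    have cm: "cmod (- \<i> / of_nat (Suc p)) = 1 / real (Suc p)" by (simp add: norm_divide del: of_nat_Suc)
    have coefn: "coef n = (\<lambda>l z. - \<i> / of_nat (Suc p) * (\<Sum>j\<le>p. \<Sum>k\<le>p - j. ?g j k l) z)"
      by (intro ext) (simp only: Suc coef.simps)
    have ml: "multilin (2 * n + 1) (1 / real (Suc p) * (\<Sum>j\<le>p. \<Sum>k\<le>p - j. C * (?A j * ?A k * ?A (p - j - k)))) (coef n)"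
      using ml unfolding cm coefn .
    have "(\<Sum>j\<le>p. \<Sum>k\<le>p - j. C * (?A j * ?A k * ?A (p - j - k)))
       = (\<Sum>j\<le>p. \<Sum>k\<le>p - j. C * (2 * C) ^ p * (inv_sqrt_coeff j * inv_sqrt_coeff k * inv_sqrt_coeff (p - j - k)))"
    proof (intro sum.cong refl)
      fix j k assume "j \<in> {..p}" "k \<in> {..p - j}"
      then have "(2 * C) ^ p = (2 * C) ^ j * (2 * C) ^ k * (2 * C) ^ (p - j - k)"
        by (simp only: power_add[symmetric]) simp
      then show "C * (?A j * ?A k * ?A (p - j - k))
         = C * (2 * C) ^ p * (inv_sqrt_coeff j * inv_sqrt_coeff k * inv_sqrt_coeff (p - j - k))"
        by (simp only: ac_simps)
    qed
    also have "\<dots> = C * (2 * C) ^ p * (2 * (real p + 1) * inv_sqrt_coeff (Suc p))"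
      by (simp only: sum_distrib_left[symmetric] inv_sqrt_coeff_convolution)
    finally have "1 / real (Suc p) * (\<Sum>j\<le>p. \<Sum>k\<le>p - j. C * (?A j * ?A k * ?A (p - j - k)))
       = 1 / real (Suc p) * (C * (2 * C) ^ p * (2 * (real p + 1) * inv_sqrt_coeff (Suc p)))" by (simp only:)
    also have "\<dots> = ?A n" by (simp add: Suc field_simps)
    finally show ?thesis using ml by simp
  qed
qed

end

section \<open>The series solves the equation, and the solution is unique\<close>

lemma sum_simplex:
  fixes f :: "nat \<Rightarrow> nat \<Rightarrow> nat \<Rightarrow> 'a::comm_monoid_add"
  shows "(\<Sum>n<K. \<Sum>j\<le>n. \<Sum>k\<le>n - j. f j k (n - j - k)) = (\<Sum>(j,k,l)\<in>{(j,k,l). j + k + l < K}. f j k l)"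
proof -
  have "(\<Sum>n<K. \<Sum>j\<le>n. \<Sum>k\<le>n - j. f j k (n - j - k))
      = (\<Sum>(n,j,k)\<in>(SIGMA n:{..<K}. SIGMA j:{..n}. {..n - j}). f j k (n - j - k))"
    by (simp add: sum.Sigma)
  also have "\<dots> = (\<Sum>(j,k,l)\<in>{(j,k,l). j + k + l < K}. f j k l)"
    by (rule sum.reindex_bij_witness[where i = "\<lambda>(j,k,l). (j + k + l, j, k)" and j = "\<lambda>(n,j,k). (j, k, n - j - k)"]) auto
  finally show ?thesis .
qed

context cubic_space
begin

text \<open>A Cauchy product for \<open>T\<close>. Its partial sums run over the simplex
  \<open>j + k + l < K\<close>, while \<open>T (S K) (S K) (S K)\<close> runs over the cube and
  converges because \<open>T\<close> is locally Lipschitz.\<close>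

lemma T_geometric_series:
  assumes f: "\<And>n. f n \<in> X" "\<And>n. N (f n) \<le> \<rho> * (1 / 2) ^ n" and F: "F = (\<lambda>z. \<Sum>n. f n z)"
  shows "(\<lambda>n. \<Sum>j\<le>n. \<Sum>k\<le>n - j. T (f j) (f k) (f (n - j - k)) z) sums T F F F z"
proof -
  let ?B = "\<lambda>n. \<rho> * (1 / 2) ^ n"
  have \<rho>: "0 \<le> \<rho>" using N_nonneg[OF f(1)[of 0]] f(2)[of 0] by simp
  have summB: "summable ?B" by (intro summable_mult summable_geometric) simp
  define S where "S K = (\<Sum>n<K. f n)" for K
  have SX: "S K \<in> X" for K unfolding S_def by (intro sum_mem f)
  have sumB: "(\<Sum>n. \<rho> * (1 / 2) ^ (n + K)) = 2 * \<rho> * (1 / 2) ^ K" for K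
  proof -
    have "(\<lambda>n. \<rho> * (1 / 2) ^ K * (1 / 2) ^ n) sums (\<rho> * (1 / 2) ^ K * (1 / (1 - 1 / 2)))"
      by (intro sums_mult geometric_sums) simp
    then show ?thesis by (simp add: sums_iff power_add ac_simps)
  qed
  have FX: "F \<in> X" and FN: "N F \<le> 2 * \<rho>"
    using series(1,2)[OF f summB] sumB[of 0] unfolding F by simp_all
  have FS: "N (F - S K) \<le> 2 * \<rho> * (1 / 2) ^ K" for K
  proof -
    have eq: "F - S K = (\<lambda>z. \<Sum>n. f (n + K) z)"
    proof
      fix z
      show "(F - S K) z = (\<Sum>n. f (n + K) z)"
        unfolding F S_def
        using suminf_minus_initial_segment[OF summable_norm_cancel[OF series(3)[OF f summB, of z]], of K]
        by (simp add: sum_fun_apply)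
    qed
    have "N (\<lambda>z. \<Sum>n. f (n + K) z) \<le> (\<Sum>n. \<rho> * (1 / 2) ^ (n + K))"
      by (rule series(2)[OF f(1) f(2) summable_ignore_initial_segment[OF summB]])
    then show ?thesis unfolding eq sumB .
  qed
  have SN: "N (S K) \<le> 4 * \<rho>" for K
  proof -
    have "S K = F - (F - S K)" by simp
    then have "N (S K) \<le> N F + N (F - S K)" by (metis N_diff FX SX diff_mem)
    moreover have "(1 / 2 :: real) ^ K \<le> 1" by (simp add: power_le_one)
    then have "2 * \<rho> * (1 / 2) ^ K \<le> 2 * \<rho>" using \<rho> mult_left_mono[of "(1/2)^K" 1 "2 * \<rho>"] by simp
    ultimately show ?thesis using FN FS[of K] by linarith
  qed
  have TS: "(\<lambda>K. T (S K) (S K) (S K) z) \<longlonglongrightarrow> T F F F z"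
  proof (rule LIM_zero_cancel, rule Lim_null_comparison)
    have "norm (T (S K) (S K) (S K) z - T F F F z) \<le> \<bar>E z\<bar> * (3 * C * (4 * \<rho>)\<^sup>2 * (2 * \<rho> * (1 / 2) ^ K))" for K
    proof -
      have "norm ((T (S K) (S K) (S K) - T F F F) z) \<le> \<bar>E z\<bar> * N (T (S K) (S K) (S K) - T F F F)"
        by (intro eval_abs diff_mem T_mem FX SX)
      also have "\<dots> \<le> \<bar>E z\<bar> * (3 * C * (4 * \<rho>)\<^sup>2 * N (S K - F))"
        using SN FN \<rho> by (intro mult_left_mono T_diff_bound FX SX) auto
      also have "\<dots> \<le> \<bar>E z\<bar> * (3 * C * (4 * \<rho>)\<^sup>2 * (2 * \<rho> * (1 / 2) ^ K))"
        using FS[of K] C_nonneg by (intro mult_left_mono) (auto simp: N_minus_commute[OF SX FX])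
      finally show ?thesis by simp
    qed
    then show "\<forall>\<^sub>F K in sequentially. norm (T (S K) (S K) (S K) z - T F F F z) \<le> \<bar>E z\<bar> * (3 * C * (4 * \<rho>)\<^sup>2 * (2 * \<rho> * (1 / 2) ^ K))"
      by simp
    show "(\<lambda>K. \<bar>E z\<bar> * (3 * C * (4 * \<rho>)\<^sup>2 * (2 * \<rho> * (1 / 2) ^ K))) \<longlonglongrightarrow> 0"
      by (intro tendsto_mult_right_zero LIMSEQ_realpow_zero) auto
  qed
  let ?t = "\<lambda>(j,k,l). T (f j) (f k) (f l) z"
  let ?cube = "\<lambda>K. {..<K} \<times> {..<K} \<times> {..<K::nat}" and ?simplex = "\<lambda>K. {(j,k,l). j + k + l < (K::nat)}"
  have cube: "T (S K) (S K) (S K) z = sum ?t (?cube K)" for K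
  proof -
    have "T (S K) (S K) (S K) = (\<Sum>j<K. \<Sum>k<K. \<Sum>l<K. T (f j) (f k) (f l))"
    proof -
      have "T (S K) (S K) (S K) = (\<Sum>j<K. T (f j) (S K) (S K))"
        unfolding S_def[of K] by (intro T_sum sum_mem f)
      also have "\<dots> = (\<Sum>j<K. \<Sum>k<K. T (f j) (f k) (S K))"
        by (subst S_def, intro sum.cong refl T_sum SX f)
      also have "\<dots> = (\<Sum>j<K. \<Sum>k<K. \<Sum>l<K. T (f j) (f k) (f l))"
        by (subst S_def, intro sum.cong refl T_sum f)
      finally show ?thesis .
    qed
    then show ?thesis by (simp add: sum_fun_apply sum.cartesian_product case_prod_unfold)
  qed
  have sub: "?simplex K \<subseteq> ?cube K" for K by auto
  \<comment> \<open>Outside the simplex \<open>j + k + l \<ge> K\<close>, so each term is of size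
    \<open>(1/2) ^ K\<close>, and there are at most \<open>K ^ 3\<close> of them.\<close>
  have "(\<lambda>K. sum ?t (?cube K) - sum ?t (?simplex K)) \<longlonglongrightarrow> 0"
  proof (rule Lim_null_comparison)
    let ?c = "\<bar>E z\<bar> * (C * \<rho> ^ 3)"
    have "norm (sum ?t (?cube K) - sum ?t (?simplex K)) \<le> real K ^ 3 * (?c * (1 / 2) ^ K)" for K
    proof -
      have t: "norm (?t x) \<le> ?c * (1 / 2) ^ K" if "x \<in> ?cube K - ?simplex K" for x
      proof -
        obtain j k l where x: "x = (j, k, l)" by (cases x)
        then have ge: "K \<le> j + k + l" using that by auto
        have "norm (?t x) \<le> \<bar>E z\<bar> * N (T (f j) (f k) (f l))"
          unfolding x by (auto intro: eval_abs T_mem f)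
        also have "\<dots> \<le> \<bar>E z\<bar> * (C * (N (f j) * N (f k) * N (f l)))"
          by (intro mult_left_mono T_bound f) auto
        also have "\<dots> \<le> \<bar>E z\<bar> * (C * (?B j * ?B k * ?B l))"
          using \<rho> C_nonneg by (intro mult_left_mono mult_mono f) (auto intro!: N_nonneg f)
        also have "\<dots> = ?c * (1 / 2) ^ (j + k + l)" by (simp add: power_add power3_eq_cube)
        also have "\<dots> \<le> ?c * (1 / 2) ^ K"
          using ge \<rho> C_nonneg by (intro mult_left_mono power_decreasing) auto
        finally show ?thesis .
      qed
      have "sum ?t (?cube K) - sum ?t (?simplex K) = sum ?t (?cube K - ?simplex K)"
        using sub by (subst sum_diff) auto
      also have "norm \<dots> \<le> real (card (?cube K - ?simplex K)) * (?c * (1 / 2) ^ K)"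
        by (rule order_trans[OF norm_sum sum_bounded_above[OF t]])
      also have "\<dots> \<le> real (card (?cube K)) * (?c * (1 / 2) ^ K)"
        using \<rho> C_nonneg by (intro mult_right_mono of_nat_mono card_mono) auto
      also have "\<dots> = real K ^ 3 * (?c * (1 / 2) ^ K)" by (simp add: card_cartesian_product power3_eq_cube)
      finally show ?thesis .
    qed
    then show "\<forall>\<^sub>F K in sequentially. norm (sum ?t (?cube K) - sum ?t (?simplex K)) \<le> real K ^ 3 * (?c * (1 / 2) ^ K)"
      by simp
    have "(\<lambda>K. ?c * (real K ^ 3 * (1 / 2) ^ K)) \<longlonglongrightarrow> 0" by (intro tendsto_mult_right_zero) real_asymp
    then show "(\<lambda>K. real K ^ 3 * (?c * (1 / 2) ^ K)) \<longlonglongrightarrow> 0" by (simp add: ac_simps)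
  qed
  from tendsto_diff[OF TS this] have "(\<lambda>K. sum ?t (?simplex K)) \<longlonglongrightarrow> T F F F z" by (simp add: cube)
  then show ?thesis unfolding sums_def sum_simplex[of "\<lambda>j k l. T (f j) (f k) (f l) z"] .
qed

text \<open>Supplies the continuous integrands that \<open>mean_value_bound\<close> needs;
  continuity in \<open>N\<close> becomes pointwise through \<open>eval\<close>.\<close>

lemma path_cubic_continuous:
  assumes "w \<in> path_space R X N"
  shows "continuous_on {0..R} (\<lambda>s. T (w s) (w s) (w s) z)"
  unfolding continuous_on_def
proof
  fix t assume t: "t \<in> {0..R}"
  have wX: "\<And>t. t \<in> {0..R} \<Longrightarrow> w t \<in> X"
    and lim: "\<And>t. t \<in> {0..R} \<Longrightarrow> ((\<lambda>s. N (w s - w t)) \<longlongrightarrow> 0) (at t within {0..R})"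
    using assms by (auto simp: path_space_def)
  obtain r where r: "\<And>s. s \<in> {0..R} \<Longrightarrow> N (w s) \<le> r" using path_bounded[OF assms] by blast
  have "((\<lambda>s. T (w s) (w s) (w s) z - T (w t) (w t) (w t) z) \<longlongrightarrow> 0) (at t within {0..R})"
  proof (rule Lim_null_comparison)
    have "norm (T (w s) (w s) (w s) z - T (w t) (w t) (w t) z) \<le> \<bar>E z\<bar> * (3 * C * r\<^sup>2) * N (w s - w t)"
      if s: "s \<in> {0..R}" for s
    proof -
      have "norm ((T (w s) (w s) (w s) - T (w t) (w t) (w t)) z) \<le> \<bar>E z\<bar> * N (T (w s) (w s) (w s) - T (w t) (w t) (w t))"
        by (intro eval_abs diff_mem T_mem wX s t)
      also have "\<dots> \<le> \<bar>E z\<bar> * (3 * C * r\<^sup>2 * N (w s - w t))"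
        by (intro mult_left_mono T_diff_bound wX s t r) auto
      finally show ?thesis by (simp add: ac_simps)
    qed
    then show "\<forall>\<^sub>F s in at t within {0..R}. norm (T (w s) (w s) (w s) z - T (w t) (w t) (w t) z) \<le> \<bar>E z\<bar> * (3 * C * r\<^sup>2) * N (w s - w t)"
      by (auto simp: eventually_at_filter intro: always_eventually)
    show "((\<lambda>s. \<bar>E z\<bar> * (3 * C * r\<^sup>2) * N (w s - w t)) \<longlongrightarrow> 0) (at t within {0..R})"
      by (intro tendsto_mult_right_zero lim t)
  qed
  then show "((\<lambda>s. T (w s) (w s) (w s) z) \<longlongrightarrow> T (w t) (w t) (w t) z) (at t within {0..R})" by (simp add: LIM_zero_iff)
qed

text \<open>Nothing is known about differentiability of \<open>N (w s - u s)\<close> in time, so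
  Gronwall's lemma is run by iteration: each use of \<open>mean_value_bound\<close> integrates the
  previous bound and produces the next term of the exponential series, which tends to zero.\<close>

lemma solution_unique:
  assumes G: "\<And>u. u \<in> X \<Longrightarrow> G u = T u u u"
    and u: "solves X N G R v u" and w: "solves X N G R v w" and t: "t \<in> {0..R}"
  shows "w t = u t"
proof -
  have pu: "u \<in> path_space R X N" and pw: "w \<in> path_space R X N" using u w by (auto simp: solves_def)
  have uX: "u s \<in> X" and wX: "w s \<in> X" if "s \<in> {0..R}" for s using pu pw that by (auto simp: path_space_def)
  have D: "((\<lambda>s. f s z) has_vector_derivative - \<i> * T (f s) (f s) (f s) z) (at s within {0..R})"
    if f: "solves X N G R v f" and s: "s \<in> {0..R}" for f s z
  proof -
    from f s have fX: "f s \<in> X" by (auto simp: solves_def path_space_def)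
    from f s obtain d where d: "((\<lambda>s. f s z) has_vector_derivative d) (at s within {0..R})" "\<i> * d = G (f s) z"
      unfolding solves_def by blast
    have "- \<i> * (\<i> * d) = d" by simp
    then have "d = - \<i> * T (f s) (f s) (f s) z" unfolding d(2) G[OF fX] by simp
    with d(1) show ?thesis by simp
  qed
  obtain r1 r2 where r12: "\<And>s. s \<in> {0..R} \<Longrightarrow> N (u s) \<le> r1" "\<And>s. s \<in> {0..R} \<Longrightarrow> N (w s) \<le> r2"
    using path_bounded[OF pu] path_bounded[OF pw] by blast
  define r L where "r = max r1 r2" and "L = 3 * C * r\<^sup>2"
  have r: "N (u s) \<le> r" "N (w s) \<le> r" if "s \<in> {0..R}" for s using r12[OF that] by (auto simp: r_def)
  have L: "0 \<le> L" using C_nonneg by (simp add: L_def)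
  let ?d = "\<lambda>s. w s - u s" and ?e = "\<lambda>s z. - \<i> * (T (w s) (w s) (w s) - T (u s) (u s) (u s)) z"
  have bound: "\<forall>s\<in>{0..R}. N (?d s) \<le> 2 * r * (L * s) ^ n / fact n" for n
  proof (induction n)
    case 0
    show ?case
    proof
      fix s assume s: "s \<in> {0..R}"
      show "N (?d s) \<le> 2 * r * (L * s) ^ 0 / fact 0"
        using N_diff[OF wX[OF s] uX[OF s]] r[OF s] by simp
    qed
  next
    case (Suc n)
    show ?case
    proof
      fix t assume t: "t \<in> {0..R}"
      have sub: "{0..t} \<subseteq> {0..R}" using t by auto
      let ?q = "\<lambda>s. L * (2 * r * (L * s) ^ n / fact n)" and ?Q = "\<lambda>s. 2 * r * (L * s) ^ Suc n / fact (Suc n)"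
      have "N (?d t - ?d 0) \<le> ?Q t - ?Q 0"
      proof (rule mean_value_bound[where e = ?e and q = ?q])
        fix s assume s: "s \<in> {0..t}"
        with sub have s': "s \<in> {0..R}" by blast
        have mem: "T (w s) (w s) (w s) - T (u s) (u s) (u s) \<in> X" by (intro diff_mem T_mem uX wX s')
        show "?d s \<in> X" by (intro diff_mem uX wX s')
        show "?e s \<in> X" by (rule cmult_mem[OF mem])
        have "N (?e s) = N (T (w s) (w s) (w s) - T (u s) (u s) (u s))"
          using N_cmult[OF mem, of "- \<i>"] by simp
        also have "\<dots> \<le> L * N (?d s)" unfolding L_def by (intro T_diff_bound uX wX s' r)
        also have "\<dots> \<le> ?q s" by (intro mult_left_mono bspec[OF Suc s'] L)
        finally show "N (?e s) \<le> ?q s" .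
        show "((\<lambda>s. ?d s z) has_vector_derivative ?e s z) (at s within {0..t})" for z
          using has_vector_derivative_within_subset[OF has_vector_derivative_diff[OF D[OF w s'] D[OF u s']] sub, of z]
          by (simp only: minus_apply fun_diff_def right_diff_distrib)
        have "(?Q has_real_derivative ?q s) (at s within {0..t})"
          by (rule derivative_eq_intros refl | simp)+
        then show "(?Q has_vector_derivative ?q s) (at s within {0..t})"
          by (simp add: has_real_derivative_iff_has_vector_derivative)
      next
        show "continuous_on {0..t} (\<lambda>s. ?e s z)" for z
          using continuous_on_subset[OF path_cubic_continuous[OF pw] sub]
            continuous_on_subset[OF path_cubic_continuous[OF pu] sub]
          by (auto intro!: continuous_intros)
      qed (use t in \<open>auto intro!: continuous_intros\<close>)
      moreover have "?d 0 = 0" using u w by (simp add: solves_def)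
      ultimately show "N (?d t) \<le> ?Q t" by simp
    qed
  qed
  have "(\<lambda>n. 2 * r * ((L * t) ^ n / fact n)) \<longlonglongrightarrow> 2 * r * 0"
    using summable_LIMSEQ_zero[OF summable_exp[of "L * t"]] by (intro tendsto_intros) (simp add: field_simps)
  then have "N (?d t) \<le> 2 * r * 0"
    using bound t by (intro LIMSEQ_le_const) auto
  then have "N (?d t) = 0" using N_nonneg[OF diff_mem[OF wX[OF t] uX[OF t]]] by simp
  then show ?thesis using N_eq_0[OF diff_mem[OF wX[OF t] uX[OF t]]] by simp
qed

lemma power_path_solves:
  assumes v: "v \<in> X" "N v \<le> \<rho>" and \<rho>: "1 \<le> \<rho>" and R: "R > 0" "2 * C * \<rho>\<^sup>2 * R \<le> 1 / 2"
    and G: "\<And>u. u \<in> X \<Longrightarrow> G u = T u u u"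
  shows "solves X N G R v (power_path R (\<lambda>n. coef n (replicate (2 * n + 1) v)))"
proof -
  define p where "p n = coef n (replicate (2 * n + 1) v)" for n
  let ?u = "power_path R p"
  have pX: "p n \<in> X" for n
    unfolding p_def using v by (intro multilinD(2)[OF multilin_coef]) auto
  have pN: "N (p n) * R ^ n \<le> \<rho> * (1 / 2) ^ n" for n
  proof -
    have "N (p n) \<le> (2 * C) ^ n * inv_sqrt_coeff n * N v ^ (2 * n + 1)"
      using multilinD(3)[OF multilin_coef length_replicate replicate_sub[OF v(1)]]
      unfolding p_def map_replicate prod_list_replicate .
    also have "\<dots> \<le> (2 * C) ^ n * 1 * \<rho> ^ (2 * n + 1)"
      using C_nonneg v N_nonneg[OF v(1)] inv_sqrt_coeff_bounds[of n] \<rho>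
      by (intro mult_mono power_mono) auto
    finally have "N (p n) * R ^ n \<le> (2 * C) ^ n * \<rho> ^ (2 * n + 1) * R ^ n"
      using R by (intro mult_right_mono) auto
    also have "\<dots> = \<rho> * (2 * C * \<rho>\<^sup>2 * R) ^ n" by (simp add: power_mult_distrib power_mult power_even_eq)
    also have "\<dots> \<le> \<rho> * (1 / 2) ^ n"
      using \<rho> R C_nonneg by (intro mult_left_mono power_mono) auto
    finally show ?thesis .
  qed
  have summ: "summable (\<lambda>n. \<rho> * (1 / 2) ^ n)" by (intro summable_mult summable_geometric) simp
  have summn: "summable (\<lambda>n. real n * (\<rho> * (1 / 2) ^ n))"
  proof (rule summable_comparison_test')
    show "summable (\<lambda>n. \<rho> * (real (2 * n + 1) ^ 1 * (1 / 2) ^ n))"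
      by (intro summable_mult summable_poly_geometric) simp
    fix n :: nat
    have "real n * (\<rho> * (1 / 2) ^ n) \<le> real (2 * n + 1) * (\<rho> * (1 / 2) ^ n)"
      using \<rho> by (intro mult_right_mono) auto
    then show "norm (real n * (\<rho> * (1 / 2) ^ n)) \<le> \<rho> * (real (2 * n + 1) ^ 1 * (1 / 2) ^ n)"
      using \<rho> by (simp add: ac_simps)
  qed
  have path: "?u \<in> path_space R X N" by (rule power_path_mem[OF pX pN summ summn R(1)])
  have u0: "?u 0 = v"
  proof
    fix z
    have "p 0 z = v z" by (simp add: p_def)
    then show "?u 0 z = v z"
      using R powser_zero[of "\<lambda>n. p n z"] by (simp add: power_path_def mult.commute)
  qed
  have pSuc: "p (Suc n) z = - \<i> / of_nat (Suc n) * (\<Sum>j\<le>n. \<Sum>k\<le>n - j. T (p j) (p k) (p (n - j - k)) z)" for n z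
  proof -
    let ?l = "replicate (2 * Suc n + 1) v"
    have step: "T (coef j (take (2 * j + 1) ?l)) (coef k (take (2 * k + 1) (drop (2 * j + 1) ?l)))
        (coef (n - j - k) (drop ((2 * j + 1) + (2 * k + 1)) ?l)) = T (p j) (p k) (p (n - j - k))"
      if "j \<le> n" "k \<le> n - j" for j k
    proof -
      have "min (2 * j + 1) (2 * Suc n + 1) = 2 * j + 1" "min (2 * k + 1) (2 * Suc n + 1 - (2 * j + 1)) = 2 * k + 1"
        "2 * Suc n + 1 - ((2 * j + 1) + (2 * k + 1)) = 2 * (n - j - k) + 1"
        using that by auto
      then show ?thesis unfolding p_def take_replicate drop_replicate by (simp only:)
    qed
    have "p (Suc n) = (\<lambda>z. - \<i> / of_nat (Suc n) * (\<Sum>j\<le>n. \<Sum>k\<le>n - j. T (p j) (p k) (p (n - j - k))) z)"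
      unfolding p_def[of "Suc n"] coef.simps
      by (intro ext arg_cong[where f = "\<lambda>h. _ * h _"] sum.cong refl step) auto
    then show ?thesis by (simp add: sum_fun_apply)
  qed
  have "\<exists>d. ((\<lambda>s. ?u s z) has_vector_derivative d) (at t within {0..R}) \<and> \<i> * d = G (?u t) z"
    if t: "t \<in> {0..R}" for t z
  proof -
    \<comment> \<open>Termwise differentiation at \<open>t\<close>, the endpoint \<open>R\<close>
      included, needs convergence at a strictly larger radius. At \<open>3 * R / 2\<close> the terms
      still decay like \<open>(3/4) ^ n\<close>.\<close>
    let ?c = "\<lambda>n. p n z" and ?K = "complex_of_real (3 * R / 2)"
    have "summable (\<lambda>n. ?c n * ?K ^ n)"
    proof (rule summable_comparison_test)
      have "norm (?c n * ?K ^ n) \<le> \<bar>E z\<bar> * \<rho> * (3 / 4) ^ n" for n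
      proof -
        have "norm (?c n * ?K ^ n) = cmod (p n z) * (3 * R / 2) ^ n"
          using R by (simp add: norm_mult norm_power)
        also have "\<dots> \<le> \<bar>E z\<bar> * N (p n) * (3 * R / 2) ^ n"
          using R by (intro mult_right_mono eval_abs pX) auto
        also have "\<dots> = \<bar>E z\<bar> * (N (p n) * R ^ n) * (3 / 2) ^ n" by (simp add: power_divide power_mult_distrib)
        also have "\<dots> \<le> \<bar>E z\<bar> * (\<rho> * (1 / 2) ^ n) * (3 / 2) ^ n"
          by (intro mult_right_mono mult_left_mono pN) auto
        also have "\<dots> = \<bar>E z\<bar> * \<rho> * (3 / 4) ^ n" by (simp flip: power_mult_distrib)
        finally show ?thesis .
      qed
      then show "\<exists>n0. \<forall>n\<ge>n0. norm (?c n * ?K ^ n) \<le> \<bar>E z\<bar> * \<rho> * (3 / 4) ^ n" by blast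
      show "summable (\<lambda>n. \<bar>E z\<bar> * \<rho> * (3 / 4) ^ n)" by (intro summable_mult summable_geometric) simp
    qed
    then have "DERIV (\<lambda>x. \<Sum>n. ?c n * x ^ n) (of_real t) :> (\<Sum>n. diffs ?c n * of_real t ^ n)"
      using t R by (intro termdiffs_strong) auto
    then have "((\<lambda>x. \<Sum>n. ?c n * of_real x ^ n) has_vector_derivative (\<Sum>n. diffs ?c n * of_real t ^ n)) (at t within {0..R})"
      by (rule has_vector_derivative_real_field)
    then have D: "((\<lambda>s. ?u s z) has_vector_derivative (\<Sum>n. diffs ?c n * of_real t ^ n)) (at t within {0..R})"
      using t by (rule_tac has_vector_derivative_transform[OF t]) (auto simp: power_path_def ac_simps)
    let ?f = "\<lambda>n z. of_real (t ^ n) * p n z"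
    have fX: "?f n \<in> X" for n by (rule cmult_mem[OF pX])
    have fN: "N (?f n) \<le> \<rho> * (1 / 2) ^ n" for n
    proof -
      have "N (?f n) = t ^ n * N (p n)" using t by (simp only: N_cmult[OF pX] norm_of_real) simp
      also have "\<dots> \<le> R ^ n * N (p n)" using t N_nonneg[OF pX] by (intro mult_right_mono power_mono) auto
      finally show ?thesis using pN[of n] by (simp add: ac_simps)
    qed
    have Tf: "T (?f j) (?f k) (?f l) = of_real (t ^ (j + k + l)) *\<^sub>R T (p j) (p k) (p l)" for j k l
    proof -
      have f: "?f n = t ^ n *\<^sub>R p n" for n by (simp add: fun_eq_iff scaleR_conv_of_real)
      have h: "t ^ n *\<^sub>R p n \<in> X" for n by (rule scaleR_mem[OF pX])
      have "T (t ^ j *\<^sub>R p j) (t ^ k *\<^sub>R p k) (t ^ l *\<^sub>R p l)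
        = t ^ j *\<^sub>R T (p j) (t ^ k *\<^sub>R p k) (t ^ l *\<^sub>R p l)"
        using T_lin1[OF pX pX h h, where b = 0] by simp
      also have "\<dots> = t ^ j *\<^sub>R t ^ k *\<^sub>R T (p j) (p k) (t ^ l *\<^sub>R p l)"
        using T_lin2[OF pX pX pX h, where b = 0] by simp
      also have "\<dots> = t ^ j *\<^sub>R t ^ k *\<^sub>R t ^ l *\<^sub>R T (p j) (p k) (p l)"
        using T_lin3[OF pX pX pX pX, where b = 0] by simp
      finally show ?thesis unfolding f by (simp add: power_add)
    qed
    have "(\<lambda>n. \<Sum>j\<le>n. \<Sum>k\<le>n - j. T (?f j) (?f k) (?f (n - j - k)) z) sums T (?u t) (?u t) (?u t) z"
      using t by (intro T_geometric_series[OF fX fN]) (simp add: power_path_def)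
    moreover have "(\<Sum>j\<le>n. \<Sum>k\<le>n - j. T (?f j) (?f k) (?f (n - j - k)) z) = \<i> * (diffs ?c n * of_real t ^ n)" for n
    proof -
      have "(\<Sum>j\<le>n. \<Sum>k\<le>n - j. T (?f j) (?f k) (?f (n - j - k)) z)
         = (\<Sum>j\<le>n. \<Sum>k\<le>n - j. of_real (t ^ n) * T (p j) (p k) (p (n - j - k)) z)"
        unfolding Tf by (intro sum.cong refl) (auto simp: scaleR_conv_of_real)
      also have "\<dots> = of_real (t ^ n) * (\<Sum>j\<le>n. \<Sum>k\<le>n - j. T (p j) (p k) (p (n - j - k)) z)"
        by (simp add: sum_distrib_left)
      also have "\<dots> = \<i> * (diffs ?c n * of_real t ^ n)"
      proof -
        \<comment> \<open>\<open>diffs\<close> multiplies the coefficient by \<open>n + 1\<close>,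
          which cancels the denominator in \<open>pSuc\<close>.\<close>
        have "a \<noteq> 0 \<Longrightarrow> a * (- \<i> / a * s) = - \<i> * s" for a s :: complex by simp
        from this[OF of_nat_neq_0] have "diffs ?c n = - \<i> * (\<Sum>j\<le>n. \<Sum>k\<le>n - j. T (p j) (p k) (p (n - j - k)) z)"
          unfolding diffs_def pSuc .
        moreover have "w * s = \<i> * (- \<i> * s * w)" for w s :: complex by (simp only: mult.assoc[symmetric]) (simp add: mult.commute)
        ultimately show ?thesis by (simp only: of_real_power)
      qed
      finally show ?thesis .
    qed
    ultimately have sm: "(\<lambda>n. \<i> * (diffs ?c n * of_real t ^ n)) sums T (?u t) (?u t) (?u t) z" by simp
    have "\<i> * (\<Sum>n. diffs ?c n * of_real t ^ n) = T (?u t) (?u t) (?u t) z"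
      using sums_mult[OF sm, of "- \<i>"] by (simp add: sums_iff)
    also have "\<dots> = G (?u t) z" using G path t by (auto simp: path_space_def)
    finally show ?thesis using D by blast
  qed
  moreover have "(\<lambda>n. coef n (replicate (2 * n + 1) v)) = p" by (intro ext) (simp only: p_def)
  ultimately show ?thesis unfolding solves_def using path u0 by simp
qed

lemma cubic_well_posed:
  assumes G: "\<And>u. u \<in> X \<Longrightarrow> G u = T u u u"
  shows "locally_well_posed X N G"
  unfolding locally_well_posed_def
proof
  fix u0 assume u0: "u0 \<in> X"
  \<comment> \<open>\<open>\<rho>\<close> bounds the norm on the unit ball around \<open>u0\<close>.
    With this \<open>R\<close> the ratio \<open>2 * C * \<rho>^2 * R\<close> is
    \<open>C / (2 * (C + 1))\<close>, below \<open>1/2\<close>; using \<open>C + 1\<close> instead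
    of \<open>C\<close> allows \<open>C = 0\<close>.\<close>
  define \<rho> R where "\<rho> = N u0 + 1" and "R = 1 / (4 * (C + 1) * \<rho>\<^sup>2)"
  let ?\<Phi> = "\<lambda>v. power_path R (\<lambda>n. coef n (replicate (2 * n + 1) v))"
  have \<rho>: "1 \<le> \<rho>" using N_nonneg[OF u0] by (simp add: \<rho>_def)
  have R: "R > 0" using \<rho> C_nonneg by (simp add: R_def)
  have "2 * C * \<rho>\<^sup>2 * R = C / (C + 1) * (1 / 2)" 
  proof -
    have "\<rho> \<noteq> 0" "C + 1 \<noteq> 0" using \<rho> C_nonneg by auto
    then show ?thesis by (simp add: R_def power2_eq_square divide_simps)
  qed
  also have "\<dots> \<le> 1 * (1 / 2)" using C_nonneg by (intro mult_right_mono) auto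
  finally have R2: "2 * C * \<rho>\<^sup>2 * R \<le> 1 / 2" by simp
  have le: "N v \<le> \<rho>" if "v \<in> X" "N (v - u0) < 1" for v
    using N_add[OF diff_mem[OF that(1) u0] u0] that(2) by (simp add: \<rho>_def)
  have sol: "solves X N G R v (?\<Phi> v)" if "v \<in> X" "N (v - u0) < 1" for v
    by (rule power_path_solves[OF that(1) le[OF that] \<rho> R R2 G])
  show "\<exists>T>0. \<exists>r>0. \<exists>\<Phi>. (\<forall>v\<in>X. N (v - u0) < r \<longrightarrow> solves X N G T v (\<Phi> v) \<and>
           (\<forall>w. solves X N G T v w \<longrightarrow> (\<forall>t\<in>{0..T}. w t = \<Phi> v t))) \<and>
        smooth_map_on X N (path_space T X N) (path_norm T N) {v \<in> X. N (v - u0) < r} \<Phi>"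
  proof (rule exI[of _ R], rule conjI[OF R], rule exI[of _ 1], rule conjI[OF zero_less_one], rule exI[of _ ?\<Phi>], intro conjI ballI impI allI)
    fix v assume v: "v \<in> X" "N (v - u0) < 1"
    show "solves X N G R v (?\<Phi> v)" by (rule sol[OF v])
    fix w t assume "solves X N G R v w" "t \<in> {0..R}"
    then show "w t = ?\<Phi> v t" by (intro solution_unique[OF G sol[OF v]])
  next
    show "smooth_map_on X N (path_space R X N) (path_norm R N) {v \<in> X. N (v - u0) < 1} ?\<Phi>"
    proof (rule power_path_smooth[OF _ _ \<rho> R])
      show "multilin (2 * n + 1) ((2 * C) ^ n) (coef n)" for n
        using inv_sqrt_coeff_bounds[of n] C_nonneg
        by (intro multilin_mono[OF multilin_coef]) (auto intro!: mult_left_le)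
      show "{v \<in> X. N (v - u0) < 1} \<subseteq> {v \<in> X. N v \<le> \<rho>}" using le by auto
      fix k
      have "\<bar>2 * C * \<rho>\<^sup>2 * R\<bar> < 1" using R2 C_nonneg R by simp
      then have "summable (\<lambda>n. \<rho> * (real (2 * n + 1) ^ k * (2 * C * \<rho>\<^sup>2 * R) ^ n))"
        by (intro summable_mult summable_poly_geometric)
      then show "summable (\<lambda>n. (2 * C) ^ n * real (2 * n + 1) ^ k * \<rho> ^ (2 * n + 1) * R ^ n)"
        unfolding power_add power_mult by (simp add: power_mult_distrib ac_simps)
    qed simp
  qed
qed

end

section \<open>Weighted sequences\<close>

lemma bracket_ge_1: "1 \<le> bracket z"
  by (simp add: bracket_def)

lemma bracket_pos [simp]: "0 < bracket z"
  using bracket_ge_1[of z] by linarith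

lemma bracket_nonzero [simp]: "bracket z \<noteq> 0"
  using bracket_pos[of z] by linarith

lemma bracket_powr_ge_1: "0 \<le> \<alpha> \<Longrightarrow> 1 \<le> bracket z powr \<alpha>"
  using bracket_ge_1 by (rule ge_one_powr_ge_zero)

lemma peetre: "bracket z \<le> sqrt 2 * bracket (z + w) * bracket w"
proof -
  have "norm z \<le> norm (z + w) + norm w" using norm_triangle_ineq4[of "z + w" w] by simp
  then have "(norm z)\<^sup>2 \<le> (norm (z + w) + norm w)\<^sup>2" by (intro power_mono) auto
  also have "\<dots> \<le> 2 * (norm (z + w))\<^sup>2 + 2 * (norm w)\<^sup>2" using sum_squares_bound[of "norm (z + w)" "norm w"] by (simp add: power2_sum)
  also have "1 + \<dots> \<le> 2 * (1 + (norm (z + w))\<^sup>2) * (1 + (norm w)\<^sup>2)" by (simp add: algebra_simps)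
  finally have "1 + (norm z)\<^sup>2 \<le> 2 * (1 + (norm (z + w))\<^sup>2) * (1 + (norm w)\<^sup>2)" by simp
  then show ?thesis unfolding bracket_def by (simp flip: real_sqrt_mult)
qed

lemma peetre_powr:
  assumes "0 \<le> \<alpha>"
  shows "bracket z powr \<alpha> \<le> 2 powr (\<alpha> / 2) * bracket (z + w) powr \<alpha> * bracket w powr \<alpha>"
proof -
  have "bracket z powr \<alpha> \<le> (sqrt 2 * bracket (z + w) * bracket w) powr \<alpha>"
    using assms by (intro powr_mono2 peetre) (auto intro: less_imp_le)
  also have "\<dots> = 2 powr (\<alpha> / 2) * bracket (z + w) powr \<alpha> * bracket w powr \<alpha>"
    by (simp add: powr_mult less_imp_le powr_half_sqrt[symmetric] powr_powr)
  finally show ?thesis .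
qed

lemma linfI:
  assumes "\<And>k. bracket (real_of_int k) powr \<alpha> * cmod (l k) \<le> B"
  shows "l \<in> linf_space \<alpha> \<and> linf_norm \<alpha> l \<le> B"
  using assms by (auto simp: linf_space_def linf_norm_def intro!: bdd_aboveI2 cSUP_least)

lemma linfD: "l \<in> linf_space \<alpha> \<Longrightarrow> bracket (real_of_int k) powr \<alpha> * cmod (l k) \<le> linf_norm \<alpha> l"
  unfolding linf_norm_def linf_space_def by (auto intro!: cSUP_upper2[OF _ _ order_refl])

lemma linf_norm_nonneg: "l \<in> linf_space \<alpha> \<Longrightarrow> 0 \<le> linf_norm \<alpha> l"
  by (rule order_trans[OF _ linfD[of l \<alpha> 0]]) simp_all

lemma linf_cmod_le:
  assumes "0 \<le> \<alpha>" "l \<in> linf_space \<alpha>"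
  shows "cmod (l k) \<le> linf_norm \<alpha> l"
proof -
  have "1 * cmod (l k) \<le> bracket (real_of_int k) powr \<alpha> * cmod (l k)"
    using bracket_powr_ge_1[OF assms(1)] by (intro mult_right_mono) auto
  then show ?thesis using linfD[OF assms(2), of k] by linarith
qed

lemma banach_fun_linf:
  assumes \<alpha>: "0 \<le> \<alpha>"
  shows "banach_fun (linf_space \<alpha>) (linf_norm \<alpha>) (\<lambda>_. 1)"
proof
  show "0 \<in> linf_space \<alpha>" using linfI[of \<alpha> 0 0] by simp
next
  fix f g :: "int \<Rightarrow> complex" assume f: "f \<in> linf_space \<alpha>" and g: "g \<in> linf_space \<alpha>"
  have "f + g \<in> linf_space \<alpha> \<and> linf_norm \<alpha> (f + g) \<le> linf_norm \<alpha> f + linf_norm \<alpha> g"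
  proof (rule linfI)
    fix k
    have "bracket (real_of_int k) powr \<alpha> * cmod ((f + g) k) \<le> bracket (real_of_int k) powr \<alpha> * (cmod (f k) + cmod (g k))"
      by (intro mult_left_mono) (auto intro: norm_triangle_ineq)
    then show "bracket (real_of_int k) powr \<alpha> * cmod ((f + g) k) \<le> linf_norm \<alpha> f + linf_norm \<alpha> g"
      using linfD[OF f, of k] linfD[OF g, of k] by (simp add: distrib_left)
  qed
  then show "f + g \<in> linf_space \<alpha>" "linf_norm \<alpha> (f + g) \<le> linf_norm \<alpha> f + linf_norm \<alpha> g" by auto
next
  have scale: "(\<lambda>z. c * f z) \<in> linf_space \<alpha> \<and> linf_norm \<alpha> (\<lambda>z. c * f z) \<le> cmod c * linf_norm \<alpha> f"
    if f: "f \<in> linf_space \<alpha>" for f c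
  proof (rule linfI)
    fix k
    show "bracket (real_of_int k) powr \<alpha> * cmod (c * f k) \<le> cmod c * linf_norm \<alpha> f"
      using mult_left_mono[OF linfD[OF f, of k], of "cmod c"] by (simp add: norm_mult ac_simps)
  qed
  fix f :: "int \<Rightarrow> complex" and c assume f: "f \<in> linf_space \<alpha>"
  show "(\<lambda>z. c * f z) \<in> linf_space \<alpha>" using scale[OF f] by simp
  show "linf_norm \<alpha> (\<lambda>z. c * f z) \<le> cmod c * linf_norm \<alpha> f" using scale[OF f] by simp
next
  fix f :: "int \<Rightarrow> complex" assume f: "f \<in> linf_space \<alpha>"
  show "0 \<le> linf_norm \<alpha> f" by (rule linf_norm_nonneg[OF f])
  show "cmod (f z) \<le> 1 * linf_norm \<alpha> f" for z using linf_cmod_le[OF \<alpha> f] by simp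
next
  fix gs :: "nat \<Rightarrow> int \<Rightarrow> complex" and B f
  assume gs: "\<And>n. gs n \<in> linf_space \<alpha>" "\<And>n. linf_norm \<alpha> (gs n) \<le> B" and lim: "\<And>z. (\<lambda>n. gs n z) \<longlonglongrightarrow> f z"
  show "f \<in> linf_space \<alpha> \<and> linf_norm \<alpha> f \<le> B"
  proof (rule linfI)
    fix k
    have lim': "(\<lambda>n. bracket (real_of_int k) powr \<alpha> * cmod (gs n k)) \<longlonglongrightarrow> bracket (real_of_int k) powr \<alpha> * cmod (f k)"
      by (intro tendsto_intros lim)
    have "bracket (real_of_int k) powr \<alpha> * cmod (gs n k) \<le> B" for n
      using linfD[OF gs(1)] gs(2) order_trans by blast
    then show "bracket (real_of_int k) powr \<alpha> * cmod (f k) \<le> B" by (intro LIMSEQ_le_const2[OF lim'] exI[of _ 0]) simp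
  qed
qed

lemma gauss_bracket_summable_int:
  fixes c :: real assumes "c > 0"
  shows "(\<lambda>q::int. exp (- c * (real_of_int q)\<^sup>2) * bracket (real_of_int q) powr \<alpha>) summable_on UNIV" (is "?g summable_on _")
proof -
  let ?h = "\<lambda>n::nat. exp (- c * (real n)\<^sup>2) * bracket (real n) powr \<alpha>"
  have "summable ?h"
  proof (rule summable_comparison_test_bigo)
    have "(\<lambda>n::nat. exp (- c * (real n)\<^sup>2) * sqrt (1 + (real n)\<^sup>2) powr \<alpha>) \<in> O(\<lambda>n. exp (- real n))"
      using assms by real_asymp
    then show "?h \<in> O(\<lambda>n. exp (- real n))" by (simp add: bracket_def)
    have "summable (\<lambda>n. exp (- 1 :: real) ^ n)" by (intro summable_geometric) simp
    moreover have "exp (- 1 :: real) ^ n = norm (exp (- real n))" for n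
      using exp_of_nat_mult[of n "- 1 :: real"] by simp
    ultimately show "summable (\<lambda>n. norm (exp (- real n)))" by (simp only:)
  qed
  then have h: "?h summable_on UNIV" by (subst summable_on_UNIV_nonneg_real_iff) auto
  have inj: "inj int" "inj (\<lambda>n. - int n)" by (auto simp: inj_on_def)
  have g: "?g summable_on range int" "?g summable_on range (\<lambda>n. - int n)"
    using h by (simp_all add: summable_on_reindex[OF inj(1)] summable_on_reindex[OF inj(2)] o_def bracket_def)
  \<comment> \<open>Both half-lines contain \<open>0\<close>, so one is removed from the other
    before the union is formed.\<close>
  have "?g summable_on (range (\<lambda>n. - int n) - range int)"
    by (rule summable_on_subset_banach[OF g(2)]) auto
  then have "?g summable_on (range int \<union> (range (\<lambda>n. - int n) - range int))"
    by (rule summable_on_Un_disjoint[OF g(1)]) auto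
  also have "range int \<union> (range (\<lambda>n. - int n) - range int) = UNIV"
  proof -
    have "x \<in> range int \<or> x \<in> range (\<lambda>n. - int n)" for x
      by (cases x rule: int_cases2) auto
    then show ?thesis by auto
  qed
  finally show ?thesis .
qed

definition coord_term :: "real \<Rightarrow> (int \<Rightarrow> complex) \<Rightarrow> (int \<Rightarrow> complex) \<Rightarrow> (int \<Rightarrow> complex) \<Rightarrow> int \<times> int \<times> int \<Rightarrow> complex" where
  "coord_term \<gamma> a b c = (\<lambda>(k, l, m). complex_of_real (1 / (\<gamma> * sqrt pi) *
          exp (- (pi\<^sup>2 / \<gamma>\<^sup>2) * ((real_of_int (l - k))\<^sup>2 + (real_of_int (l - m))\<^sup>2)))
        * a k * cnj (b l) * c m)"

lemma coord_term_lincomb: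
  "coord_term \<gamma> (x *\<^sub>R a + y *\<^sub>R a') b c t = x *\<^sub>R coord_term \<gamma> a b c t + y *\<^sub>R coord_term \<gamma> a' b c t"
  "coord_term \<gamma> b (x *\<^sub>R a + y *\<^sub>R a') c t = x *\<^sub>R coord_term \<gamma> b a c t + y *\<^sub>R coord_term \<gamma> b a' c t"
  "coord_term \<gamma> b c (x *\<^sub>R a + y *\<^sub>R a') t = x *\<^sub>R coord_term \<gamma> b c a t + y *\<^sub>R coord_term \<gamma> b c a' t"
  unfolding coord_term_def case_prod_beta
  by (simp_all only: plus_fun_apply scaleR_fun_apply scaleR_conv_of_real complex_cnj_add complex_cnj_mult
      complex_cnj_complex_of_real distrib_left distrib_right ac_simps)

definition coord_trilinear :: "real \<Rightarrow> (int \<Rightarrow> complex) \<Rightarrow> (int \<Rightarrow> complex) \<Rightarrow> (int \<Rightarrow> complex) \<Rightarrow> int \<Rightarrow> complex" where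
  "coord_trilinear \<gamma> a b c n = infsum (coord_term \<gamma> a b c) {(k, l, m). k - l + m = n}"

text \<open>In the variables \<open>p = k - l\<close>, \<open>q = m - l\<close> the kernel is a
  product of two Gaussians. The extra factor is the cost of moving the weight from \<open>n\<close>
  to \<open>k\<close>, since \<open>n - k = q\<close>.\<close>

definition coord_weight :: "real \<Rightarrow> real \<Rightarrow> int \<times> int \<Rightarrow> real" where
  "coord_weight \<gamma> \<alpha> = (\<lambda>(p, q). exp (- (pi\<^sup>2 / \<gamma>\<^sup>2) * (real_of_int p)\<^sup>2) *
     (exp (- (pi\<^sup>2 / \<gamma>\<^sup>2) * (real_of_int q)\<^sup>2) * bracket (real_of_int q) powr \<alpha>))"

lemma coord_weight_summable:
  assumes "\<gamma> > 0" shows "coord_weight \<gamma> \<alpha> summable_on UNIV"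
proof -
  define c where "c = pi\<^sup>2 / \<gamma>\<^sup>2"
  have c: "c > 0" using assms by (simp add: c_def)
  let ?g = "\<lambda>p::int. exp (- c * (real_of_int p)\<^sup>2)" and ?h = "\<lambda>q::int. exp (- c * (real_of_int q)\<^sup>2) * bracket (real_of_int q) powr \<alpha>"
  have g: "?g summable_on UNIV"
    using gauss_bracket_summable_int[OF c, of 0] by (simp add: powr_zero_eq_one less_imp_neq[symmetric])
  have "coord_weight \<gamma> \<alpha> summable_on (SIGMA x:UNIV. UNIV)"
  proof (rule summable_on_SigmaI)
    show "((\<lambda>q. coord_weight \<gamma> \<alpha> (p, q)) has_sum (?g p * infsum ?h UNIV)) UNIV" for p
      unfolding coord_weight_def prod.case c_def[symmetric]
      by (intro has_sum_cmult_right has_sum_infsum gauss_bracket_summable_int c)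
    show "(\<lambda>p. ?g p * infsum ?h UNIV) summable_on UNIV" by (intro summable_on_cmult_left g)
  qed (auto simp: coord_weight_def)
  then show ?thesis by simp
qed

lemma coord_diff_bij: "bij_betw (\<lambda>(k, l, m). (k - l, m - l)) {(k, l, m). k - l + m = n} (UNIV :: (int \<times> int) set)"
  by (rule bij_betwI[where g = "\<lambda>(p, q). (n - q, n - p - q, n - p)"]) auto

text \<open>Only the factor with index \<open>k\<close> has to carry the weight, by Peetre's
  inequality with the shift \<open>n - k = m - l\<close>. The other two are estimated by their plain
  suprema, where \<open>0 \<le> \<alpha>\<close> enters.\<close>

lemma coord_term_bound:
  assumes "\<gamma> > 0" "0 \<le> \<alpha>" "a \<in> linf_space \<alpha>" "b \<in> linf_space \<alpha>" "c \<in> linf_space \<alpha>" "k - l + m = n"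
  shows "bracket (real_of_int n) powr \<alpha> * norm (coord_term \<gamma> a b c (k, l, m))
     \<le> 2 powr (\<alpha> / 2) / (\<gamma> * sqrt pi) * (linf_norm \<alpha> a * linf_norm \<alpha> b * linf_norm \<alpha> c) * coord_weight \<gamma> \<alpha> (k - l, m - l)"
proof -
  define e where "e = exp (- (pi\<^sup>2 / \<gamma>\<^sup>2) * ((real_of_int (l - k))\<^sup>2 + (real_of_int (l - m))\<^sup>2))"
  let ?q = "real_of_int (m - l)"
  have eW: "e * bracket ?q powr \<alpha> = coord_weight \<gamma> \<alpha> (k - l, m - l)"
  proof -
    have sq: "(real_of_int (l - k))\<^sup>2 = (real_of_int (k - l))\<^sup>2" "(real_of_int (l - m))\<^sup>2 = (real_of_int (m - l))\<^sup>2"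
      unfolding of_int_diff by (rule power2_commute)+
    show ?thesis unfolding e_def coord_weight_def sq by (simp only: exp_add distrib_left prod.case mult.assoc)
  qed
  have nn: "0 \<le> linf_norm \<alpha> a" "0 \<le> linf_norm \<alpha> b" "0 \<le> linf_norm \<alpha> c" using assms linf_norm_nonneg by auto
  have "real_of_int n + - ?q = real_of_int k" using assms(6) by auto
  moreover have "bracket (- ?q) = bracket ?q" by (simp only: bracket_def norm_minus_cancel)
  ultimately have "bracket (real_of_int n) powr \<alpha> \<le> 2 powr (\<alpha> / 2) * bracket (real_of_int k) powr \<alpha> * bracket ?q powr \<alpha>"
    using peetre_powr[OF assms(2), of "real_of_int n" "- ?q"] by (simp only:)
  then have "bracket (real_of_int n) powr \<alpha> * cmod (a k)
     \<le> 2 powr (\<alpha> / 2) * bracket (real_of_int k) powr \<alpha> * bracket ?q powr \<alpha> * cmod (a k)"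
    by (intro mult_right_mono) auto
  also have "\<dots> = 2 powr (\<alpha> / 2) * bracket ?q powr \<alpha> * (bracket (real_of_int k) powr \<alpha> * cmod (a k))" by simp
  also have "\<dots> \<le> 2 powr (\<alpha> / 2) * bracket ?q powr \<alpha> * linf_norm \<alpha> a"
    by (intro mult_left_mono linfD assms) auto
  finally have 1: "bracket (real_of_int n) powr \<alpha> * cmod (a k) \<le> 2 powr (\<alpha> / 2) * bracket ?q powr \<alpha> * linf_norm \<alpha> a" .
  have e0: "0 \<le> e / (\<gamma> * sqrt pi)" using assms(1) by (simp add: e_def)
  have "bracket (real_of_int n) powr \<alpha> * norm (coord_term \<gamma> a b c (k, l, m))
     = e / (\<gamma> * sqrt pi) * ((bracket (real_of_int n) powr \<alpha> * cmod (a k)) * cmod (b l) * cmod (c m))"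
  proof -
    have "\<bar>1 / (\<gamma> * sqrt pi) * e\<bar> = e / (\<gamma> * sqrt pi)" using abs_of_nonneg[OF e0] by simp
    then have "norm (coord_term \<gamma> a b c (k, l, m)) = e / (\<gamma> * sqrt pi) * cmod (a k) * cmod (b l) * cmod (c m)"
      by (simp only: coord_term_def prod.case e_def[symmetric] norm_mult norm_of_real complex_mod_cnj)
    then show ?thesis by (simp only: ac_simps)
  qed
  also have "\<dots> \<le> e / (\<gamma> * sqrt pi) * ((2 powr (\<alpha> / 2) * bracket ?q powr \<alpha> * linf_norm \<alpha> a) * linf_norm \<alpha> b * linf_norm \<alpha> c)"
    using e0 nn by (intro mult_left_mono mult_mono 1 linf_cmod_le assms) auto
  also have "\<dots> = 2 powr (\<alpha> / 2) / (\<gamma> * sqrt pi) * (linf_norm \<alpha> a * linf_norm \<alpha> b * linf_norm \<alpha> c) * (e * bracket ?q powr \<alpha>)"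
    by simp
  finally show ?thesis unfolding eW .
qed

text \<open>The map to \<open>(k - l, m - l)\<close> carries each set \<open>k - l + m = n\<close>
  onto all pairs of integers, so the weights have the same sum for every \<open>n\<close>.\<close>

lemma coord_trilinear_bound:
  assumes "\<gamma> > 0" "0 \<le> \<alpha>" "a \<in> linf_space \<alpha>" "b \<in> linf_space \<alpha>" "c \<in> linf_space \<alpha>"
  shows "coord_term \<gamma> a b c summable_on {(k, l, m). k - l + m = n}" (is "_ summable_on ?S n")
    and "coord_trilinear \<gamma> a b c \<in> linf_space \<alpha>"
    and "linf_norm \<alpha> (coord_trilinear \<gamma> a b c)
      \<le> 2 powr (\<alpha> / 2) / (\<gamma> * sqrt pi) * infsum (coord_weight \<gamma> \<alpha>) UNIV * (linf_norm \<alpha> a * linf_norm \<alpha> b * linf_norm \<alpha> c)"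
proof -
  define D where "D = 2 powr (\<alpha> / 2) / (\<gamma> * sqrt pi) * (linf_norm \<alpha> a * linf_norm \<alpha> b * linf_norm \<alpha> c)"
  let ?W = "\<lambda>(k, l, m). coord_weight \<gamma> \<alpha> (k - l, m - l)"
  have W: "?W = (\<lambda>x. coord_weight \<gamma> \<alpha> ((\<lambda>(k, l, m). (k - l, m - l)) x))" by auto
  have Wsum: "(?W has_sum infsum (coord_weight \<gamma> \<alpha>) UNIV) (?S n)" for n
    unfolding W has_sum_reindex_bij_betw[OF coord_diff_bij]
    by (intro has_sum_infsum coord_weight_summable assms)
  have le: "norm (coord_term \<gamma> a b c x) \<le> D / bracket (real_of_int n) powr \<alpha> * ?W x" if "x \<in> ?S n" for x n
  proof -
    obtain k l m where x: "x = (k, l, m)" by (cases x)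
    have "bracket (real_of_int n) powr \<alpha> * norm (coord_term \<gamma> a b c (k, l, m)) \<le> D * coord_weight \<gamma> \<alpha> (k - l, m - l)"
      unfolding D_def using that by (intro coord_term_bound[OF assms]) (simp add: x)
    then show ?thesis unfolding x by (simp add: pos_le_divide_eq mult.commute)
  qed
  note DW = has_sum_cmult_right[OF Wsum]
  have summ: "coord_term \<gamma> a b c summable_on ?S n" for n
  proof (rule Infinite_Sum.abs_summable_summable)
    show "(\<lambda>x. norm (coord_term \<gamma> a b c x)) summable_on ?S n"
      by (rule Infinite_Sum.abs_summable_on_comparison_test'[OF has_sum_imp_summable[OF DW] le])
  qed
  then show "coord_term \<gamma> a b c summable_on ?S n" .
  have "coord_trilinear \<gamma> a b c \<in> linf_space \<alpha> \<and> linf_norm \<alpha> (coord_trilinear \<gamma> a b c) \<le> D * infsum (coord_weight \<gamma> \<alpha>) UNIV"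
  proof (rule linfI)
    fix n
    have "norm (coord_trilinear \<gamma> a b c n) \<le> D / bracket (real_of_int n) powr \<alpha> * infsum (coord_weight \<gamma> \<alpha>) UNIV"
      unfolding coord_trilinear_def by (rule norm_infsum_le[OF has_sum_infsum[OF summ] DW le])
    then show "bracket (real_of_int n) powr \<alpha> * cmod (coord_trilinear \<gamma> a b c n) \<le> D * infsum (coord_weight \<gamma> \<alpha>) UNIV"
      by (simp add: pos_le_divide_eq mult.commute)
  qed
  then show "coord_trilinear \<gamma> a b c \<in> linf_space \<alpha>"
    "linf_norm \<alpha> (coord_trilinear \<gamma> a b c)
      \<le> 2 powr (\<alpha> / 2) / (\<gamma> * sqrt pi) * infsum (coord_weight \<gamma> \<alpha>) UNIV * (linf_norm \<alpha> a * linf_norm \<alpha> b * linf_norm \<alpha> c)"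
    by (simp_all add: D_def ac_simps)
qed

lemma cubic_space_linf:
  assumes \<gamma>: "\<gamma> > 0" and \<alpha>: "0 \<le> \<alpha>"
  shows "cubic_space (linf_space \<alpha>) (linf_norm \<alpha>) (\<lambda>_. 1) (coord_trilinear \<gamma>)
    (2 powr (\<alpha> / 2) / (\<gamma> * sqrt pi) * infsum (coord_weight \<gamma> \<alpha>) UNIV)"
proof -
  interpret banach_fun "linf_space \<alpha>" "linf_norm \<alpha>" "\<lambda>_. 1" by (rule banach_fun_linf[OF \<alpha>])
  let ?X = "linf_space \<alpha>" and ?T = "coord_trilinear \<gamma>" and ?S = "\<lambda>n. {(k, l, m). k - l + m = (n::int)}"
  have lin: "?T f1 f2 f3 = x *\<^sub>R ?T g1 g2 g3 + y *\<^sub>R ?T h1 h2 h3"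
    if "g1 \<in> ?X" "g2 \<in> ?X" "g3 \<in> ?X" "h1 \<in> ?X" "h2 \<in> ?X" "h3 \<in> ?X"
      "\<And>t. coord_term \<gamma> f1 f2 f3 t = x *\<^sub>R coord_term \<gamma> g1 g2 g3 t + y *\<^sub>R coord_term \<gamma> h1 h2 h3 t"
    for f1 f2 f3 g1 g2 g3 h1 h2 h3 x y
  proof
    fix n
    have "(coord_term \<gamma> f1 f2 f3 has_sum (x *\<^sub>R ?T g1 g2 g3 n + y *\<^sub>R ?T h1 h2 h3 n)) (?S n)"
      unfolding that(7)[abs_def] coord_trilinear_def scaleR_conv_of_real
      by (intro has_sum_add has_sum_cmult_right has_sum_infsum coord_trilinear_bound(1)[OF \<gamma> \<alpha> that(1-3)]
          coord_trilinear_bound(1)[OF \<gamma> \<alpha> that(4-6)])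
    then show "?T f1 f2 f3 n = (x *\<^sub>R ?T g1 g2 g3 + y *\<^sub>R ?T h1 h2 h3) n"
      by (simp add: coord_trilinear_def infsumI)
  qed
  show ?thesis
  proof
    fix u v w assume uvw: "u \<in> ?X" "v \<in> ?X" "w \<in> ?X"
    show "?T u v w \<in> ?X" "linf_norm \<alpha> (?T u v w) \<le> 2 powr (\<alpha> / 2) / (\<gamma> * sqrt pi) * infsum (coord_weight \<gamma> \<alpha>) UNIV *
        (linf_norm \<alpha> u * linf_norm \<alpha> v * linf_norm \<alpha> w)"
      by (rule coord_trilinear_bound[OF \<gamma> \<alpha> uvw])+
  next
    show "0 \<le> 2 powr (\<alpha> / 2) / (\<gamma> * sqrt pi) * infsum (coord_weight \<gamma> \<alpha>) UNIV"
      using \<gamma> by (intro mult_nonneg_nonneg infsum_nonneg) (auto simp: coord_weight_def)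
  qed (rule lin; (assumption | rule coord_term_lincomb))+
qed

lemma well_posed_linf:
  assumes "\<gamma> > 0" "0 \<le> \<alpha>"
  shows "locally_well_posed (linf_space \<alpha>) (linf_norm \<alpha>) (cubic_coord \<gamma>)"
proof -
  interpret cubic_space "linf_space \<alpha>" "linf_norm \<alpha>" "\<lambda>_. 1" "coord_trilinear \<gamma>"
    "2 powr (\<alpha> / 2) / (\<gamma> * sqrt pi) * infsum (coord_weight \<gamma> \<alpha>) UNIV"
    by (rule cubic_space_linf[OF assms])
  show ?thesis
    by (rule cubic_well_posed) (simp add: cubic_coord_def coord_trilinear_def coord_term_def fun_eq_iff)
qed

section \<open>Mean value property over discs\<close>

text \<open>Agreement on boxes suffices; this gives access to Tonelli's theorem in the real and
  imaginary parts.\<close>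

lemma lborel_complex_eq: "(lborel :: complex measure) = distr lborel borel (\<lambda>(x, y). Complex x y)"
proof (rule lborel_eqI)
  have meas: "(\<lambda>(x, y). Complex x y) \<in> borel_measurable borel"
    by (intro borel_measurable_continuous_onI) (auto intro!: continuous_intros simp: case_prod_beta Complex_eq)
  fix l u :: complex assume le: "\<And>b. b \<in> Basis \<Longrightarrow> l \<bullet> b \<le> u \<bullet> b"
  have "emeasure (distr lborel borel (\<lambda>(x, y). Complex x y)) (box l u)
     = emeasure lborel ((\<lambda>(x, y). Complex x y) -` box l u)"
    using meas by (subst emeasure_distr) auto
  also have "(\<lambda>(x, y). Complex x y) -` box l u = box (Re l, Im l) (Re u, Im u)"
    by (auto simp: box_def Basis_complex_def Basis_prod_def)
  also have "emeasure lborel \<dots> = ennreal ((Re u - Re l) * (Im u - Im l))"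
  proof -
    have eq: "(\<Prod>b\<in>(Basis :: (real \<times> real) set). f b) = f (1, 0) * f (0, 1)" for f :: "real \<times> real \<Rightarrow> real"
      by (simp add: Basis_prod_def)
    have "emeasure lborel (box (Re l, Im l) (Re u, Im u)) = (\<Prod>b\<in>Basis. ((Re u, Im u) - (Re l, Im l)) \<bullet> b)"
      using le[of 1] le[of \<i>] by (intro emeasure_lborel_box) (auto simp: Basis_complex_def Basis_prod_def)
    then show ?thesis by (simp add: eq)
  qed
  also have "(Re u - Re l) * (Im u - Im l) = (\<Prod>b\<in>Basis. (u - l) \<bullet> b)"
    by (simp add: Basis_complex_def)
  finally show "emeasure (distr lborel borel (\<lambda>(x, y). Complex x y)) (box l u) = ennreal (\<Prod>b\<in>Basis. (u - l) \<bullet> b)" .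
qed simp

lemma nn_integral_complex:
  fixes H :: "complex \<Rightarrow> ennreal"
  assumes [measurable]: "H \<in> borel_measurable borel"
  shows "(\<integral>\<^sup>+z. H z \<partial>lborel) = (\<integral>\<^sup>+x. \<integral>\<^sup>+y. H (Complex x y) \<partial>lborel \<partial>lborel)"
    and "(\<integral>\<^sup>+z. H z \<partial>lborel) = (\<integral>\<^sup>+y. \<integral>\<^sup>+x. H (Complex x y) \<partial>lborel \<partial>lborel)"
proof -
  have meas [measurable]: "(\<lambda>(x, y). Complex x y) \<in> borel_measurable borel"
    by (intro borel_measurable_continuous_onI) (auto intro!: continuous_intros simp: case_prod_beta Complex_eq)
  have "(\<integral>\<^sup>+z. H z \<partial>lborel) = (\<integral>\<^sup>+p. H (case p of (x, y) \<Rightarrow> Complex x y) \<partial>(lborel \<Otimes>\<^sub>M lborel))"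
    unfolding lborel_complex_eq lborel_prod by (subst nn_integral_distr) auto
  then have eq: "(\<integral>\<^sup>+z. H z \<partial>lborel) = (\<integral>\<^sup>+p. (\<lambda>(x, y). H (Complex x y)) p \<partial>(lborel \<Otimes>\<^sub>M lborel))"
    by (simp add: case_prod_beta)
  have "(\<lambda>p. H (case p of (x, y) \<Rightarrow> Complex x y)) \<in> borel_measurable borel" by measurable
  then have m: "(\<lambda>(x, y). H (Complex x y)) \<in> borel_measurable (lborel \<Otimes>\<^sub>M lborel)"
    by (simp add: case_prod_beta lborel_prod)
  show "(\<integral>\<^sup>+z. H z \<partial>lborel) = (\<integral>\<^sup>+x. \<integral>\<^sup>+y. H (Complex x y) \<partial>lborel \<partial>lborel)"
    unfolding eq by (subst lborel.nn_integral_fst[symmetric, OF m]) simp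
  show "(\<integral>\<^sup>+z. H z \<partial>lborel) = (\<integral>\<^sup>+y. \<integral>\<^sup>+x. H (Complex x y) \<partial>lborel \<partial>lborel)"
    unfolding eq by (subst lborel_pair.nn_integral_snd[symmetric, OF m]) simp
qed

lemma nn_integral_lborel_shift:
  fixes H :: "'a::euclidean_space \<Rightarrow> ennreal"
  assumes [measurable]: "H \<in> borel_measurable borel"
  shows "(\<integral>\<^sup>+z. H (z + a) \<partial>lborel) = (\<integral>\<^sup>+z. H z \<partial>lborel)"
proof -
  have "(\<integral>\<^sup>+z. H z \<partial>lborel) = (\<integral>\<^sup>+z. H z \<partial>(distr lborel borel ((+) a)))" by (simp only: lborel_distr_plus)
  also have "\<dots> = (\<integral>\<^sup>+z. H (z + a) \<partial>lborel)" by (subst nn_integral_distr) (auto simp: add.commute)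
  finally show ?thesis by simp
qed

text \<open>A rotation other than \<open>- 1\<close> is a product of three shears, which preserve Lebesgue measure by Fubini.\<close>

lemma nn_integral_rotation:
  fixes H :: "complex \<Rightarrow> ennreal"
  assumes [measurable]: "H \<in> borel_measurable borel" and w: "cmod w = 1"
  shows "(\<integral>\<^sup>+z. H (w * z) \<partial>lborel) = (\<integral>\<^sup>+z. H z \<partial>lborel)"
proof -
  have cont1: "continuous_on UNIV (\<lambda>z. z + of_real (t * Im z))" and cont2: "continuous_on UNIV (\<lambda>z. z + \<i> * of_real (t * Re z))" for t
    by (auto intro!: continuous_intros)
  have shear1: "(\<integral>\<^sup>+z. H (z + of_real (t * Im z)) \<partial>lborel) = (\<integral>\<^sup>+z. H z \<partial>lborel)"
    if [measurable]: "H \<in> borel_measurable borel" for t and H :: "complex \<Rightarrow> ennreal"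
  proof -
    have [measurable]: "(\<lambda>z::complex. z + of_real (t * Im z)) \<in> borel_measurable borel"
      by (rule borel_measurable_continuous_onI[OF cont1])
    have m: "(\<lambda>x. H (Complex x y)) \<in> borel_measurable borel" for y
    proof (rule measurable_compose[OF _ that])
      show "(\<lambda>x. Complex x y) \<in> borel_measurable borel"
        by (intro borel_measurable_continuous_onI) (auto intro!: continuous_intros simp: Complex_eq)
    qed
    have "(\<integral>\<^sup>+z. H (z + of_real (t * Im z)) \<partial>lborel) = (\<integral>\<^sup>+y. \<integral>\<^sup>+x. H (Complex x y + of_real (t * y)) \<partial>lborel \<partial>lborel)"
      by (subst nn_integral_complex(2)) auto
    also have "\<dots> = (\<integral>\<^sup>+y. \<integral>\<^sup>+x. H (Complex (x + t * y) y) \<partial>lborel \<partial>lborel)"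
    proof -
      have "Complex x y + of_real (t * y) = Complex (x + t * y) y" for x y by (simp add: complex_eq_iff)
      then show ?thesis by simp
    qed
    also have "\<dots> = (\<integral>\<^sup>+y. \<integral>\<^sup>+x. H (Complex x y) \<partial>lborel \<partial>lborel)"
      by (intro nn_integral_cong nn_integral_lborel_shift m)
    also have "\<dots> = (\<integral>\<^sup>+z. H z \<partial>lborel)" by (rule nn_integral_complex(2)[OF that, symmetric])
    finally show ?thesis .
  qed
  have shear2: "(\<integral>\<^sup>+z. H (z + \<i> * of_real (t * Re z)) \<partial>lborel) = (\<integral>\<^sup>+z. H z \<partial>lborel)"
    if [measurable]: "H \<in> borel_measurable borel" for t and H :: "complex \<Rightarrow> ennreal"
  proof -
    have [measurable]: "(\<lambda>z::complex. z + \<i> * of_real (t * Re z)) \<in> borel_measurable borel"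
      by (rule borel_measurable_continuous_onI[OF cont2])
    have m: "(\<lambda>y. H (Complex x y)) \<in> borel_measurable borel" for x
    proof (rule measurable_compose[OF _ that])
      show "(\<lambda>y. Complex x y) \<in> borel_measurable borel"
        by (intro borel_measurable_continuous_onI) (auto intro!: continuous_intros simp: Complex_eq)
    qed
    have "(\<integral>\<^sup>+z. H (z + \<i> * of_real (t * Re z)) \<partial>lborel) = (\<integral>\<^sup>+x. \<integral>\<^sup>+y. H (Complex x y + \<i> * of_real (t * x)) \<partial>lborel \<partial>lborel)"
      by (subst nn_integral_complex(1)) auto
    also have "\<dots> = (\<integral>\<^sup>+x. \<integral>\<^sup>+y. H (Complex x (y + t * x)) \<partial>lborel \<partial>lborel)"
    proof -
      have "Complex x y + \<i> * of_real (t * x) = Complex x (y + t * x)" for x y by (simp add: complex_eq_iff)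
      then show ?thesis by simp
    qed
    also have "\<dots> = (\<integral>\<^sup>+x. \<integral>\<^sup>+y. H (Complex x y) \<partial>lborel \<partial>lborel)"
      by (intro nn_integral_cong nn_integral_lborel_shift m)
    also have "\<dots> = (\<integral>\<^sup>+z. H z \<partial>lborel)" by (rule nn_integral_complex(1)[OF that, symmetric])
    finally show ?thesis .
  qed
  have rot: "(\<integral>\<^sup>+z. H (w * z) \<partial>lborel) = (\<integral>\<^sup>+z. H z \<partial>lborel)"
    if H [measurable]: "H \<in> borel_measurable borel" and w: "cmod w = 1" "w \<noteq> - 1" for H :: "complex \<Rightarrow> ennreal" and w
  proof -
    define c s where "c = Re w" and "s = Im w"
    have cs: "c\<^sup>2 + s\<^sup>2 = 1" using w(1) by (simp add: cmod_def c_def s_def)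
    have "c \<noteq> - 1"
    proof
      assume "c = - 1"
      with cs have "s = 0" by simp
      with \<open>c = - 1\<close> w(2) show False by (simp add: c_def s_def complex_eq_iff)
    qed
    then have c1: "1 + c \<noteq> 0" by linarith
    \<comment> \<open>For \<open>w\<close> of argument \<open>\<theta>\<close> this is
      \<open>- tan (\<theta> / 2)\<close>: the rotation is the horizontal shear by \<open>a\<close>,
      then the vertical one by \<open>sin \<theta>\<close>, then the horizontal one by
      \<open>a\<close> again.\<close>
    define a where "a = - s / (1 + c)"
    have a: "a * (1 + c) = - s" using c1 by (simp add: a_def)
    have "(1 + a * s) * (1 + c) = c * (1 + c)"
    proof -
      have "(1 + a * s) * (1 + c) = 1 + c + a * (1 + c) * s" by (simp add: algebra_simps)
      also have "\<dots> = c * (1 + c)" unfolding a using cs by (simp add: algebra_simps power2_eq_square)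
      finally show ?thesis .
    qed
    then have as: "1 + a * s = c" using c1 by simp
    let ?A = "\<lambda>z. z + of_real (a * Im z)" and ?B = "\<lambda>z. z + \<i> * of_real (s * Re z)"
    have [measurable]: "?A \<in> borel_measurable borel" "?B \<in> borel_measurable borel"
      using borel_measurable_continuous_onI[OF cont1] borel_measurable_continuous_onI[OF cont2] by auto
    have "w * z = ?A (?B (?A z))" for z
    proof -
      have "Im z + s * (Re z + a * Im z) = s * Re z + (1 + a * s) * Im z" by (simp add: algebra_simps)
      then have i: "Im z + s * (Re z + a * Im z) = s * Re z + c * Im z" unfolding as .
      have "Re z + a * Im z + a * (Im z + s * (Re z + a * Im z)) = (1 + a * s) * Re z + (a * (1 + c)) * Im z"
        unfolding i by (simp add: algebra_simps)
      then have "Re z + a * Im z + a * (Im z + s * (Re z + a * Im z)) = c * Re z - s * Im z" unfolding as a by simp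
      with i show ?thesis by (simp add: complex_eq_iff c_def[symmetric] s_def[symmetric])
    qed
    then have "(\<integral>\<^sup>+z. H (w * z) \<partial>lborel) = (\<integral>\<^sup>+z. (\<lambda>z. H (?A (?B z))) (?A z) \<partial>lborel)" by simp
    also have "\<dots> = (\<integral>\<^sup>+z. H (?A (?B z)) \<partial>lborel)" by (rule shear1) measurable
    also have "\<dots> = (\<integral>\<^sup>+z. H (?A z) \<partial>lborel)" by (rule shear2[where H = "\<lambda>z. H (?A z)"]) measurable
    also have "\<dots> = (\<integral>\<^sup>+z. H z \<partial>lborel)" by (rule shear1) measurable
    finally show ?thesis .
  qed
  show ?thesis
  proof (cases "w = - 1")
    case False
    then show ?thesis using rot[OF assms(1) w] by simp
  next
    case True
    \<comment> \<open>The half turn has no such parameter, but it is the square of the quarter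
      turn.\<close>
    have i: "\<i> \<noteq> - 1" by (simp add: complex_eq_iff)
    have "(\<integral>\<^sup>+z. H (w * z) \<partial>lborel) = (\<integral>\<^sup>+z. (\<lambda>z. H (\<i> * z)) (\<i> * z) \<partial>lborel)"
      using True by (simp add: mult.assoc[symmetric])
    also have "\<dots> = (\<integral>\<^sup>+z. H (\<i> * z) \<partial>lborel)" by (rule rot[OF _ _ i]) auto
    also have "\<dots> = (\<integral>\<^sup>+z. H z \<partial>lborel)" by (rule rot[OF _ _ i]) auto
    finally show ?thesis .
  qed
qed

text \<open>Cauchy's formula on the unit circle for \<open>v \<mapsto> f (z + v * \<zeta>)\<close>.
  Keeping \<open>\<zeta>\<close> fixed and averaging over its rotations prepares the passage to
  discs without polar coordinates.\<close>

lemma circle_mean_bound: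
  assumes "f holomorphic_on UNIV"
  shows "ennreal (cmod (f z)) \<le> (\<integral>\<^sup>+s. indicator {0..1} s * ennreal (cmod (f (z + exp (2 * of_real pi * \<i> * of_real s) * \<zeta>))) \<partial>lborel)"
proof -
  define g where "g v = f (z + v * \<zeta>)" for v
  let ?c = "\<lambda>s::real. exp (2 * of_real pi * \<i> * of_real s)"
  have "((\<lambda>v. f (z + v * \<zeta>)) holomorphic_on UNIV)"
    by (rule holomorphic_on_compose_gen[OF _ assms, unfolded o_def]) (auto intro!: holomorphic_intros)
  then have hol: "g holomorphic_on UNIV" by (simp add: g_def[abs_def])
  have "((\<lambda>u. g u / (u - 0)) has_contour_integral (2 * of_real pi * \<i> * g 0)) (circlepath 0 1)"
    by (rule Cauchy_integral_circlepath_simple) (auto intro: holomorphic_on_subset[OF hol])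
  then have "((\<lambda>s. g (circlepath 0 1 s) / circlepath 0 1 s * vector_derivative (circlepath 0 1) (at s within {0..1}))
      has_integral (2 * of_real pi * \<i> * g 0)) {0..1}"
    by (simp add: has_contour_integral_def)
  then have "((\<lambda>s. (2 * of_real pi * \<i>) * g (?c s)) has_integral (2 * of_real pi * \<i> * g 0)) {0..1}"
  proof (rule has_integral_eq[rotated])
    fix s :: real assume "s \<in> {0..1}"
    then have "0 \<le> s" "s \<le> 1" by auto
    then show "g (circlepath 0 1 s) / circlepath 0 1 s * vector_derivative (circlepath 0 1) (at s within {0..1})
       = (2 * of_real pi * \<i>) * g (?c s)"
      by (subst vector_derivative_circlepath01) (auto simp: circlepath mult_ac)
  qed
  note * = has_integral_mult_right[OF this, of "inverse (2 * of_real pi * \<i>)"]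
  have "inverse (2 * of_real pi * \<i>) * (2 * of_real pi * \<i> * x) = x" for x :: complex
  proof -
    have k: "k \<noteq> 0 \<Longrightarrow> inverse k * (k * x) = x" for k :: complex by (simp flip: mult.assoc)
    show ?thesis by (rule k) simp
  qed
  with * have int: "((\<lambda>s. g (?c s)) has_integral g 0) {0..1}" by (simp only:)
  have cont: "continuous_on {0..1} (\<lambda>s. g (?c s))"
    by (intro continuous_on_compose2[OF holomorphic_on_imp_continuous_on[OF hol]] continuous_intros) auto
  have sint: "set_integrable lborel {0..1} (\<lambda>s. g (?c s))" by (rule borel_integrable_atLeastAtMost'[OF cont])
  have "g 0 = (LINT s:{0..1}|lborel. g (?c s))"
    using set_borel_integral_eq_integral(2)[OF sint] int by (simp add: integral_unique)
  then have "ennreal (cmod (f z)) = ennreal (norm (LINT s:{0..1}|lborel. g (?c s)))" by (simp add: g_def)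
  also have "\<dots> \<le> (\<integral>\<^sup>+s. norm (indicator {0..1} s *\<^sub>R g (?c s)) \<partial>lborel)"
    using sint unfolding set_lebesgue_integral_def set_integrable_def by (rule integral_norm_bound_ennreal)
  also have "\<dots> = (\<integral>\<^sup>+s. indicator {0..1} s * ennreal (cmod (g (?c s))) \<partial>lborel)"
    by (intro nn_integral_cong) (auto simp: indicator_def)
  finally show ?thesis by (simp add: g_def)
qed

text \<open>The circle estimate is integrated over \<open>\<zeta>\<close> in the disc. After
  Tonelli, for each angle the inner integral is independent of the rotation, since disc and Lebesgue
  measure are rotation invariant.\<close>

lemma area_mean_bound:
  assumes hol: "f holomorphic_on UNIV"
  shows "emeasure lborel (ball 0 r :: complex set) * ennreal (cmod (f z))
    \<le> (\<integral>\<^sup>+\<zeta>. indicator (ball 0 r) \<zeta> * ennreal (cmod (f (z + \<zeta>))) \<partial>lborel)"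
proof -
  let ?c = "\<lambda>s::real. exp (2 * of_real pi * \<i> * of_real s) :: complex"
  let ?B = "ball 0 r :: complex set"
  have cont: "continuous_on UNIV f" by (rule holomorphic_on_imp_continuous_on[OF hol])
  have fm [measurable]: "f \<in> borel_measurable borel" by (rule borel_measurable_continuous_onI[OF cont])
  have [measurable]: "(\<lambda>s. ?c s) \<in> borel_measurable borel"
    by (intro borel_measurable_continuous_onI continuous_intros)
  have Bm [measurable]: "(indicator ?B :: complex \<Rightarrow> ennreal) \<in> borel_measurable borel"
    by (rule borel_measurable_indicator) simp
  have m: "(\<lambda>(\<zeta>, s). indicator ?B \<zeta> * (indicator {0..1} s * ennreal (cmod (f (z + ?c s * \<zeta>)))))
      \<in> borel_measurable (lborel \<Otimes>\<^sub>M lborel)"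
  proof -
    have "(\<lambda>p::complex \<times> real. f (z + ?c (snd p) * fst p)) \<in> borel_measurable borel"
      by (intro borel_measurable_continuous_onI continuous_on_compose2[OF cont] continuous_intros) auto
    then have [measurable]: "(\<lambda>p. f (z + ?c (snd p) * fst p)) \<in> borel_measurable (lborel \<Otimes>\<^sub>M lborel)"
      by (simp add: lborel_prod)
    have [measurable]: "(\<lambda>p::complex \<times> real. indicator ?B (fst p) :: ennreal) \<in> borel_measurable (lborel \<Otimes>\<^sub>M lborel)"
      by (rule measurable_compose[OF measurable_fst borel_measurable_indicator]) simp
    have [measurable]: "(\<lambda>p::complex \<times> real. indicator {0..1} (snd p) :: ennreal) \<in> borel_measurable (lborel \<Otimes>\<^sub>M lborel)"
      by (rule measurable_compose[OF measurable_snd borel_measurable_indicator]) simp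
    show ?thesis unfolding case_prod_beta by measurable
  qed
  have "emeasure lborel ?B * ennreal (cmod (f z)) = (\<integral>\<^sup>+\<zeta>. indicator ?B \<zeta> * ennreal (cmod (f z)) \<partial>lborel)"
    by (subst nn_integral_multc) auto
  also have "\<dots> \<le> (\<integral>\<^sup>+\<zeta>. indicator ?B \<zeta> * (\<integral>\<^sup>+s. indicator {0..1} s * ennreal (cmod (f (z + ?c s * \<zeta>))) \<partial>lborel) \<partial>lborel)"
    by (intro nn_integral_mono mult_left_mono circle_mean_bound[OF hol]) auto
  also have "\<dots> = (\<integral>\<^sup>+\<zeta>. \<integral>\<^sup>+s. indicator ?B \<zeta> * (indicator {0..1} s * ennreal (cmod (f (z + ?c s * \<zeta>)))) \<partial>lborel \<partial>lborel)"
    by (intro nn_integral_cong nn_integral_cmult[symmetric]) measurable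
  also have "\<dots> = (\<integral>\<^sup>+s. \<integral>\<^sup>+\<zeta>. indicator ?B \<zeta> * (indicator {0..1} s * ennreal (cmod (f (z + ?c s * \<zeta>)))) \<partial>lborel \<partial>lborel)"
    using lborel_pair.Fubini'[OF m] by simp
  also have "\<dots> = (\<integral>\<^sup>+s. indicator {0..1::real} s * (\<integral>\<^sup>+\<zeta>. indicator ?B \<zeta> * ennreal (cmod (f (z + \<zeta>))) \<partial>lborel) \<partial>lborel)"
  proof (rule nn_integral_cong)
    fix s :: real
    have c1: "cmod (?c s) = 1" by (simp add: norm_exp_eq_Re)
    have "(\<integral>\<^sup>+\<zeta>. indicator ?B \<zeta> * (indicator {0..1} s * ennreal (cmod (f (z + ?c s * \<zeta>)))) \<partial>lborel)
       = (\<integral>\<^sup>+\<zeta>. indicator {0..1} s * (indicator ?B (?c s * \<zeta>) * ennreal (cmod (f (z + ?c s * \<zeta>)))) \<partial>lborel)"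
      by (intro nn_integral_cong) (auto simp: indicator_def norm_mult c1)
    also have "\<dots> = indicator {0..1} s * (\<integral>\<^sup>+\<zeta>. indicator ?B (?c s * \<zeta>) * ennreal (cmod (f (z + ?c s * \<zeta>))) \<partial>lborel)"
      by (intro nn_integral_cmult) measurable
    also have "(\<integral>\<^sup>+\<zeta>. indicator ?B (?c s * \<zeta>) * ennreal (cmod (f (z + ?c s * \<zeta>))) \<partial>lborel)
       = (\<integral>\<^sup>+\<zeta>. indicator ?B \<zeta> * ennreal (cmod (f (z + \<zeta>))) \<partial>lborel)"
      by (rule nn_integral_rotation[where H = "\<lambda>\<zeta>. indicator ?B \<zeta> * ennreal (cmod (f (z + \<zeta>)))", OF _ c1]) measurable
    finally show "(\<integral>\<^sup>+\<zeta>. indicator ?B \<zeta> * (indicator {0..1} s * ennreal (cmod (f (z + ?c s * \<zeta>)))) \<partial>lborel)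
       = indicator {0..1} s * (\<integral>\<^sup>+\<zeta>. indicator ?B \<zeta> * ennreal (cmod (f (z + \<zeta>))) \<partial>lborel)" .
  qed
  also have "\<dots> = (\<integral>\<^sup>+\<zeta>. indicator ?B \<zeta> * ennreal (cmod (f (z + \<zeta>))) \<partial>lborel)"
    by (subst nn_integral_multc) auto
  finally show ?thesis .
qed

lemma integrable_gauss_complex:
  assumes "c > 0"
  shows "integrable lborel (\<lambda>w::complex. exp (- c * (cmod w)\<^sup>2))"
proof -
  \<comment> \<open>The standard deviation for which \<open>exp (- c * x^2)\<close> is a multiple of
    the normal density.\<close>
  define \<sigma> where "\<sigma> = 1 / sqrt (2 * c)"
  have \<sigma>: "\<sigma> > 0" "2 * \<sigma>\<^sup>2 = 1 / c" using assms by (auto simp: \<sigma>_def power_divide)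
  have "exp (- c * x\<^sup>2) = sqrt (2 * pi * \<sigma>\<^sup>2) * normal_density 0 \<sigma> x" for x
    using \<sigma> assms by (simp add: normal_density_def field_simps)
  then have int: "integrable lborel (\<lambda>x. exp (- c * x\<^sup>2))"
    using integrable_normal_density[OF \<sigma>(1), of 0] by simp
  have fin: "(\<integral>\<^sup>+x. ennreal (exp (- c * x\<^sup>2)) \<partial>lborel) < \<infinity>"
    using int by (simp add: integrable_iff_bounded)
  have "(\<integral>\<^sup>+w. ennreal (exp (- c * (cmod w)\<^sup>2)) \<partial>lborel)
     = (\<integral>\<^sup>+x. \<integral>\<^sup>+y. ennreal (exp (- c * x\<^sup>2)) * ennreal (exp (- c * y\<^sup>2)) \<partial>lborel \<partial>lborel)"
    by (subst nn_integral_complex(1))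
      (auto intro!: nn_integral_cong simp: cmod_def algebra_simps exp_diff exp_add[symmetric] ennreal_mult[symmetric])
  also have "\<dots> = (\<integral>\<^sup>+x. ennreal (exp (- c * x\<^sup>2)) \<partial>lborel) * (\<integral>\<^sup>+x. ennreal (exp (- c * x\<^sup>2)) \<partial>lborel)"
    by (simp add: nn_integral_cmult nn_integral_multc)
  also have "\<dots> < \<infinity>" using fin by (simp add: ennreal_mult_less_top)
  finally show ?thesis by (intro integrableI_nonneg) auto
qed

section \<open>The Lebesgue norms on the strip\<close>

lemma powr_tangent:
  fixes q m x :: real
  assumes "1 \<le> q" "0 \<le> m" "0 \<le> x"
  shows "m powr q + q * m powr (q - 1) * (x - m) \<le> x powr q"
proof -
  consider "m = 0" | "m > 0" "x = 0" | "m > 0" "x > 0" using assms by linarith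
  then show ?thesis
  proof cases
    \<comment> \<open>\<open>0 powr a = 0\<close> for every \<open>a\<close>, even
      \<open>a = 0\<close>, so the left side vanishes also when \<open>q = 1\<close>.\<close>
    case 1
    then show ?thesis using assms by simp
  next
    case 2
    have "m powr (q - 1) * m = m powr q" using 2 by (simp add: powr_diff)
    then have "m powr q + q * m powr (q - 1) * (x - m) = (1 - q) * m powr q"
      using 2 by (simp add: algebra_simps)
    also have "\<dots> \<le> 0" using assms by (intro mult_nonpos_nonneg) auto
    finally show ?thesis using 2 by simp
  next
    case 3
    have "(x powr q) - (m powr q) \<ge> (q * m powr (q - 1)) * (x - m)"
    proof (rule convex_on_imp_above_tangent[of "{0<..}" "\<lambda>x. x powr q"])
      show "convex_on {0<..} (\<lambda>x. x powr q)" by (rule powr_convex[OF assms(1)])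
      show "((\<lambda>x. x powr q) has_field_derivative q * m powr (q - 1)) (at m within {0<..})"
        using 3 by (auto intro!: derivative_eq_intros simp: powr_diff)
    qed (use 3 in \<open>auto simp: interior_open\<close>)
    then show ?thesis by simp
  qed
qed

text \<open>The tangent inequality at the mean \<open>m\<close> is averaged over the two points; the
  linear terms cancel.\<close>

lemma powr_convex_nonneg:
  fixes q t a b :: real
  assumes "1 \<le> q" "0 \<le> a" "0 \<le> b" "0 \<le> t" "t \<le> 1"
  shows "(t * a + (1 - t) * b) powr q \<le> t * a powr q + (1 - t) * b powr q"
proof -
  define m where "m = t * a + (1 - t) * b"
  define k where "k = q * m powr (q - 1)"
  have m: "0 \<le> m" using assms by (simp add: m_def)
  have "t * (m powr q + k * (a - m)) + (1 - t) * (m powr q + k * (b - m)) \<le> t * a powr q + (1 - t) * b powr q"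
    unfolding k_def using assms m by (intro add_mono mult_left_mono powr_tangent) auto
  moreover have "t * (m powr q + k * (a - m)) + (1 - t) * (m powr q + k * (b - m)) = m powr q + k * (m - m)"
    by (simp add: m_def algebra_simps)
  ultimately show ?thesis by (simp add: m_def)
qed

text \<open>Membership together with a norm bound, phrased by the nonnegative integral. Without
  integrability conditions and roots, comparison and Fatou's lemma apply directly.\<close>

definition Lp_ball :: "ennreal \<Rightarrow> complex set \<Rightarrow> real \<Rightarrow> (complex \<Rightarrow> complex) \<Rightarrow> bool" where
  "Lp_ball p S B u \<longleftrightarrow> u \<in> borel_measurable (lebesgue_on S) \<and>
     (if p = \<infinity> then AE z in lebesgue_on S. cmod (u z) \<le> B
      else (\<integral>\<^sup>+z. ennreal (cmod (u z) powr enn2real p) \<partial>lebesgue_on S) \<le> ennreal (B powr enn2real p))"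

lemma enn2real_ge_1: "1 \<le> p \<Longrightarrow> p \<noteq> \<infinity> \<Longrightarrow> 1 \<le> enn2real p"
  by (cases p rule: ennreal_cases) auto

lemma Lp_ball_iff:
  assumes p: "1 \<le> p" and B: "0 \<le> B"
  shows "Lp_ball p S B u \<longleftrightarrow> u \<in> Lp_space p S \<and> Lp_norm p S u \<le> B"
proof (cases "u \<in> borel_measurable (lebesgue_on S)")
  case False
  then show ?thesis by (simp add: Lp_ball_def Lp_space_def)
next
  case [measurable]: True
  show ?thesis
  proof (cases "p = \<infinity>")
    case True
    let ?f = "\<lambda>z. ennreal (cmod (u z))"
    have "(AE z in lebesgue_on S. cmod (u z) \<le> B) \<longleftrightarrow> esssup (lebesgue_on S) ?f \<le> ennreal B"
    proof
      assume "AE z in lebesgue_on S. cmod (u z) \<le> B"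
      then show "esssup (lebesgue_on S) ?f \<le> ennreal B" by (intro esssup_I) (auto intro: ennreal_leI)
    next
      assume le: "esssup (lebesgue_on S) ?f \<le> ennreal B"
      have "AE z in lebesgue_on S. ?f z \<le> esssup (lebesgue_on S) ?f" by (rule esssup_AE)
      then show "AE z in lebesgue_on S. cmod (u z) \<le> B"
      proof eventually_elim
        case (elim z)
        then have "?f z \<le> ennreal B" using le by (rule order_trans)
        then show ?case using B by simp
      qed
    qed
    also have "\<dots> \<longleftrightarrow> esssup (lebesgue_on S) ?f < \<infinity> \<and> enn2real (esssup (lebesgue_on S) ?f) \<le> B"
      using B by (cases "esssup (lebesgue_on S) ?f" rule: ennreal_cases) (auto simp: top_unique)
    finally show ?thesis using True \<open>u \<in> _\<close> by (simp add: Lp_ball_def Lp_space_def Lp_norm_def)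
  next
    case False
    define q where "q = enn2real p"
    have q: "1 \<le> q" unfolding q_def by (rule enn2real_ge_1[OF p False])
    let ?I = "\<integral>\<^sup>+z. ennreal (cmod (u z) powr q) \<partial>lebesgue_on S"
    have int: "integrable (lebesgue_on S) (\<lambda>z. cmod (u z) powr q) \<longleftrightarrow> ?I < \<infinity>"
      by (subst integrable_iff_bounded) auto
    have "?I \<le> ennreal (B powr q) \<longleftrightarrow> ?I < \<infinity> \<and> (LINT z|lebesgue_on S. cmod (u z) powr q) powr (1 / q) \<le> B"
    proof (cases "?I < \<infinity>")
      case fin: True
      let ?L = "LINT z|lebesgue_on S. cmod (u z) powr q"
      have I: "?I = ennreal ?L" using fin int by (intro nn_integral_eq_integral) auto
      have L: "0 \<le> ?L" by (intro integral_nonneg_AE) auto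
      have "?L \<le> B powr q \<longleftrightarrow> ?L powr (1 / q) \<le> B"
      proof
        assume "?L \<le> B powr q"
        then have "?L powr (1 / q) \<le> (B powr q) powr (1 / q)" using L q by (intro powr_mono2) auto
        then show "?L powr (1 / q) \<le> B" using B q by (simp add: powr_powr)
      next
        assume "?L powr (1 / q) \<le> B"
        then have "(?L powr (1 / q)) powr q \<le> B powr q" using q by (intro powr_mono2) auto
        then show "?L \<le> B powr q" using L q by (simp add: powr_powr)
      qed
      then show ?thesis using fin L unfolding I by simp
    next
      case inf: False
      then show ?thesis using le_less_trans[OF _ ennreal_less_top] by auto
    qed
    then show ?thesis using False int \<open>u \<in> _\<close> by (simp add: Lp_ball_def Lp_space_def Lp_norm_def q_def)
  qed
qed

lemma Lp_ball_mono:
  assumes "1 \<le> p" "Lp_ball p S B u" "v \<in> borel_measurable (lebesgue_on S)" "0 \<le> B" "0 \<le> K"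
    and le: "\<And>z. z \<in> S \<Longrightarrow> cmod (v z) \<le> K * cmod (u z)"
  shows "Lp_ball p S (K * B) v"
proof (cases "p = \<infinity>")
  case True
  have "AE z in lebesgue_on S. cmod (u z) \<le> B" using assms(2) True by (simp add: Lp_ball_def)
  then have "AE z in lebesgue_on S. cmod (v z) \<le> K * B"
  proof (rule AE_mp, intro AE_I2 impI)
    fix z assume "z \<in> space (lebesgue_on S)" "cmod (u z) \<le> B"
    then show "cmod (v z) \<le> K * B"
      using le[of z] mult_left_mono[of "cmod (u z)" B K] assms(5) by (simp add: space_restrict_space)
  qed
  then show ?thesis using assms(3) True by (simp add: Lp_ball_def)
next
  case False
  define q where "q = enn2real p"
  have q: "1 \<le> q" unfolding q_def by (rule enn2real_ge_1[OF assms(1) False])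
  have [measurable]: "u \<in> borel_measurable (lebesgue_on S)" using assms(2) by (simp add: Lp_ball_def)
  have "(\<integral>\<^sup>+z. ennreal (cmod (v z) powr q) \<partial>lebesgue_on S) \<le> (\<integral>\<^sup>+z. ennreal (K powr q) * ennreal (cmod (u z) powr q) \<partial>lebesgue_on S)"
  proof (intro nn_integral_mono)
    fix z assume "z \<in> space (lebesgue_on S)"
    then have "z \<in> S" by (simp add: space_restrict_space)
    then have "cmod (v z) powr q \<le> (K * cmod (u z)) powr q" using q by (intro powr_mono2 le) auto
    then show "ennreal (cmod (v z) powr q) \<le> ennreal (K powr q) * ennreal (cmod (u z) powr q)"
      using assms(5) by (simp add: powr_mult ennreal_mult[symmetric] ennreal_leI)
  qed
  also have "\<dots> = ennreal (K powr q) * (\<integral>\<^sup>+z. ennreal (cmod (u z) powr q) \<partial>lebesgue_on S)"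
    by (intro nn_integral_cmult) auto
  also have "\<dots> \<le> ennreal (K powr q) * ennreal (B powr q)"
    using assms(2) False by (intro mult_left_mono) (auto simp: Lp_ball_def q_def)
  also have "\<dots> = ennreal ((K * B) powr q)" using assms by (simp add: powr_mult ennreal_mult[symmetric])
  finally show ?thesis using assms(3) False by (simp add: Lp_ball_def q_def)
qed

lemma Lp_ball_fatou:
  assumes "1 \<le> p" "\<And>n::nat. Lp_ball p S B (f n)" "\<And>z. (\<lambda>n. f n z) \<longlonglongrightarrow> g z"
  shows "Lp_ball p S B g"
proof -
  have [measurable]: "f n \<in> borel_measurable (lebesgue_on S)" for n using assms(2) by (simp add: Lp_ball_def)
  have g: "g \<in> borel_measurable (lebesgue_on S)"
    by (rule borel_measurable_LIMSEQ_metric[of f]) (use assms(3) in auto)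
  show ?thesis
  proof (cases "p = \<infinity>")
    case True
    have "AE z in lebesgue_on S. \<forall>n. cmod (f n z) \<le> B"
      unfolding AE_all_countable using assms(2) True by (simp add: Lp_ball_def)
    then have "AE z in lebesgue_on S. cmod (g z) \<le> B"
    proof eventually_elim
      case (elim z)
      then show ?case using tendsto_norm[OF assms(3)[of z]] by (intro LIMSEQ_le_const2) auto
    qed
    then show ?thesis using True g by (simp add: Lp_ball_def)
  next
    case False
    define q where "q = enn2real p"
    have q: "1 \<le> q" unfolding q_def by (rule enn2real_ge_1[OF assms(1) False])
    have conv: "(\<lambda>n. ennreal (cmod (f n z) powr q)) \<longlonglongrightarrow> ennreal (cmod (g z) powr q)" for z
      using q assms(3) by (intro tendsto_ennrealI tendsto_powr' tendsto_norm tendsto_const) auto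
    have "(\<integral>\<^sup>+z. ennreal (cmod (g z) powr q) \<partial>lebesgue_on S)
        = (\<integral>\<^sup>+z. liminf (\<lambda>n. ennreal (cmod (f n z) powr q)) \<partial>lebesgue_on S)"
      by (intro nn_integral_cong) (simp only: lim_imp_Liminf[OF sequentially_bot conv])
    also have "\<dots> \<le> liminf (\<lambda>n. \<integral>\<^sup>+z. ennreal (cmod (f n z) powr q) \<partial>lebesgue_on S)"
      by (intro nn_integral_liminf) auto
    also have "\<dots> \<le> ennreal (B powr q)"
      using assms(2) False by (intro Liminf_le) (auto simp: Lp_ball_def q_def)
    finally show ?thesis using False g by (simp add: Lp_ball_def q_def)
  qed
qed

text \<open>Minkowski's inequality by convexity: \<open>u + v\<close> is \<open>B1 + B2\<close>
  times the convex combination of \<open>u / B1\<close> and \<open>v / B2\<close> with weights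
  \<open>B1 / (B1 + B2)\<close> and \<open>B2 / (B1 + B2)\<close>. The divisions ask for positive
  radii.\<close>

lemma Lp_ball_add:
  assumes "1 \<le> p" "Lp_ball p S B1 u" "Lp_ball p S B2 v" "0 < B1" "0 < B2"
  shows "Lp_ball p S (B1 + B2) (\<lambda>z. u z + v z)"
proof -
  have [measurable]: "u \<in> borel_measurable (lebesgue_on S)" "v \<in> borel_measurable (lebesgue_on S)"
    using assms(2,3) by (auto simp: Lp_ball_def)
  show ?thesis
  proof (cases "p = \<infinity>")
    case True
    have "AE z in lebesgue_on S. cmod (u z) \<le> B1" "AE z in lebesgue_on S. cmod (v z) \<le> B2"
      using assms(2,3) True by (auto simp: Lp_ball_def)
    then have "AE z in lebesgue_on S. cmod (u z + v z) \<le> B1 + B2"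
      by eventually_elim (auto intro: norm_triangle_le)
    then show ?thesis using True by (simp add: Lp_ball_def)
  next
    case False
    define q where "q = enn2real p"
    have q: "1 \<le> q" unfolding q_def by (rule enn2real_ge_1[OF assms(1) False])
    define t where "t = B1 / (B1 + B2)"
    have t: "0 \<le> t" "t \<le> 1" "1 - t = B2 / (B1 + B2)" using assms by (auto simp: t_def field_simps)
    \<comment> \<open>Chosen so that
      \<open>c1 * B1 powr q + c2 * B2 powr q = (B1 + B2) powr q\<close>.\<close>
    define c1 c2 where "c1 = (B1 + B2) powr q * t / B1 powr q" and "c2 = (B1 + B2) powr q * (1 - t) / B2 powr q"
    have pt: "cmod (u z + v z) powr q \<le> c1 * cmod (u z) powr q + c2 * cmod (v z) powr q" for z
    proof -
      have "cmod (u z + v z) \<le> cmod (u z) + cmod (v z)" by (rule norm_triangle_ineq)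
      also have "\<dots> = (B1 + B2) * (t * (cmod (u z) / B1) + (1 - t) * (cmod (v z) / B2))"
      proof -
        have nz: "B1 \<noteq> 0" "B2 \<noteq> 0" "B1 + B2 \<noteq> 0" using assms by auto
        then have "t * (cmod (u z) / B1) = cmod (u z) / (B1 + B2)" "(1 - t) * (cmod (v z) / B2) = cmod (v z) / (B1 + B2)"
          unfolding t(3) unfolding t_def by simp_all
        then show ?thesis using nz by (simp flip: add_divide_distrib)
      qed
      finally have "cmod (u z + v z) powr q \<le> ((B1 + B2) * (t * (cmod (u z) / B1) + (1 - t) * (cmod (v z) / B2))) powr q"
        using q by (intro powr_mono2) auto
      also have "\<dots> = (B1 + B2) powr q * (t * (cmod (u z) / B1) + (1 - t) * (cmod (v z) / B2)) powr q"
        by (rule powr_mult)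
      also have "\<dots> \<le> (B1 + B2) powr q * (t * (cmod (u z) / B1) powr q + (1 - t) * (cmod (v z) / B2) powr q)"
        using assms t q by (intro mult_left_mono powr_convex_nonneg) auto
      also have "\<dots> = c1 * cmod (u z) powr q + c2 * cmod (v z) powr q"
        using assms by (simp add: c1_def c2_def powr_divide field_simps)
      finally show ?thesis .
    qed
    have c: "0 \<le> c1" "0 \<le> c2" using t(1,2) by (auto simp: c1_def c2_def intro!: divide_nonneg_nonneg mult_nonneg_nonneg)
    have "(\<integral>\<^sup>+z. ennreal (cmod (u z + v z) powr q) \<partial>lebesgue_on S)
       \<le> (\<integral>\<^sup>+z. ennreal c1 * ennreal (cmod (u z) powr q) + ennreal c2 * ennreal (cmod (v z) powr q) \<partial>lebesgue_on S)"
      using pt c by (intro nn_integral_mono) (simp add: ennreal_mult[symmetric] ennreal_plus[symmetric] ennreal_leI del: ennreal_plus)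
    also have "\<dots> = ennreal c1 * (\<integral>\<^sup>+z. ennreal (cmod (u z) powr q) \<partial>lebesgue_on S)
        + ennreal c2 * (\<integral>\<^sup>+z. ennreal (cmod (v z) powr q) \<partial>lebesgue_on S)"
      by (simp add: nn_integral_add nn_integral_cmult)
    also have "\<dots> \<le> ennreal c1 * ennreal (B1 powr q) + ennreal c2 * ennreal (B2 powr q)"
      using assms(2,3) False by (intro add_mono mult_left_mono) (auto simp: Lp_ball_def q_def)
    also have "\<dots> = ennreal (c1 * B1 powr q + c2 * B2 powr q)"
      using c by (simp add: ennreal_mult ennreal_plus)
    also have "c1 * B1 powr q + c2 * B2 powr q = (B1 + B2) powr q"
      using assms by (simp add: c1_def c2_def field_simps)
    finally show ?thesis using False by (simp add: Lp_ball_def q_def)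
  qed
qed

section \<open>Periodic functions on the strip and the weight in the imaginary part\<close>

lemma strip_measurable [measurable]: "strip \<gamma> \<in> sets borel"
proof -
  have "strip \<gamma> = {z. - \<gamma> / 2 < Re z} \<inter> {z. Re z \<le> \<gamma> / 2}" by (auto simp: strip_def)
  also have "\<dots> \<in> sets borel"
    by (intro sets.Int borel_open borel_closed open_halfspace_Re_gt closed_halfspace_Re_le)
  finally show ?thesis .
qed

text \<open>Vertical translations preserve the strip, and whole periods can be removed from the
  shift. What remains moves the strip to the right by less than one period, into the union of the
  strip and its right neighbour; this gives the factor \<open>2\<close>.\<close>

lemma strip_shift_bound:
  fixes H :: "complex \<Rightarrow> ennreal"
  assumes \<gamma>: "\<gamma> > 0" and [measurable]: "H \<in> borel_measurable borel" and per: "\<And>z. H (z + of_real \<gamma>) = H z"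
  shows "(\<integral>\<^sup>+z. indicator (strip \<gamma>) z * H (z + w) \<partial>lborel) \<le> 2 * (\<integral>\<^sup>+z. indicator (strip \<gamma>) z * H z \<partial>lborel)"
proof -
  have pern: "H (z + of_real (\<gamma> * real n)) = H z" for z and n :: nat
  proof (induction n)
    case (Suc n)
    have "H (z + of_real (\<gamma> * real (Suc n))) = H ((z + of_real (\<gamma> * real n)) + of_real \<gamma>)" by (simp add: algebra_simps)
    then show ?case using Suc per by simp
  qed simp
  have perk: "H (z + of_real (\<gamma> * of_int k)) = H z" for z k
  proof (cases k rule: int_cases2)
    case (nonneg n)
    then show ?thesis using pern[of z n] by simp
  next
    case (nonpos n)
    have "H (z + of_real (\<gamma> * of_int k)) = H ((z + of_real (\<gamma> * of_int k)) + of_real (\<gamma> * real n))"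
      by (rule pern[symmetric])
    then show ?thesis using nonpos by simp
  qed
  define k where "k = \<lfloor>Re w / \<gamma>\<rfloor>"
  define a where "a = w - of_real (\<gamma> * of_int k)"
  have "of_int k \<le> Re w / \<gamma>" "Re w / \<gamma> < of_int k + 1" by (auto simp: k_def)
  then have a: "0 \<le> Re a" "Re a < \<gamma>" using \<gamma> by (auto simp: a_def field_simps)
  have Ha: "H (z + w) = H (z + a)" for z
    using perk[of "z + a" k] by (simp add: a_def algebra_simps)
  have "(\<integral>\<^sup>+z. indicator (strip \<gamma>) z * H (z + w) \<partial>lborel) = (\<integral>\<^sup>+z. (\<lambda>z. indicator (strip \<gamma>) (z - a) * H z) (z + a) \<partial>lborel)"
    by (simp add: Ha)
  also have "\<dots> = (\<integral>\<^sup>+z. indicator (strip \<gamma>) (z - a) * H z \<partial>lborel)"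
    by (rule nn_integral_lborel_shift) measurable
  also have "\<dots> \<le> (\<integral>\<^sup>+z. indicator (strip \<gamma>) z * H z + indicator (strip \<gamma>) (z - of_real \<gamma>) * H z \<partial>lborel)"
  proof (intro nn_integral_mono)
    fix z
    show "indicator (strip \<gamma>) (z - a) * H z \<le> indicator (strip \<gamma>) z * H z + indicator (strip \<gamma>) (z - of_real \<gamma>) * H z"
      using a by (auto simp: indicator_def strip_def)
  qed
  also have "\<dots> = (\<integral>\<^sup>+z. indicator (strip \<gamma>) z * H z \<partial>lborel) + (\<integral>\<^sup>+z. indicator (strip \<gamma>) (z - of_real \<gamma>) * H z \<partial>lborel)"
    by (intro nn_integral_add) measurable
  also have "(\<integral>\<^sup>+z. indicator (strip \<gamma>) (z - of_real \<gamma>) * H z \<partial>lborel)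
      = (\<integral>\<^sup>+z. (\<lambda>z. indicator (strip \<gamma>) (z - of_real \<gamma>) * H z) (z + of_real \<gamma>) \<partial>lborel)"
    by (rule nn_integral_lborel_shift[symmetric]) measurable
  also have "\<dots> = (\<integral>\<^sup>+z. indicator (strip \<gamma>) z * H z \<partial>lborel)" by (simp add: per)
  finally show ?thesis by (simp add: mult_2)
qed

text \<open>Independent of \<open>Re z\<close>, hence invariant under the period, and comparable
  with \<open>bracket z powr \<alpha>\<close> on the strip.\<close>

definition im_weight :: "real \<Rightarrow> complex \<Rightarrow> real" where
  "im_weight \<alpha> z = bracket (Im z) powr \<alpha>"

lemma im_weight_ge_1: "0 \<le> \<alpha> \<Longrightarrow> 1 \<le> im_weight \<alpha> z"
  unfolding im_weight_def by (rule bracket_powr_ge_1)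

lemma im_weight_nonneg [simp]: "0 \<le> im_weight \<alpha> z"
  by (simp add: im_weight_def)

lemma bracket_mono: "norm x \<le> norm y \<Longrightarrow> bracket x \<le> bracket y"
  by (simp add: bracket_def power_mono)

lemma im_weight_le: "0 \<le> \<alpha> \<Longrightarrow> im_weight \<alpha> z \<le> bracket z powr \<alpha>"
  unfolding im_weight_def using abs_Im_le_cmod[of z]
  by (intro powr_mono2 bracket_mono) (auto intro: less_imp_le)

lemma bracket_le_im_weight:
  assumes "0 \<le> \<alpha>" "\<gamma> > 0" "z \<in> strip \<gamma>"
  shows "bracket z powr \<alpha> \<le> (1 + \<gamma>) powr \<alpha> * im_weight \<alpha> z"
proof -
  have "\<bar>Re z\<bar> \<le> \<bar>\<gamma>\<bar>" using assms by (auto simp: strip_def)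
  then have "(Re z)\<^sup>2 \<le> \<gamma>\<^sup>2" by (simp add: abs_le_square_iff)
  then have "1 + (cmod z)\<^sup>2 \<le> 1 + \<gamma>\<^sup>2 + (Im z)\<^sup>2" by (simp add: cmod_power2)
  also have "\<dots> \<le> (1 + \<gamma>)\<^sup>2 * (1 + (Im z)\<^sup>2)"
    using assms by (simp add: power2_eq_square algebra_simps)
  finally have "bracket z \<le> (1 + \<gamma>) * bracket (Im z)"
    using assms unfolding bracket_def by (intro real_le_lsqrt) (auto simp: power_mult_distrib)
  then have "bracket z powr \<alpha> \<le> ((1 + \<gamma>) * bracket (Im z)) powr \<alpha>"
    using assms by (intro powr_mono2) (auto intro: less_imp_le)
  then show ?thesis using assms by (simp add: im_weight_def powr_mult less_imp_le)
qed

lemma im_weight_shift: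
  assumes "0 \<le> \<alpha>"
  shows "im_weight \<alpha> z \<le> 2 powr (\<alpha> / 2) * im_weight \<alpha> (z + w) * bracket w powr \<alpha>"
proof -
  have "im_weight \<alpha> z \<le> 2 powr (\<alpha> / 2) * im_weight \<alpha> (z + w) * bracket (Im w) powr \<alpha>"
    unfolding im_weight_def using peetre_powr[OF assms, of "Im z" "Im w"] by simp
  also have "\<dots> \<le> 2 powr (\<alpha> / 2) * im_weight \<alpha> (z + w) * bracket w powr \<alpha>"
    using im_weight_le[OF assms, of w] by (intro mult_left_mono) (auto simp: im_weight_def)
  finally show ?thesis .
qed

lemma continuous_im_weight: "continuous_on UNIV (im_weight \<alpha>)"
  unfolding im_weight_def[abs_def] bracket_def
  by (intro continuous_intros) (auto simp: add_nonneg_eq_0_iff)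

lemma continuous_bracket_powr: "continuous_on UNIV (\<lambda>z::complex. bracket z powr \<alpha>)"
  unfolding bracket_def by (intro continuous_intros) (auto simp: add_nonneg_eq_0_iff)

lemma E_tilde_continuous:
  assumes "u \<in> E_tilde" shows "continuous_on UNIV u"
proof -
  obtain f where f: "f holomorphic_on UNIV" "\<And>z. u z = complex_of_real (exp (- (cmod z)\<^sup>2 / 2)) * f z"
    using assms by (auto simp: E_tilde_def)
  have "continuous_on UNIV (\<lambda>z. complex_of_real (exp (- (cmod z)\<^sup>2 / 2)) * f z)"
    by (intro continuous_intros holomorphic_on_imp_continuous_on[OF f(1)]) auto
  then show ?thesis by (simp add: f(2)[abs_def])
qed

lemma F_per_cmod_periodic:
  assumes "u \<in> F_per \<gamma>" shows "cmod (u (z + of_real \<gamma>)) = cmod (u z)"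
proof -
  have "mag_trans (of_real \<gamma>) u z = u z" using assms by (simp add: F_per_def)
  then have "cmod (exp ((of_real \<gamma> * cnj z - cnj (of_real \<gamma>) * z) / 2)) * cmod (u (z + of_real \<gamma>)) = cmod (u z)"
    unfolding mag_trans_def by (simp only: norm_mult[symmetric])
  moreover have "cmod (exp ((of_real \<gamma> * cnj z - cnj (of_real \<gamma>) * z) / 2)) = 1" by (simp add: norm_exp_eq_Re)
  ultimately show ?thesis by simp
qed

text \<open>The Gaussian factor of \<open>u\<close> is not the modulus of a holomorphic function,
  but it can be recentred: multiplying \<open>f\<close> by
  \<open>exp (- cnj z * (\<zeta> - z))\<close> gives an entire function whose modulus at
  \<open>z + w\<close> is \<open>exp (|z|^2 / 2) * exp (|w|^2 / 2) * |u (z + w)|\<close>. The factor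
  in \<open>z\<close> cancels and the one in \<open>w\<close> is bounded on the disc.\<close>

lemma E_tilde_local_bound:
  assumes u: "u \<in> E_tilde"
  shows "emeasure lborel (ball 0 \<delta> :: complex set) * ennreal (cmod (u z))
    \<le> ennreal (exp (\<delta>\<^sup>2 / 2)) * (\<integral>\<^sup>+w. indicator (ball 0 \<delta>) w * ennreal (cmod (u (z + w))) \<partial>lborel)"
proof -
  obtain f where f: "f holomorphic_on UNIV" "\<And>z. u z = complex_of_real (exp (- (cmod z)\<^sup>2 / 2)) * f z"
    using u by (auto simp: E_tilde_def)
  have [measurable]: "u \<in> borel_measurable borel"
    by (rule borel_measurable_continuous_onI[OF E_tilde_continuous[OF u]])
  define h where "h \<zeta> = f \<zeta> * exp (- cnj z * (\<zeta> - z))" for \<zeta>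
  have h: "h holomorphic_on UNIV" unfolding h_def[abs_def] by (intro holomorphic_intros f)
  have hz: "cmod (h (z + w)) = exp ((cmod z)\<^sup>2 / 2) * exp ((cmod w)\<^sup>2 / 2) * cmod (u (z + w))" for w
  proof -
    have "(cmod (z + w))\<^sup>2 = (cmod z)\<^sup>2 + (cmod w)\<^sup>2 + 2 * Re (cnj z * w)"
      unfolding cmod_power2 by (simp add: power2_eq_square algebra_simps)
    then have "(cmod z)\<^sup>2 / 2 + (cmod w)\<^sup>2 / 2 + - (cmod (z + w))\<^sup>2 / 2 = - Re (cnj z * w)" by linarith
    then have "exp ((cmod z)\<^sup>2 / 2) * exp ((cmod w)\<^sup>2 / 2) * exp (- (cmod (z + w))\<^sup>2 / 2) = exp (- Re (cnj z * w))"
      by (simp only: exp_add[symmetric])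
    moreover have "cmod (h (z + w)) = cmod (f (z + w)) * exp (- Re (cnj z * w))"
      by (simp add: h_def norm_mult norm_exp_eq_Re)
    moreover have "cmod (u (z + w)) = exp (- (cmod (z + w))\<^sup>2 / 2) * cmod (f (z + w))"
      by (simp only: f(2) norm_mult norm_of_real abs_exp_cancel)
    ultimately show ?thesis by (simp only: ac_simps)
  qed
  let ?z = "exp ((cmod z)\<^sup>2 / 2)" and ?B = "ball 0 \<delta> :: complex set"
  have [measurable]: "(indicator ?B :: complex \<Rightarrow> ennreal) \<in> borel_measurable borel"
    by (rule borel_measurable_indicator) simp
  have "emeasure lborel ?B * ennreal (cmod (h z)) \<le> (\<integral>\<^sup>+w. indicator ?B w * ennreal (cmod (h (z + w))) \<partial>lborel)"
    by (rule area_mean_bound[OF h])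
  also have "\<dots> \<le> (\<integral>\<^sup>+w. ennreal ?z * (ennreal (exp (\<delta>\<^sup>2 / 2)) * (indicator ?B w * ennreal (cmod (u (z + w))))) \<partial>lborel)"
  proof (intro nn_integral_mono)
    fix w
    show "indicator ?B w * ennreal (cmod (h (z + w)))
       \<le> ennreal ?z * (ennreal (exp (\<delta>\<^sup>2 / 2)) * (indicator ?B w * ennreal (cmod (u (z + w)))))"
    proof (cases "w \<in> ?B")
      case True
      then have "(cmod w)\<^sup>2 \<le> \<delta>\<^sup>2" by (intro power_mono) auto
      then have "cmod (h (z + w)) \<le> ?z * (exp (\<delta>\<^sup>2 / 2) * cmod (u (z + w)))"
        unfolding hz mult.assoc by (intro mult_left_mono mult_right_mono) auto
      then show ?thesis using True by (simp add: ennreal_mult[symmetric] ennreal_leI)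
    qed simp
  qed
  also have "\<dots> = ennreal ?z * (ennreal (exp (\<delta>\<^sup>2 / 2)) * (\<integral>\<^sup>+w. indicator ?B w * ennreal (cmod (u (z + w))) \<partial>lborel))"
    by (simp add: nn_integral_cmult)
  finally have le: "emeasure lborel ?B * ennreal (cmod (h z)) \<le> \<dots>" .
  have "cmod (h z) = ?z * cmod (u z)" using hz[of 0] by simp
  then have "ennreal ?z * (emeasure lborel ?B * ennreal (cmod (u z))) \<le> ennreal ?z * (ennreal (exp (\<delta>\<^sup>2 / 2)) * (\<integral>\<^sup>+w. indicator ?B w * ennreal (cmod (u (z + w))) \<partial>lborel))"
    using le by (simp add: ennreal_mult ac_simps)
  then show ?thesis by (subst (asm) ennreal_mult_le_mult_iff) auto
qed

lemma nn_integral_lebesgue_on_strip: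
  "(\<integral>\<^sup>+z. f z \<partial>lebesgue_on (strip \<gamma>)) = (\<integral>\<^sup>+z. indicator (strip \<gamma>) z * f z \<partial>lborel)"
proof -
  have "strip \<gamma> \<in> sets lebesgue" using strip_measurable by simp
  then have "(\<integral>\<^sup>+z. f z \<partial>lebesgue_on (strip \<gamma>)) = (\<integral>\<^sup>+z. f z * indicator (strip \<gamma>) z \<partial>lebesgue)"
    by (intro nn_integral_restrict_space) simp
  then show ?thesis by (simp add: nn_integral_completion mult.commute)
qed

lemma weighted_measurable:
  assumes "u \<in> E_tilde" shows "weighted \<alpha> u \<in> borel_measurable (lebesgue_on S)"
proof -
  have "continuous_on UNIV (weighted \<alpha> u)"
    unfolding weighted_def[abs_def]
    by (intro continuous_intros continuous_bracket_powr E_tilde_continuous[OF assms])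
  then have "weighted \<alpha> u \<in> borel_measurable lborel" by (simp add: borel_measurable_continuous_onI)
  then have "weighted \<alpha> u \<in> borel_measurable lebesgue" by (rule measurable_completion)
  then show ?thesis by (rule measurable_restrict_space1)
qed

lemma cmod_weighted: "cmod (weighted \<alpha> u z) = bracket z powr \<alpha> * cmod (u z)"
  by (simp add: weighted_def norm_mult)

text \<open>One constant serves all \<open>p\<close>, because on the unit ball
  \<open>V \<le> 1 + H\<close> with \<open>H\<close> of integral at most \<open>1\<close> over the
  strip. The mean value bound over a disc and the periodicity of \<open>H\<close> then control
  \<open>V\<close> at every point.\<close>

lemma F_per_sup_bound_unit:
  assumes \<gamma>: "\<gamma> > 0" and \<alpha>: "0 \<le> \<alpha>"
  shows "\<exists>C\<ge>0. \<forall>p u. 1 \<le> p \<longrightarrow> u \<in> F_per \<gamma> \<longrightarrow> Lp_ball p (strip \<gamma>) 1 (weighted \<alpha> u) \<longrightarrow>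
    (\<forall>z. im_weight \<alpha> z * cmod (u z) \<le> C)"
proof -
  \<comment> \<open>With this radius the disc lies inside the strip, so an integral over a
    translated disc is dominated by one over a translated strip.\<close>
  define \<delta> where "\<delta> = \<gamma> / 2"
  let ?B = "ball 0 \<delta> :: complex set" and ?S = "strip \<gamma>"
  define b where "b = measure lborel ?B"
  define K where "K = exp (\<delta>\<^sup>2 / 2) * (2 powr (\<alpha> / 2) * (1 + \<delta>\<^sup>2) powr (\<alpha> / 2))"
  have b: "b > 0" "emeasure lborel ?B = ennreal b"
  proof -
    show "b > 0" unfolding b_def using \<gamma> by (intro content_ball_pos) (simp add: \<delta>_def)
    show "emeasure lborel ?B = ennreal b" unfolding b_def
      using emeasure_lborel_ball_finite[of "0 :: complex" \<delta>] by (intro emeasure_eq_ennreal_measure) (simp add: less_top)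
  qed
  have [measurable]: "(indicator ?B :: complex \<Rightarrow> ennreal) \<in> borel_measurable borel"
    by (rule borel_measurable_indicator) simp
  have "im_weight \<alpha> z * cmod (u z) \<le> K * (b + 2) / b"
    if p: "1 \<le> p" and u: "u \<in> F_per \<gamma>" and ball: "Lp_ball p ?S 1 (weighted \<alpha> u)" for p u z
  proof -
    have uE: "u \<in> E_tilde" using u by (simp add: F_per_def)
    define V where "V z = im_weight \<alpha> z * cmod (u z)" for z
    have contV: "continuous_on UNIV V"
      unfolding V_def[abs_def] by (intro continuous_intros continuous_im_weight E_tilde_continuous[OF uE])
    have [measurable]: "V \<in> borel_measurable borel" by (rule borel_measurable_continuous_onI[OF contV])
    have V0: "0 \<le> V z" for z by (simp add: V_def)
    have Vper: "V (z + of_real \<gamma>) = V z" for z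
      by (simp add: V_def im_weight_def F_per_cmod_periodic[OF u])
    have Vle: "V z \<le> cmod (weighted \<alpha> u z)" for z
      unfolding V_def cmod_weighted by (intro mult_right_mono im_weight_le \<alpha>) auto
    \<comment> \<open>For finite \<open>p\<close>, \<open>H = V powr q\<close>; for
      \<open>p = \<infinity>\<close> it is the excess of \<open>V\<close> over \<open>1\<close>,
      which vanishes almost everywhere on the strip.\<close>
    obtain H :: "complex \<Rightarrow> real" where Hm: "H \<in> borel_measurable borel" and H0: "\<And>z. 0 \<le> H z"
      and VH: "\<And>z. V z \<le> 1 + H z" and Hper: "\<And>z. H (z + of_real \<gamma>) = H z"
      and HS: "(\<integral>\<^sup>+z. indicator ?S z * ennreal (H z) \<partial>lborel) \<le> 1"
    proof (cases "p = \<infinity>")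
      case True
      have "AE z in lebesgue_on ?S. ennreal (max (V z - 1) 0) = 0"
      proof -
        have "AE z in lebesgue_on ?S. cmod (weighted \<alpha> u z) \<le> 1" using ball True by (simp add: Lp_ball_def)
        then show ?thesis
        proof eventually_elim
          case (elim z)
          then show ?case using Vle[of z] by simp
        qed
      qed
      then have "(\<integral>\<^sup>+z. ennreal (max (V z - 1) 0) \<partial>lebesgue_on ?S) = (\<integral>\<^sup>+z. 0 \<partial>lebesgue_on ?S)"
        by (rule nn_integral_cong_AE)
      then show ?thesis
        by (intro that[of "\<lambda>z. max (V z - 1) 0"]) (auto simp: Vper nn_integral_lebesgue_on_strip)
    next
      case False
      define q where "q = enn2real p"
      have q: "1 \<le> q" unfolding q_def by (rule enn2real_ge_1[OF p False])
      have le: "(\<integral>\<^sup>+z. ennreal (V z powr q) \<partial>lebesgue_on ?S) \<le> 1"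
      proof -
        have "(\<integral>\<^sup>+z. ennreal (V z powr q) \<partial>lebesgue_on ?S) \<le> (\<integral>\<^sup>+z. ennreal (cmod (weighted \<alpha> u z) powr q) \<partial>lebesgue_on ?S)"
          using q by (intro nn_integral_mono ennreal_leI powr_mono2 Vle V0) auto
        also have "\<dots> \<le> 1" using ball False by (simp add: Lp_ball_def q_def)
        finally show ?thesis .
      qed
      have "V z \<le> 1 + V z powr q" for z
      proof (cases "V z \<le> 1")
        case False
        then have "V z powr 1 \<le> V z powr q" using q by (intro powr_mono) auto
        then show ?thesis using False by simp
      qed (simp add: add_increasing2)
      then show ?thesis using le
        by (intro that[of "\<lambda>z. V z powr q"]) (auto simp: Vper nn_integral_lebesgue_on_strip)
    qed
    note [measurable] = Hm
    have pt: "im_weight \<alpha> z * exp (\<delta>\<^sup>2 / 2) * (indicator ?B w * cmod (u (z + w))) \<le> K * (indicator ?B w + indicator ?S w * H (z + w))" for w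
    proof (cases "w \<in> ?B")
      case True
      have "\<bar>Re w\<bar> < \<gamma> / 2" using True abs_Re_le_cmod[of w] by (simp add: \<delta>_def)
      then have wS: "w \<in> ?S" by (auto simp: strip_def abs_less_iff)
      have "bracket w powr \<alpha> \<le> (1 + \<delta>\<^sup>2) powr (\<alpha> / 2)"
      proof -
        have "(cmod w)\<^sup>2 \<le> \<delta>\<^sup>2" using True by (intro power_mono) auto
        then have "(1 + (cmod w)\<^sup>2) powr (\<alpha> / 2) \<le> (1 + \<delta>\<^sup>2) powr (\<alpha> / 2)" using \<alpha> by (intro powr_mono2) auto
        then show ?thesis by (simp add: bracket_def powr_half_sqrt[symmetric] powr_powr)
      qed
      then have "im_weight \<alpha> z \<le> 2 powr (\<alpha> / 2) * im_weight \<alpha> (z + w) * (1 + \<delta>\<^sup>2) powr (\<alpha> / 2)"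
        by (intro order_trans[OF im_weight_shift[OF \<alpha>, of z w]] mult_left_mono) auto
      then have "im_weight \<alpha> z * exp (\<delta>\<^sup>2 / 2) * cmod (u (z + w))
        \<le> 2 powr (\<alpha> / 2) * im_weight \<alpha> (z + w) * (1 + \<delta>\<^sup>2) powr (\<alpha> / 2) * exp (\<delta>\<^sup>2 / 2) * cmod (u (z + w))"
        by (intro mult_right_mono) auto
      also have "\<dots> = K * V (z + w)" by (simp add: K_def V_def)
      also have "\<dots> \<le> K * (1 + H (z + w))" by (intro mult_left_mono VH) (simp add: K_def)
      finally show ?thesis using True wS by simp
    next
      case False
      then show ?thesis using H0 by (simp add: K_def)
    qed
    have "ennreal (im_weight \<alpha> z) * (emeasure lborel ?B * ennreal (cmod (u z)))
      \<le> ennreal (im_weight \<alpha> z) * (ennreal (exp (\<delta>\<^sup>2 / 2)) * (\<integral>\<^sup>+w. indicator ?B w * ennreal (cmod (u (z + w))) \<partial>lborel))"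
      by (intro mult_left_mono E_tilde_local_bound uE) auto
    also have "\<dots> = (\<integral>\<^sup>+w. ennreal (im_weight \<alpha> z * exp (\<delta>\<^sup>2 / 2)) * (indicator ?B w * ennreal (cmod (u (z + w)))) \<partial>lborel)"
    proof -
      have [measurable]: "u \<in> borel_measurable borel"
        by (rule borel_measurable_continuous_onI[OF E_tilde_continuous[OF uE]])
      show ?thesis by (subst nn_integral_cmult) (auto simp: ennreal_mult mult.assoc)
    qed
    also have "\<dots> \<le> (\<integral>\<^sup>+w. ennreal K * (indicator ?B w + indicator ?S w * ennreal (H (z + w))) \<partial>lborel)"
    proof (intro nn_integral_mono)
      fix w
      have "ennreal (im_weight \<alpha> z * exp (\<delta>\<^sup>2 / 2) * (indicator ?B w * cmod (u (z + w)))) \<le> ennreal (K * (indicator ?B w + indicator ?S w * H (z + w)))"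
        by (intro ennreal_leI pt)
      moreover have "ennreal (K * (indicator ?B w + indicator ?S w * H (z + w))) = ennreal K * (indicator ?B w + indicator ?S w * ennreal (H (z + w)))"
        using H0 by (auto simp: K_def ennreal_mult indicator_def ennreal_plus)
      moreover have "ennreal (im_weight \<alpha> z * exp (\<delta>\<^sup>2 / 2) * (indicator ?B w * cmod (u (z + w))))
         = ennreal (im_weight \<alpha> z * exp (\<delta>\<^sup>2 / 2)) * (indicator ?B w * ennreal (cmod (u (z + w))))"
        by (auto simp: ennreal_mult indicator_def)
      ultimately show "ennreal (im_weight \<alpha> z * exp (\<delta>\<^sup>2 / 2)) * (indicator ?B w * ennreal (cmod (u (z + w))))
        \<le> ennreal K * (indicator ?B w + indicator ?S w * ennreal (H (z + w)))" by simp
    qed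
    also have "\<dots> = ennreal K * (ennreal b + (\<integral>\<^sup>+w. indicator ?S w * ennreal (H (w + z)) \<partial>lborel))"
      by (simp add: nn_integral_cmult nn_integral_add b add.commute[of z])
    \<comment> \<open>\<open>b\<close> is the integral of the constant \<open>1\<close> over the
      disc, and \<open>2\<close> is the loss in \<open>strip_shift_bound\<close>.\<close>
    also have "\<dots> \<le> ennreal K * (ennreal b + 2 * 1)"
    proof (intro mult_left_mono add_left_mono)
      have "(\<integral>\<^sup>+w. indicator ?S w * ennreal (H (w + z)) \<partial>lborel) \<le> 2 * (\<integral>\<^sup>+w. indicator ?S w * ennreal (H w) \<partial>lborel)"
        by (rule strip_shift_bound[OF \<gamma>]) (auto simp: Hper)
      also have "\<dots> \<le> 2 * 1" by (intro mult_left_mono HS) simp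
      finally show "(\<integral>\<^sup>+w. indicator ?S w * ennreal (H (w + z)) \<partial>lborel) \<le> 2 * 1" .
    qed simp
    also have "\<dots> = ennreal (K * (b + 2))"
      using b(1) by (simp add: ennreal_mult ennreal_plus K_def)
    finally have "ennreal (im_weight \<alpha> z * (b * cmod (u z))) \<le> ennreal (K * (b + 2))"
      using b by (simp add: ennreal_mult)
    then have "im_weight \<alpha> z * (b * cmod (u z)) \<le> K * (b + 2)"
      using b(1) by (simp add: K_def)
    then show ?thesis using b(1) by (simp add: pos_le_divide_eq ac_simps)
  qed
  moreover have "0 \<le> K * (b + 2) / b" using b(1) by (simp add: K_def)
  ultimately show ?thesis by blast
qed

section \<open>The projection\<close>

lemma gauss_bracket_bound:
  assumes "0 \<le> \<alpha>"
  shows "\<exists>M\<ge>0. \<forall>w::complex. exp (- (cmod w)\<^sup>2 / 2) * bracket w powr \<alpha> \<le> M * exp (- (1 / 4) * (cmod w)\<^sup>2)"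
proof (intro exI conjI allI)
  \<comment> \<open>Small enough that \<open>exp (\<epsilon> * t) powr (\<alpha> / 2)\<close> uses
    up at most \<open>exp (t / 4)\<close> of the Gaussian \<open>exp (- t / 2)\<close>.\<close>
  define \<epsilon> where "\<epsilon> = 1 / (2 * \<alpha> + 1)"
  have \<epsilon>: "0 < \<epsilon>" "\<epsilon> \<le> 1" "\<epsilon> * \<alpha> / 2 \<le> 1 / 4" using assms by (auto simp: \<epsilon>_def field_simps)
  let ?M = "(1 / \<epsilon>) powr (\<alpha> / 2)"
  show "0 \<le> ?M" by simp
  fix w :: complex
  define t where "t = (cmod w)\<^sup>2"
  have t: "0 \<le> t" by (simp add: t_def)
  have "\<epsilon> * (1 + t) \<le> 1 + \<epsilon> * t" using \<epsilon> by (simp add: algebra_simps)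
  also have "\<dots> \<le> exp (\<epsilon> * t)" by (rule exp_ge_add_one_self)
  finally have "1 + t \<le> (1 / \<epsilon>) * exp (\<epsilon> * t)" using \<epsilon> by (simp add: field_simps)
  then have "(1 + t) powr (\<alpha> / 2) \<le> ((1 / \<epsilon>) * exp (\<epsilon> * t)) powr (\<alpha> / 2)"
    using assms t by (intro powr_mono2) auto
  also have "\<dots> = ?M * exp (\<epsilon> * \<alpha> / 2 * t)"
  proof -
    have "exp (\<epsilon> * t) powr (\<alpha> / 2) = exp (\<epsilon> * \<alpha> / 2 * t)" by (simp add: powr_def)
    then show ?thesis by (simp only: powr_mult)
  qed
  also have "\<dots> \<le> ?M * exp (1 / 4 * t)"
    using \<epsilon> t by (intro mult_left_mono) (auto intro!: mult_right_mono simp del: times_divide_eq_left)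
  finally have "bracket w powr \<alpha> \<le> ?M * exp (1 / 4 * t)"
    by (simp add: bracket_def t_def powr_half_sqrt[symmetric] powr_powr)
  then have "exp (- t / 2) * bracket w powr \<alpha> \<le> exp (- t / 2) * (?M * exp (1 / 4 * t))" by (intro mult_left_mono) auto
  also have "\<dots> = ?M * (exp (- t / 2) * exp (1 / 4 * t))" by (simp only: ac_simps)
  also have "exp (- t / 2) * exp (1 / 4 * t) = exp (- (1 / 4) * t)" by (simp flip: exp_add)
  finally show "exp (- (cmod w)\<^sup>2 / 2) * bracket w powr \<alpha> \<le> ?M * exp (- (1 / 4) * (cmod w)\<^sup>2)"
    by (simp only: t_def)
qed

text \<open>The Gaussian left over from the projection kernel, times the factor that Peetre's
  inequality costs when the weight is moved from \<open>z\<close> to \<open>z + w\<close>.\<close>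

definition gauss_weight :: "real \<Rightarrow> complex \<Rightarrow> real" where
  "gauss_weight \<alpha> w = exp (- (cmod w)\<^sup>2 / 2) * bracket w powr \<alpha>"

lemma gauss_weight_nonneg [simp]: "0 \<le> gauss_weight \<alpha> w"
  by (simp add: gauss_weight_def)

lemma continuous_gauss_weight: "continuous_on UNIV (gauss_weight \<alpha>)"
  unfolding gauss_weight_def[abs_def] by (intro continuous_intros continuous_bracket_powr) auto

lemma gauss_weight_measurable [measurable]: "gauss_weight \<alpha> \<in> borel_measurable borel"
  by (rule borel_measurable_continuous_onI[OF continuous_gauss_weight])

lemma integrable_gauss_weight:
  assumes "0 \<le> \<alpha>" shows "integrable lborel (gauss_weight \<alpha>)"
proof -
  obtain M where M: "M \<ge> 0" "\<And>w::complex. exp (- (cmod w)\<^sup>2 / 2) * bracket w powr \<alpha> \<le> M * exp (- (1 / 4) * (cmod w)\<^sup>2)"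
    using gauss_bracket_bound[OF assms] by blast
  have "integrable lborel (\<lambda>w::complex. M * exp (- (1 / 4) * (cmod w)\<^sup>2))"
    using integrable_gauss_complex[of "1 / 4"] by (intro integrable_mult_right) simp
  then show ?thesis
    by (rule Bochner_Integration.integrable_bound)
      (use M in \<open>auto intro!: AE_I2 simp: gauss_weight_def\<close>)
qed

text \<open>Completing the square. The factor in \<open>z\<close> cancels against the prefactor of
  \<open>bargmann_proj\<close>, so in modulus the projection is dominated by a convolution with a
  Gaussian.\<close>

lemma bargmann_kernel_norm:
  "cmod (exp (cnj w * z - complex_of_real ((cmod w)\<^sup>2 / 2))) = exp ((cmod z)\<^sup>2 / 2) * exp (- (cmod (w - z))\<^sup>2 / 2)"
proof -
  have "Re (cnj w * z) - (cmod w)\<^sup>2 / 2 = (cmod z)\<^sup>2 / 2 + - (cmod (w - z))\<^sup>2 / 2"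
    unfolding cmod_power2 by (simp add: power2_eq_square field_simps)
  then show ?thesis by (simp add: norm_exp_eq_Re exp_add[symmetric])
qed

context
  fixes g :: "complex \<Rightarrow> complex" and K :: real
  assumes contg: "continuous_on UNIV g" and K: "\<And>z. cmod (g z) \<le> K"
begin

lemma bargmann_argument_measurable [measurable]: "g \<in> borel_measurable borel"
  by (rule borel_measurable_continuous_onI[OF contg])

lemma bargmann_integrand_measurable [measurable]:
  "(\<lambda>w. exp (cnj w * z - complex_of_real ((cmod w)\<^sup>2 / 2)) * g w) \<in> borel_measurable borel"
  by (intro borel_measurable_continuous_onI continuous_intros contg) auto

lemma bargmann_integrable:
  "integrable lborel (\<lambda>w. exp (cnj w * z - complex_of_real ((cmod w)\<^sup>2 / 2)) * g w)"
proof (rule integrableI_bounded)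
  let ?G = "\<lambda>w::complex. ennreal (exp (- (1 / 2) * (cmod w)\<^sup>2))"
  have K0: "0 \<le> K" using K[of 0] norm_ge_zero order_trans by blast
  have "(\<integral>\<^sup>+w. ennreal (norm (exp (cnj w * z - complex_of_real ((cmod w)\<^sup>2 / 2)) * g w)) \<partial>lborel)
      \<le> (\<integral>\<^sup>+w. ennreal (exp ((cmod z)\<^sup>2 / 2) * K) * ?G (w + - z) \<partial>lborel)"
  proof (intro nn_integral_mono)
    fix w
    have "norm (exp (cnj w * z - complex_of_real ((cmod w)\<^sup>2 / 2)) * g w)
       \<le> exp ((cmod z)\<^sup>2 / 2) * exp (- (cmod (w - z))\<^sup>2 / 2) * K"
      unfolding norm_mult bargmann_kernel_norm by (intro mult_left_mono K) auto
    then show "ennreal (norm (exp (cnj w * z - complex_of_real ((cmod w)\<^sup>2 / 2)) * g w))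
      \<le> ennreal (exp ((cmod z)\<^sup>2 / 2) * K) * ?G (w + - z)"
      using K0 by (simp add: ennreal_mult[symmetric] ennreal_leI ac_simps)
  qed
  also have "\<dots> = ennreal (exp ((cmod z)\<^sup>2 / 2) * K) * (\<integral>\<^sup>+w. ?G (w + - z) \<partial>lborel)"
    by (intro nn_integral_cmult) measurable
  also have "(\<integral>\<^sup>+w. ?G (w + - z) \<partial>lborel) = (\<integral>\<^sup>+w. ?G w \<partial>lborel)"
    by (rule nn_integral_lborel_shift) measurable
  also have "ennreal (exp ((cmod z)\<^sup>2 / 2) * K) * (\<integral>\<^sup>+w. ?G w \<partial>lborel) < \<infinity>"
    using integrable_gauss_complex[of "1 / 2"] by (auto simp: integrable_iff_bounded ennreal_mult_less_top)
  finally show "(\<integral>\<^sup>+w. ennreal (norm (exp (cnj w * z - complex_of_real ((cmod w)\<^sup>2 / 2)) * g w)) \<partial>lborel) < \<infinity>" .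
qed measurable

lemma bargmann_proj_lborel:
  "bargmann_proj g z = complex_of_real (1 / pi * exp (- (cmod z)\<^sup>2 / 2)) *
     (LINT w|lborel. exp (cnj w * z - complex_of_real ((cmod w)\<^sup>2 / 2)) * g w)"
  unfolding bargmann_proj_def by (subst integral_completion) (simp_all only: measurable_lborel2 bargmann_integrand_measurable)

lemma bargmann_proj_le:
  "ennreal (cmod (bargmann_proj g z)) \<le> ennreal (1 / pi) * (\<integral>\<^sup>+w. ennreal (exp (- (cmod w)\<^sup>2 / 2) * cmod (g (z + w))) \<partial>lborel)"
proof -
  let ?I = "LINT w|lborel. exp (cnj w * z - complex_of_real ((cmod w)\<^sup>2 / 2)) * g w"
  let ?e = "exp (- (cmod z)\<^sup>2 / 2)"
  have "ennreal (cmod (bargmann_proj g z)) = ennreal (1 / pi) * (ennreal ?e * ennreal (cmod ?I))"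
  proof -
    have "\<bar>1 / pi * ?e\<bar> = 1 / pi * ?e" by (intro abs_of_nonneg) simp
    then have *: "cmod (bargmann_proj g z) = 1 / pi * (?e * cmod ?I)"
      unfolding bargmann_proj_lborel norm_mult norm_of_real by (simp only: mult.assoc)
    have "ennreal (a * (b * c)) = ennreal a * (ennreal b * ennreal c)" if "0 \<le> a" "0 \<le> b" "0 \<le> c" for a b c
      using that by (simp add: ennreal_mult)
    from this[of "1 / pi" ?e "cmod ?I"] show ?thesis unfolding * by simp
  qed
  also have "ennreal (cmod ?I) \<le> (\<integral>\<^sup>+w. ennreal (norm (exp (cnj w * z - complex_of_real ((cmod w)\<^sup>2 / 2)) * g w)) \<partial>lborel)"
    by (rule integral_norm_bound_ennreal[OF bargmann_integrable])
  also have "ennreal ?e * \<dots> = (\<integral>\<^sup>+w. ennreal ?e * ennreal (norm (exp (cnj w * z - complex_of_real ((cmod w)\<^sup>2 / 2)) * g w)) \<partial>lborel)"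
    by (intro nn_integral_cmult[symmetric]) measurable
  also have "\<dots> = (\<integral>\<^sup>+w. (\<lambda>w. ennreal (exp (- (cmod (w - z))\<^sup>2 / 2) * cmod (g w))) w \<partial>lborel)"
  proof (intro nn_integral_cong)
    fix w
    have "?e * exp ((cmod z)\<^sup>2 / 2) = 1" by (simp flip: exp_add)
    then have "?e * norm (exp (cnj w * z - complex_of_real ((cmod w)\<^sup>2 / 2)) * g w) = exp (- (cmod (w - z))\<^sup>2 / 2) * cmod (g w)"
      unfolding norm_mult bargmann_kernel_norm by (simp only: mult.assoc[symmetric] mult_1_left)
    then show "ennreal ?e * ennreal (norm (exp (cnj w * z - complex_of_real ((cmod w)\<^sup>2 / 2)) * g w))
      = ennreal (exp (- (cmod (w - z))\<^sup>2 / 2) * cmod (g w))" by (simp only: ennreal_mult'[symmetric] exp_ge_zero)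
  qed
  also have "\<dots> = (\<integral>\<^sup>+w. ennreal (exp (- (cmod ((w + z) - z))\<^sup>2 / 2) * cmod (g (w + z))) \<partial>lborel)"
    by (rule nn_integral_lborel_shift[symmetric]) measurable
  finally show ?thesis by (simp add: mult_left_mono add.commute)
qed

text \<open>Expanding \<open>exp (cnj w * z)\<close> in powers of \<open>z\<close> and integrating
  term by term exhibits the integral as an everywhere convergent power series with coefficients
  \<open>a n\<close>.\<close>

lemma bargmann_integral_holomorphic:
  "(\<lambda>z. LINT w|lborel. exp (cnj w * z - complex_of_real ((cmod w)\<^sup>2 / 2)) * g w) holomorphic_on UNIV"
proof -
  let ?h = "\<lambda>w. complex_of_real (exp (- (cmod w)\<^sup>2 / 2)) * g w"
  let ?I = "\<lambda>z. LINT w|lborel. exp (cnj w * z - complex_of_real ((cmod w)\<^sup>2 / 2)) * g w"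
  define a where "a n = (LINT w|lborel. (cnj w) ^ n /\<^sub>R fact n * ?h w)" for n
  have K0: "0 \<le> K" using K[of 0] norm_ge_zero order_trans by blast
  have sums: "(\<lambda>n. a n * z ^ n) sums ?I z" for z
  proof -
    let ?f = "\<lambda>n w. (cnj w * z) ^ n /\<^sub>R fact n * ?h w"
    \<comment> \<open>One integrable majorant for all partial sums:
      \<open>|w| * |z| \<le> |z|^2 + |w|^2 / 4\<close> leaves a quarter of \<open>|w|^2\<close> in
      the Gaussian.\<close>
    let ?G = "\<lambda>w::complex. K * exp ((cmod z)\<^sup>2) * exp (- (1 / 4) * (cmod w)\<^sup>2)"
    have G: "integrable lborel ?G"
      using integrable_gauss_complex[of "1 / 4"] by (intro integrable_mult_right) simp
    have part: "(\<Sum>n<N. norm (?f n w)) \<le> ?G w" for N w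
    proof -
      let ?x = "cmod w * cmod z"
      have "(\<Sum>n<N. norm (?f n w)) = (\<Sum>n<N. ?x ^ n /\<^sub>R fact n) * norm (?h w)"
        by (simp add: sum_distrib_right norm_mult norm_power mult.assoc)
      also have "(\<Sum>n<N. ?x ^ n /\<^sub>R fact n) \<le> exp ?x"
        unfolding exp_def by (intro sum_le_suminf summable_exp_generic) auto
      also have "exp ?x * norm (?h w) = exp ?x * exp (- (cmod w)\<^sup>2 / 2) * cmod (g w)" by (simp add: norm_mult)
      also have "\<dots> = exp (?x - (cmod w)\<^sup>2 / 2) * cmod (g w)" by (simp flip: exp_add)
      also have "\<dots> \<le> exp ((cmod z)\<^sup>2 - (1 / 4) * (cmod w)\<^sup>2) * K"
      proof (intro mult_mono K)
        have "0 \<le> (cmod z - cmod w / 2)\<^sup>2" by simp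
        then have "?x \<le> (cmod z)\<^sup>2 + (1 / 4) * (cmod w)\<^sup>2" by (simp add: power2_eq_square algebra_simps)
        then show "exp (?x - (cmod w)\<^sup>2 / 2) \<le> exp ((cmod z)\<^sup>2 - (1 / 4) * (cmod w)\<^sup>2)" by simp
      qed auto
      also have "\<dots> = ?G w"
      proof -
        have "exp ((cmod z)\<^sup>2 - (1 / 4) * (cmod w)\<^sup>2) = exp ((cmod z)\<^sup>2) * exp (- (1 / 4) * (cmod w)\<^sup>2)"
          by (simp flip: exp_add)
        then show ?thesis by (simp only: ac_simps)
      qed
      finally show ?thesis by (simp add: mult_right_mono)
    qed
    have int: "integrable lborel (?f n)" for n
    proof (rule Bochner_Integration.integrable_bound[OF G])
      show "?f n \<in> borel_measurable lborel"
        by (simp, intro borel_measurable_continuous_onI continuous_intros contg) auto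
      have "norm (?f n w) \<le> norm (?G w)" for w
      proof -
        have "norm (?f n w) \<le> (\<Sum>k<Suc n. norm (?f k w))" by (rule member_le_sum) auto
        also have "\<dots> \<le> ?G w" by (rule part)
        finally show ?thesis by simp
      qed
      then show "AE w in lborel. norm (?f n w) \<le> norm (?G w)" by simp
    qed
    have summ: "summable (\<lambda>n. norm (?f n w))" for w
      by (rule summableI_nonneg_bounded[OF _ part]) simp
    have "(\<lambda>n. LINT w|lborel. ?f n w) sums (LINT w|lborel. (\<Sum>n. ?f n w))"
    proof (rule sums_integral[OF int])
      show "AE w in lborel. summable (\<lambda>n. norm (?f n w))" using summ by simp
      show "summable (\<lambda>n. LINT w|lborel. norm (?f n w))"
      proof (rule summableI_nonneg_bounded)
        fix N
        have "(\<Sum>n<N. LINT w|lborel. norm (?f n w)) = (LINT w|lborel. (\<Sum>n<N. norm (?f n w)))"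
          by (rule Bochner_Integration.integral_sum[symmetric]) (intro integrable_norm int)
        also have "\<dots> \<le> (LINT w|lborel. ?G w)"
          by (intro integral_mono Bochner_Integration.integrable_sum integrable_norm int G part)
        finally show "(\<Sum>n<N. LINT w|lborel. norm (?f n w)) \<le> (LINT w|lborel. ?G w)" .
      qed simp
    qed
    moreover have "(\<Sum>n. ?f n w) = exp (cnj w * z - complex_of_real ((cmod w)\<^sup>2 / 2)) * g w" for w
    proof -
      have "(\<lambda>n. ?f n w) sums (exp (cnj w * z) * ?h w)" by (intro sums_mult2 exp_converges)
      moreover have "exp (cnj w * z) * ?h w = exp (cnj w * z - complex_of_real ((cmod w)\<^sup>2 / 2)) * g w"
      proof -
        have "complex_of_real (exp (- (cmod w)\<^sup>2 / 2)) = exp (- complex_of_real ((cmod w)\<^sup>2 / 2))"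
          by (simp flip: exp_of_real)
        then show ?thesis by (simp only: diff_conv_add_uminus exp_add mult.assoc)
      qed
      ultimately show ?thesis by (simp add: sums_iff)
    qed
    moreover have "(LINT w|lborel. ?f n w) = a n * z ^ n" for n
    proof -
      have "?f n = (\<lambda>w. ((cnj w) ^ n /\<^sub>R fact n * ?h w) * z ^ n)" by (auto simp: power_mult_distrib)
      then show ?thesis unfolding a_def by (simp only: integral_mult_left_zero)
    qed
    ultimately show ?thesis by simp
  qed
  have "?I field_differentiable at z" for z
  proof -
    have "?I holomorphic_on ball 0 (cmod z + 1)"
      by (rule power_series_holomorphic[where a = a]) (use sums in simp)
    then show ?thesis by (rule holomorphic_on_imp_differentiable_at) auto
  qed
  then show ?thesis by (simp add: holomorphic_on_def field_differentiable_at_within)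
qed

lemma bargmann_proj_E_tilde: "bargmann_proj g \<in> E_tilde"
proof -
  have K0: "0 \<le> K" using K[of 0] norm_ge_zero order_trans by blast
  let ?I = "\<lambda>z. LINT w|lborel. exp (cnj w * z - complex_of_real ((cmod w)\<^sup>2 / 2)) * g w"
  have "(\<lambda>z. complex_of_real (1 / pi) * ?I z) holomorphic_on UNIV"
    by (intro holomorphic_intros bargmann_integral_holomorphic)
  moreover have "bargmann_proj g z = complex_of_real (exp (- (cmod z)\<^sup>2 / 2)) * (complex_of_real (1 / pi) * ?I z)" for z
    unfolding bargmann_proj_lborel by simp
  moreover define B where "B = (LINT w|lborel. gauss_weight 0 w)"
  have "cmod (bargmann_proj g z) \<le> (1 / pi * (K * B)) * bracket z powr 0" for z
  proof -
    have "ennreal (cmod (bargmann_proj g z)) \<le> ennreal (1 / pi) * (\<integral>\<^sup>+w. ennreal (exp (- (cmod w)\<^sup>2 / 2) * cmod (g (z + w))) \<partial>lborel)"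
      by (rule bargmann_proj_le)
    also have "\<dots> \<le> ennreal (1 / pi) * (\<integral>\<^sup>+w. ennreal (gauss_weight 0 w * K) \<partial>lborel)"
      by (intro mult_left_mono nn_integral_mono ennreal_leI) (auto simp: gauss_weight_def K)
    also have "(\<integral>\<^sup>+w. ennreal (gauss_weight 0 w * K) \<partial>lborel) = ennreal (LINT w|lborel. gauss_weight 0 w * K)"
      using K0 by (intro nn_integral_eq_integral integrable_mult_left integrable_gauss_weight) auto
    also have "ennreal (1 / pi) * \<dots> = ennreal (1 / pi * (K * B))"
      by (subst ennreal_mult'[symmetric]) (auto simp: B_def ac_simps)
    finally show ?thesis using K0 by (simp add: B_def)
  qed
  ultimately show ?thesis unfolding E_tilde_def by blast
qed

text \<open>Translating the integration variable by the period multiplies the integrand by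
  \<open>exp (\<gamma> * z + \<gamma>^2 / 2)\<close>, which does not depend on \<open>w\<close>.
  Together with the change of the Gaussian prefactor it cancels the phase in
  \<open>mag_trans\<close>.\<close>

lemma bargmann_proj_F_per:
  assumes per: "mag_trans (of_real \<gamma>) g = g"
  shows "bargmann_proj g \<in> F_per \<gamma>"
proof -
  let ?k = "\<lambda>z w. exp (cnj w * z - complex_of_real ((cmod w)\<^sup>2 / 2)) * g w"
  let ?c = "complex_of_real \<gamma>"
  have gper: "g (w + ?c) = exp (- ((?c * cnj w - ?c * w) / 2)) * g w" for w
  proof -
    have "exp ((?c * cnj w - ?c * w) / 2) * g (w + ?c) = g w"
      using fun_cong[OF per, of w] by (simp add: mag_trans_def)
    then have "exp (- ((?c * cnj w - ?c * w) / 2)) * (exp ((?c * cnj w - ?c * w) / 2) * g (w + ?c)) = exp (- ((?c * cnj w - ?c * w) / 2)) * g w" by simp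
    then show ?thesis by (simp only: mult.assoc[symmetric] exp_add[symmetric]) simp
  qed
  have "mag_trans ?c (bargmann_proj g) z = bargmann_proj g z" for z
  proof -
    have "(LINT w|lborel. ?k (z + ?c) w) = (LINT w|distr lborel borel ((+) ?c). ?k (z + ?c) w)"
      by (simp only: lborel_distr_plus)
    also have "\<dots> = (LINT w|lborel. ?k (z + ?c) (?c + w))" by (rule integral_distr[OF _ bargmann_integrand_measurable]) simp
    also have "\<dots> = (LINT w|lborel. exp (?c * z + ?c\<^sup>2 / 2) * ?k z w)"
    proof (intro Bochner_Integration.integral_cong refl)
      fix w
      have cw: "complex_of_real ((cmod v)\<^sup>2 / 2) = v * cnj v / 2" for v by (simp add: complex_norm_square[symmetric])
      have "cnj (?c + w) * (z + ?c) - complex_of_real ((cmod (?c + w))\<^sup>2 / 2) + - ((?c * cnj w - ?c * w) / 2)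
         = (?c * z + ?c\<^sup>2 / 2) + (cnj w * z - complex_of_real ((cmod w)\<^sup>2 / 2))"
        unfolding cw by (simp add: field_simps power2_eq_square)
      then show "?k (z + ?c) (?c + w) = exp (?c * z + ?c\<^sup>2 / 2) * ?k z w"
        unfolding add.commute[of ?c w] gper by (simp only: mult.assoc[symmetric] exp_add[symmetric])
    qed
    also have "\<dots> = exp (?c * z + ?c\<^sup>2 / 2) * (LINT w|lborel. ?k z w)" by (rule integral_mult_right_zero)
    finally have I: "(LINT w|lborel. ?k (z + ?c) w) = exp (?c * z + ?c\<^sup>2 / 2) * (LINT w|lborel. ?k z w)" .
    have ofexp: "complex_of_real (1 / pi * exp (- (cmod v)\<^sup>2 / 2)) = complex_of_real (1 / pi) * exp (- (v * cnj v) / 2)" for v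
    proof -
      have "complex_of_real (exp (- (cmod v)\<^sup>2 / 2)) = exp (complex_of_real (- (cmod v)\<^sup>2 / 2))" by (simp only: exp_of_real)
      also have "complex_of_real (- (cmod v)\<^sup>2 / 2) = - (v * cnj v) / 2" by (simp add: complex_norm_square[symmetric])
      finally show ?thesis by (simp only: of_real_mult)
    qed
    have "((?c * cnj z - cnj ?c * z) / 2) + - ((z + ?c) * cnj (z + ?c)) / 2 + (?c * z + ?c\<^sup>2 / 2) = - (z * cnj z) / 2"
      by (simp add: field_simps power2_eq_square)
    then have "exp ((?c * cnj z - cnj ?c * z) / 2) * exp (- ((z + ?c) * cnj (z + ?c)) / 2) * exp (?c * z + ?c\<^sup>2 / 2) = exp (- (z * cnj z) / 2)"
      by (simp only: exp_add[symmetric])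
    moreover have "a * b * c = d \<Longrightarrow> a * (k * b * (c * x)) = k * d * x" for a b c d k x :: complex by auto
    ultimately show ?thesis
      unfolding mag_trans_def bargmann_proj_lborel I ofexp by blast
  qed
  then show ?thesis using bargmann_proj_E_tilde by (auto simp: F_per_def)
qed

end

section \<open>Weighted bounds for the projection\<close>

text \<open>Jensen's inequality for a measure \<open>k\<close> of total mass at most
  \<open>m\<close>. The tangent to the power at \<open>P / m\<close>, with \<open>P\<close> the
  integral of \<open>k * f\<close>, is integrated against \<open>k\<close>; the mass deficit only
  adds a term of the favourable sign.\<close>

lemma weighted_jensen:
  fixes k f :: "'a \<Rightarrow> real"
  assumes k: "integrable M k" "\<And>x. 0 \<le> k x" and f [measurable]: "f \<in> borel_measurable M"
    and fB: "\<And>x. 0 \<le> f x" "\<And>x. f x \<le> B" and m: "0 < m" "(LINT x|M. k x) \<le> m" and q: "1 \<le> q"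
  shows "(LINT x|M. k x * f x) powr q \<le> m powr (q - 1) * (LINT x|M. k x * f x powr q)"
    and "integrable M (\<lambda>x. k x * f x)" and "integrable M (\<lambda>x. k x * f x powr q)"
proof -
  have [measurable]: "k \<in> borel_measurable M" using k(1) by (rule borel_measurable_integrable)
  show int1: "integrable M (\<lambda>x. k x * f x)"
    by (rule Bochner_Integration.integrable_bound[OF integrable_mult_left[OF k(1), of B]])
      (use fB k(2) order_trans[OF fB] in \<open>auto intro!: AE_I2 mult_left_mono simp: abs_mult\<close>)
  show int2: "integrable M (\<lambda>x. k x * f x powr q)"
  proof (rule Bochner_Integration.integrable_bound[OF integrable_mult_left[OF k(1), of "B powr q"]])
    show "AE x in M. norm (k x * f x powr q) \<le> norm (k x * B powr q)"
      using k(2) fB q by (auto intro!: AE_I2 mult_left_mono powr_mono2 simp: abs_mult)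
  qed simp
  define P where "P = (LINT x|M. k x * f x)"
  define Q where "Q = (LINT x|M. k x * f x powr q)"
  define m0 where "m0 = (LINT x|M. k x)"
  have P0: "0 \<le> P" unfolding P_def using k(2) fB(1) by (intro integral_nonneg_AE) auto
  define y where "y = P / m"
  define c where "c = q * y powr (q - 1)"
  have y: "0 \<le> y" "P = y * m" using P0 m by (auto simp: y_def)
  have c0: "0 \<le> c" using q by (simp add: c_def)
  have "(LINT x|M. k x * (y powr q - c * y) + c * (k x * f x)) \<le> Q"
    unfolding Q_def
  proof (intro integral_mono Bochner_Integration.integrable_add integrable_mult_left integrable_mult_right k int1 int2)
    fix x
    have "k x * (y powr q + c * (f x - y)) \<le> k x * f x powr q"
      unfolding c_def using k(2) fB(1) y q by (intro mult_left_mono powr_tangent) auto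
    then show "k x * (y powr q - c * y) + c * (k x * f x) \<le> k x * f x powr q" by (simp add: algebra_simps)
  qed
  also have "(LINT x|M. k x * (y powr q - c * y) + c * (k x * f x)) = m0 * (y powr q - c * y) + c * P"
    unfolding m0_def P_def using k int1 by simp
  finally have le: "m0 * y powr q + c * y * (m - m0) \<le> Q" unfolding y(2) by (simp add: algebra_simps)
  \<comment> \<open>Since \<open>1 \<le> q\<close>, the missing mass \<open>m - m0\<close> may be
    counted with the value \<open>y powr q\<close> itself.\<close>
  have cy: "y powr q \<le> c * y"
  proof (cases "y = 0")
    case False
    then have "c * y = q * y powr q" using y(1) by (simp add: c_def powr_diff)
    then show ?thesis using q mult_right_mono[of 1 q "y powr q"] by simp
  qed simp
  have "y powr q * (m - m0) \<le> c * y * (m - m0)" using cy m by (intro mult_right_mono) (auto simp: m0_def)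
  with le have "m * y powr q \<le> Q" by (simp add: algebra_simps)
  then have "m powr (q - 1) * (m * y powr q) \<le> m powr (q - 1) * Q" by (intro mult_left_mono) auto
  moreover have "m powr (q - 1) * (m * y powr q) = P powr q"
    using m(1) y by (simp add: powr_mult powr_diff)
  ultimately show "(LINT x|M. k x * f x) powr q \<le> m powr (q - 1) * (LINT x|M. k x * f x powr q)"
    by (simp add: P_def Q_def)
qed

lemma wLp_norm_nonneg: "0 \<le> wLp_norm p \<alpha> S u"
  by (simp add: wLp_norm_def Lp_norm_def)

lemma wLp_ball:
  assumes "1 \<le> p" "u \<in> wLp_space p \<alpha> S"
  shows "Lp_ball p S (wLp_norm p \<alpha> S u) (weighted \<alpha> u)"
  using assms Lp_ball_iff[OF assms(1) wLp_norm_nonneg[of p \<alpha> S u], of S "weighted \<alpha> u"]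
  by (simp add: wLp_space_def wLp_norm_def)

lemma wLp_ballD:
  assumes "1 \<le> p" "0 \<le> B" "Lp_ball p S B (weighted \<alpha> u)"
  shows "u \<in> wLp_space p \<alpha> S \<and> wLp_norm p \<alpha> S u \<le> B"
  using Lp_ball_iff[OF assms(1,2)] assms(3) by (simp add: wLp_space_def wLp_norm_def)

lemma E_tildeE:
  assumes "u \<in> E_tilde"
  obtains f M C where "f holomorphic_on UNIV" "\<And>z. u z = complex_of_real (exp (- (cmod z)\<^sup>2 / 2)) * f z"
    "\<And>z. cmod (u z) \<le> C * bracket z powr M"
proof -
  have "\<exists>f. f holomorphic_on UNIV \<and> (\<forall>z. u z = complex_of_real (exp (- (cmod z)\<^sup>2 / 2)) * f z)"
    "\<exists>M C. \<forall>z. cmod (u z) \<le> C * bracket z powr M"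
    using assms unfolding E_tilde_def by simp_all
  then show ?thesis using that by blast
qed

lemma E_tilde_lincomb:
  assumes "u \<in> E_tilde" "v \<in> E_tilde" shows "(\<lambda>z. a * u z + b * v z) \<in> E_tilde"
proof -
  obtain f M C where f: "f holomorphic_on UNIV" "\<And>z. u z = complex_of_real (exp (- (cmod z)\<^sup>2 / 2)) * f z"
    and M: "\<And>z. cmod (u z) \<le> C * bracket z powr M"
    by (rule E_tildeE[OF assms(1)]) (rule that)
  obtain f' M' C' where f': "f' holomorphic_on UNIV" "\<And>z. v z = complex_of_real (exp (- (cmod z)\<^sup>2 / 2)) * f' z"
    and M': "\<And>z. cmod (v z) \<le> C' * bracket z powr M'"
    by (rule E_tildeE[OF assms(2)]) (rule that)
  have "(\<lambda>z. a * f z + b * f' z) holomorphic_on UNIV" by (intro holomorphic_intros f f')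
  moreover have "a * u z + b * v z = complex_of_real (exp (- (cmod z)\<^sup>2 / 2)) * (a * f z + b * f' z)" for z
    by (simp add: f f' algebra_simps)
  moreover have "cmod (a * u z + b * v z) \<le> (cmod a * \<bar>C\<bar> + cmod b * \<bar>C'\<bar>) * bracket z powr (max M M')" for z
  proof -
    have le: "c * bracket z powr m \<le> \<bar>c\<bar> * bracket z powr (max M M')" if "m \<le> max M M'" for c m
    proof -
      have "c * bracket z powr m \<le> \<bar>c\<bar> * bracket z powr m" by (intro mult_right_mono) auto
      also have "\<dots> \<le> \<bar>c\<bar> * bracket z powr (max M M')"
        by (intro mult_left_mono powr_mono that bracket_ge_1) simp
      finally show ?thesis .
    qed
    have "cmod (a * u z + b * v z) \<le> cmod a * cmod (u z) + cmod b * cmod (v z)"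
      by (metis norm_mult norm_triangle_ineq)
    also have "\<dots> \<le> cmod a * (\<bar>C\<bar> * bracket z powr (max M M')) + cmod b * (\<bar>C'\<bar> * bracket z powr (max M M'))"
      by (intro add_mono mult_left_mono order_trans[OF M le] order_trans[OF M' le]) auto
    finally show ?thesis by (simp add: algebra_simps)
  qed
  ultimately show ?thesis unfolding E_tilde_def by blast
qed

lemma F_per_lincomb:
  assumes "u \<in> F_per \<gamma>" "v \<in> F_per \<gamma>" shows "(\<lambda>z. a * u z + b * v z) \<in> F_per \<gamma>"
proof -
  have "mag_trans (of_real \<gamma>) (\<lambda>z. a * u z + b * v z) z = a * u z + b * v z" for z
  proof -
    have "mag_trans (of_real \<gamma>) (\<lambda>z. a * u z + b * v z) z = a * mag_trans (of_real \<gamma>) u z + b * mag_trans (of_real \<gamma>) v z"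
      by (simp add: mag_trans_def algebra_simps)
    then show ?thesis using assms by (simp add: F_per_def)
  qed
  then show ?thesis using assms E_tilde_lincomb by (auto simp: F_per_def)
qed

lemma F_per_sup_bound:
  assumes \<gamma>: "\<gamma> > 0" and \<alpha>: "0 \<le> \<alpha>"
  shows "\<exists>C\<ge>0. \<forall>p u. 1 \<le> p \<longrightarrow> u \<in> F_per \<gamma> \<inter> wLp_space p \<alpha> (strip \<gamma>) \<longrightarrow>
    (\<forall>z. im_weight \<alpha> z * cmod (u z) \<le> C * wLp_norm p \<alpha> (strip \<gamma>) u)"
proof -
  obtain C where C: "C \<ge> 0" "\<And>p u z. 1 \<le> p \<Longrightarrow> u \<in> F_per \<gamma> \<Longrightarrow> Lp_ball p (strip \<gamma>) 1 (weighted \<alpha> u) \<Longrightarrow>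
    im_weight \<alpha> z * cmod (u z) \<le> C"
    using F_per_sup_bound_unit[OF assms] by blast
  have "im_weight \<alpha> z * cmod (u z) \<le> C * wLp_norm p \<alpha> (strip \<gamma>) u"
    if p: "1 \<le> p" and u: "u \<in> F_per \<gamma>" "u \<in> wLp_space p \<alpha> (strip \<gamma>)" for p u z
  proof (rule field_le_epsilon)
    let ?N = "wLp_norm p \<alpha> (strip \<gamma>) u"
    fix e :: real assume e: "e > 0"
    \<comment> \<open>A strictly positive radius by which to normalise, even if the norm is zero;
      multiplied by \<open>C\<close>, the increment stays below \<open>e\<close>.\<close>
    define B where "B = ?N + e / (C + 1)"
    have B: "B > 0" "?N \<le> B" using wLp_norm_nonneg[of p \<alpha> "strip \<gamma>" u] e C(1) by (auto simp: B_def intro!: add_nonneg_pos)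
    let ?v = "\<lambda>z. complex_of_real (1 / B) * u z"
    have v: "?v \<in> F_per \<gamma>" using F_per_lincomb[OF u(1) u(1), of "of_real (1 / B)" 0] by simp
    have "Lp_ball p (strip \<gamma>) B (weighted \<alpha> u)"
      using wLp_ball[OF p u(2)] Lp_ball_iff[OF p] B wLp_norm_nonneg order_trans by (metis less_imp_le)
    then have "Lp_ball p (strip \<gamma>) (1 / B * B) (weighted \<alpha> ?v)"
      using B v by (intro Lp_ball_mono[OF p]) (auto simp: F_per_def norm_divide cmod_weighted intro!: weighted_measurable)
    then have "im_weight \<alpha> z * cmod (?v z) \<le> C" using B by (intro C(2)[OF p v]) simp
    then have "im_weight \<alpha> z * cmod (u z) \<le> C * B" using B by (simp add: norm_divide field_simps)
    also have "\<dots> = C * ?N + C / (C + 1) * e" using C(1) by (simp add: B_def algebra_simps)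
    also have "\<dots> \<le> C * ?N + 1 * e" using C(1) e by (intro add_left_mono mult_right_mono) auto
    finally show "im_weight \<alpha> z * cmod (u z) \<le> C * ?N + e" by simp
  qed
  then show ?thesis using C(1) by blast
qed

text \<open>In the application \<open>A\<close> is the product of sup bounds for two factors of the
  trilinear term, so that only \<open>u\<close> stays under the integral. Moving the weight inside
  leaves the Gaussian average \<open>P\<close> of the periodic function \<open>V\<close>. After
  Jensen and Tonelli, \<open>strip_shift_bound\<close> controls each translate of \<open>V\<close>
  by the norm of \<open>u\<close>.\<close>

lemma bargmann_proj_wLp_bound:
  assumes \<gamma>: "\<gamma> > 0" and \<alpha>: "0 \<le> \<alpha>"
  shows "\<exists>D\<ge>0. \<forall>p u g A. 1 \<le> p \<longrightarrow> u \<in> F_per \<gamma> \<inter> wLp_space p \<alpha> (strip \<gamma>) \<longrightarrow> continuous_on UNIV g \<longrightarrow> 0 \<le> A \<longrightarrow>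
    (\<forall>z. cmod (g z) \<le> A * cmod (u z)) \<longrightarrow>
    Lp_ball p (strip \<gamma>) (D * (A * wLp_norm p \<alpha> (strip \<gamma>) u)) (weighted \<alpha> (bargmann_proj g))"
proof -
  obtain C where C: "C \<ge> 0" "\<And>p u z. 1 \<le> p \<Longrightarrow> u \<in> F_per \<gamma> \<inter> wLp_space p \<alpha> (strip \<gamma>) \<Longrightarrow>
    im_weight \<alpha> z * cmod (u z) \<le> C * wLp_norm p \<alpha> (strip \<gamma>) u"
    using F_per_sup_bound[OF assms] by blast
  let ?S = "strip \<gamma>" and ?k = "gauss_weight \<alpha>"
  note kint = integrable_gauss_weight[OF \<alpha>]
  \<comment> \<open>The added \<open>1\<close> makes positivity, which
    \<open>weighted_jensen\<close> asks for, immediate.\<close>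
  define m where "m = (LINT w|lborel. ?k w) + 1"
  have m: "0 < m" "(LINT w|lborel. ?k w) \<le> m"
  proof -
    have "0 \<le> (LINT w|lborel. ?k w)" by (intro integral_nonneg_AE) auto
    then show "0 < m" "(LINT w|lborel. ?k w) \<le> m" unfolding m_def by linarith+
  qed
  have km: "(\<integral>\<^sup>+w. ennreal (?k w) \<partial>lborel) \<le> ennreal m"
    using nn_integral_eq_integral[OF kint] m(2) by (simp add: ennreal_leI)
  define L where "L = (1 + \<gamma>) powr \<alpha> * (2 powr (\<alpha> / 2) / pi)"
  \<comment> \<open>\<open>C\<close> is what the case \<open>p = \<infinity>\<close> needs and
    \<open>2\<close> what finite \<open>p\<close> needs; the sum serves both.\<close>
  define D where "D = L * (m * (C + 2))"
  have L: "0 \<le> L" by (simp add: L_def)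
  have D: "0 \<le> D" using L m(1) C(1) by (simp add: D_def)
  have "Lp_ball p ?S (D * (A * wLp_norm p \<alpha> ?S u)) (weighted \<alpha> (bargmann_proj g))"
    if p: "1 \<le> p" and u: "u \<in> F_per \<gamma> \<inter> wLp_space p \<alpha> ?S" and g: "continuous_on UNIV g" and A: "0 \<le> A"
      and gu: "\<And>z. cmod (g z) \<le> A * cmod (u z)" for p u g A
  proof -
    let ?N = "wLp_norm p \<alpha> ?S u"
    note N0 = wLp_norm_nonneg[of p \<alpha> ?S u]
    have uE: "u \<in> E_tilde" using u by (simp add: F_per_def)
    define V where "V z = im_weight \<alpha> z * cmod (u z)" for z
    have contV: "continuous_on UNIV V"
      unfolding V_def[abs_def] by (intro continuous_intros continuous_im_weight E_tilde_continuous[OF uE])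
    have [measurable]: "V \<in> borel_measurable borel" by (rule borel_measurable_continuous_onI[OF contV])
    have V0: "0 \<le> V z" for z by (simp add: V_def)
    have VC: "V z \<le> C * ?N" for z unfolding V_def by (rule C(2)[OF p u])
    have Vper: "V (z + of_real \<gamma>) = V z" for z
      using u by (simp add: V_def im_weight_def F_per_cmod_periodic[of u])
    have gB: "cmod (g z) \<le> A * (C * ?N)" for z
    proof -
      have "cmod (u z) \<le> V z" unfolding V_def using mult_right_mono[OF im_weight_ge_1[OF \<alpha>], of "cmod (u z)" z] by simp
      then show ?thesis using gu[of z] VC[of z] A mult_left_mono[of "cmod (u z)" "C * ?N" A] by linarith
    qed
    define P where "P z = (LINT w|lborel. ?k w * V (z + w))" for z
    have P0: "0 \<le> P z" for z unfolding P_def using V0 by (intro integral_nonneg_AE) auto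
    have jensen: "P z powr q \<le> m powr (q - 1) * (LINT w|lborel. ?k w * V (z + w) powr q)"
        "integrable lborel (\<lambda>w. ?k w * V (z + w))" "integrable lborel (\<lambda>w. ?k w * V (z + w) powr q)" if "1 \<le> q" for q z
      unfolding P_def
      by (rule weighted_jensen[OF kint _ _ _ _ m that, of "\<lambda>w. V (z + w)" "C * ?N"]; (simp add: V0 VC)?)+
    have PC: "P z \<le> m * (C * ?N)" for z
    proof -
      have "P z \<le> (LINT w|lborel. ?k w * (C * ?N))"
        unfolding P_def by (intro integral_mono jensen(2)[of 1] integrable_mult_left kint mult_left_mono VC) auto
      also have "\<dots> = (LINT w|lborel. ?k w) * (C * ?N)" by simp
      also have "\<dots> \<le> m * (C * ?N)" using m C N0 by (intro mult_right_mono) auto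
      finally show ?thesis .
    qed
    have le: "im_weight \<alpha> z * cmod (bargmann_proj g z) \<le> 2 powr (\<alpha> / 2) / pi * A * P z" for z
    proof -
      have "ennreal (im_weight \<alpha> z * cmod (bargmann_proj g z)) = ennreal (im_weight \<alpha> z) * ennreal (cmod (bargmann_proj g z))"
        by (simp add: ennreal_mult)
      also have "\<dots> \<le> ennreal (im_weight \<alpha> z) * (ennreal (1 / pi) * (\<integral>\<^sup>+w. ennreal (exp (- (cmod w)\<^sup>2 / 2) * cmod (g (z + w))) \<partial>lborel))"
        by (intro mult_left_mono bargmann_proj_le[OF g gB]) auto
      also have "\<dots> = ennreal (1 / pi) * (\<integral>\<^sup>+w. ennreal (im_weight \<alpha> z) * ennreal (exp (- (cmod w)\<^sup>2 / 2) * cmod (g (z + w))) \<partial>lborel)"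
      proof -
        have [measurable]: "g \<in> borel_measurable borel" by (rule borel_measurable_continuous_onI[OF g])
        show ?thesis by (subst nn_integral_cmult) (auto simp: ac_simps)
      qed
      also have "\<dots> \<le> ennreal (1 / pi) * (\<integral>\<^sup>+w. ennreal (2 powr (\<alpha> / 2) * A * (?k w * V (z + w))) \<partial>lborel)"
      proof (intro mult_left_mono nn_integral_mono)
        fix w
        have "im_weight \<alpha> z * (exp (- (cmod w)\<^sup>2 / 2) * cmod (g (z + w)))
           \<le> (2 powr (\<alpha> / 2) * im_weight \<alpha> (z + w) * bracket w powr \<alpha>) * (exp (- (cmod w)\<^sup>2 / 2) * (A * cmod (u (z + w))))"
          using A by (intro mult_mono im_weight_shift \<alpha> mult_left_mono gu) auto
        also have "\<dots> = 2 powr (\<alpha> / 2) * A * (?k w * V (z + w))" by (simp add: gauss_weight_def V_def)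
        finally show "ennreal (im_weight \<alpha> z) * ennreal (exp (- (cmod w)\<^sup>2 / 2) * cmod (g (z + w)))
           \<le> ennreal (2 powr (\<alpha> / 2) * A * (?k w * V (z + w)))"
          by (simp add: ennreal_mult'[symmetric] ennreal_leI)
      qed simp
      also have "(\<integral>\<^sup>+w. ennreal (2 powr (\<alpha> / 2) * A * (?k w * V (z + w))) \<partial>lborel) = ennreal (2 powr (\<alpha> / 2) * A * P z)"
        unfolding P_def using A V0 jensen(2)[of 1 z]
        by (subst nn_integral_eq_integral) auto
      also have "ennreal (1 / pi) * \<dots> = ennreal (2 powr (\<alpha> / 2) / pi * A * P z)"
        by (subst ennreal_mult'[symmetric]) auto
      finally show ?thesis using A P0 by simp
    qed
    have wle: "cmod (weighted \<alpha> (bargmann_proj g) z) \<le> L * A * P z" if "z \<in> ?S" for z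
    proof -
      have "cmod (weighted \<alpha> (bargmann_proj g) z) \<le> (1 + \<gamma>) powr \<alpha> * im_weight \<alpha> z * cmod (bargmann_proj g z)"
        unfolding cmod_weighted by (intro mult_right_mono bracket_le_im_weight \<alpha> \<gamma> that) auto
      also have "\<dots> \<le> (1 + \<gamma>) powr \<alpha> * (2 powr (\<alpha> / 2) / pi * A * P z)"
        unfolding mult.assoc[of "(1 + \<gamma>) powr \<alpha>"] by (intro mult_left_mono le) auto
      finally show ?thesis by (simp add: L_def)
    qed
    have meas: "weighted \<alpha> (bargmann_proj g) \<in> borel_measurable (lebesgue_on ?S)"
      by (rule weighted_measurable[OF bargmann_proj_E_tilde[OF g gB]])
    show ?thesis
    proof (cases "p = \<infinity>")
      case True
      have "cmod (weighted \<alpha> (bargmann_proj g) z) \<le> D * (A * ?N)" if "z \<in> ?S" for z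
      proof -
        have "L * A * P z \<le> L * A * (m * (C * ?N))" using L A by (intro mult_left_mono PC) auto
        also have "\<dots> \<le> L * A * (m * ((C + 2) * ?N))"
          using L A m N0 by (intro mult_left_mono mult_right_mono) auto
        finally show ?thesis using wle[OF that] by (simp add: D_def ac_simps)
      qed
      then show ?thesis using True meas by (auto simp: Lp_ball_def space_restrict_space intro!: AE_I2)
    next
      case False
      define q where "q = enn2real p"
      have q: "1 \<le> q" unfolding q_def by (rule enn2real_ge_1[OF p False])
      have VN: "(\<integral>\<^sup>+z. indicator ?S z * ennreal (V z powr q) \<partial>lborel) \<le> ennreal (?N powr q)"
      proof -
        have "(\<integral>\<^sup>+z. ennreal (V z powr q) \<partial>lebesgue_on ?S) \<le> (\<integral>\<^sup>+z. ennreal (cmod (weighted \<alpha> u z) powr q) \<partial>lebesgue_on ?S)"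
          using q unfolding V_def cmod_weighted
          by (intro nn_integral_mono ennreal_leI powr_mono2 mult_right_mono im_weight_le \<alpha>) auto
        also have "\<dots> \<le> ennreal (?N powr q)" using wLp_ball[OF p, of u \<alpha> ?S] u False by (simp add: Lp_ball_def q_def)
        finally show ?thesis by (simp only: nn_integral_lebesgue_on_strip)
      qed
      have Pq: "ennreal (P z powr q) \<le> ennreal (m powr (q - 1)) * (\<integral>\<^sup>+w. ennreal (?k w) * ennreal (V (z + w) powr q) \<partial>lborel)" for z
      proof -
        have "ennreal (P z powr q) \<le> ennreal (m powr (q - 1)) * ennreal (LINT w|lborel. ?k w * V (z + w) powr q)"
          using jensen(1)[OF q, of z] by (simp add: ennreal_mult'[symmetric] ennreal_leI)
        also have "ennreal (LINT w|lborel. ?k w * V (z + w) powr q) = (\<integral>\<^sup>+w. ennreal (?k w * V (z + w) powr q) \<partial>lborel)"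
          by (rule nn_integral_eq_integral[symmetric, OF jensen(3)[OF q]]) simp
        finally show ?thesis by (simp add: ennreal_mult)
      qed
      have mprod: "(\<lambda>(z, w). indicator ?S z * (ennreal (?k w) * ennreal (V (z + w) powr q))) \<in> borel_measurable (lborel \<Otimes>\<^sub>M lborel)"
        by measurable
      have "(\<integral>\<^sup>+z. indicator ?S z * ennreal (P z powr q) \<partial>lborel)
         \<le> (\<integral>\<^sup>+z. ennreal (m powr (q - 1)) * (\<integral>\<^sup>+w. indicator ?S z * (ennreal (?k w) * ennreal (V (z + w) powr q)) \<partial>lborel) \<partial>lborel)"
      proof (rule nn_integral_mono)
        fix z
        show "indicator ?S z * ennreal (P z powr q) \<le> ennreal (m powr (q - 1)) * (\<integral>\<^sup>+w. indicator ?S z * (ennreal (?k w) * ennreal (V (z + w) powr q)) \<partial>lborel)"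
          using Pq[of z] by (cases "z \<in> ?S") auto
      qed
      also have "\<dots> = ennreal (m powr (q - 1)) * (\<integral>\<^sup>+z. \<integral>\<^sup>+w. indicator ?S z * (ennreal (?k w) * ennreal (V (z + w) powr q)) \<partial>lborel \<partial>lborel)"
        by (intro nn_integral_cmult) measurable
      also have "(\<integral>\<^sup>+z. \<integral>\<^sup>+w. indicator ?S z * (ennreal (?k w) * ennreal (V (z + w) powr q)) \<partial>lborel \<partial>lborel)
         = (\<integral>\<^sup>+w. \<integral>\<^sup>+z. indicator ?S z * (ennreal (?k w) * ennreal (V (z + w) powr q)) \<partial>lborel \<partial>lborel)"
        using lborel_pair.Fubini'[OF mprod] by simp
      also have "\<dots> = (\<integral>\<^sup>+w. ennreal (?k w) * (\<integral>\<^sup>+z. indicator ?S z * ennreal (V (z + w) powr q) \<partial>lborel) \<partial>lborel)"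
        by (intro nn_integral_cong, subst nn_integral_cmult[symmetric]) (auto simp: ac_simps)
      also have "\<dots> \<le> (\<integral>\<^sup>+w. ennreal (?k w) * (2 * ennreal (?N powr q)) \<partial>lborel)"
      proof (intro nn_integral_mono mult_left_mono)
        fix w
        have "(\<integral>\<^sup>+z. indicator ?S z * ennreal (V (z + w) powr q) \<partial>lborel) \<le> 2 * (\<integral>\<^sup>+z. indicator ?S z * ennreal (V z powr q) \<partial>lborel)"
          by (rule strip_shift_bound[OF \<gamma>]) (auto simp: Vper)
        also have "\<dots> \<le> 2 * ennreal (?N powr q)" by (intro mult_left_mono VN) simp
        finally show "(\<integral>\<^sup>+z. indicator ?S z * ennreal (V (z + w) powr q) \<partial>lborel) \<le> 2 * ennreal (?N powr q)" .
      qed simp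
      also have "\<dots> = (\<integral>\<^sup>+w. ennreal (?k w) \<partial>lborel) * (2 * ennreal (?N powr q))"
        by (intro nn_integral_multc) simp
      also have "\<dots> \<le> ennreal m * (2 * ennreal (?N powr q))" by (intro mult_right_mono km) simp
      also have "ennreal (m powr (q - 1)) * \<dots> = ennreal (2 * (m powr q * ?N powr q))"
      proof -
        have "m powr (q - 1) * m = m powr q" using m(1) by (simp add: powr_diff)
        moreover have "ennreal (m powr (q - 1)) * (ennreal m * (2 * ennreal (?N powr q))) = ennreal ((m powr (q - 1) * m) * (2 * ?N powr q))"
          using m(1) by (simp add: ennreal_mult ac_simps)
        ultimately show ?thesis by (simp add: ac_simps)
      qed
      \<comment> \<open>\<open>2 \<le> 2 powr q\<close> puts the factor from the translation under
        the power, so the final constant does not depend on \<open>q\<close>.\<close>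
      also have "\<dots> \<le> ennreal (2 powr q * (m powr q * ?N powr q))"
        using q powr_mono[of 1 q 2] by (intro ennreal_leI mult_right_mono) auto
      also have "2 powr q * (m powr q * ?N powr q) = (m * (2 * ?N)) powr q"
        by (simp add: powr_mult)
      finally have PS: "(\<integral>\<^sup>+z. indicator ?S z * ennreal (P z powr q) \<partial>lborel) \<le> ennreal ((m * (2 * ?N)) powr q)"
        by (simp add: mult_left_mono)
      have "(\<integral>\<^sup>+z. ennreal (cmod (weighted \<alpha> (bargmann_proj g) z) powr q) \<partial>lebesgue_on ?S)
         \<le> (\<integral>\<^sup>+z. ennreal ((L * A) powr q) * (indicator ?S z * ennreal (P z powr q)) \<partial>lborel)"
        unfolding nn_integral_lebesgue_on_strip
      proof (rule nn_integral_mono)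
        fix z
        show "indicator ?S z * ennreal (cmod (weighted \<alpha> (bargmann_proj g) z) powr q) \<le> ennreal ((L * A) powr q) * (indicator ?S z * ennreal (P z powr q))"
        proof (cases "z \<in> ?S")
          case True
          have "cmod (weighted \<alpha> (bargmann_proj g) z) powr q \<le> (L * A * P z) powr q"
            using q wle[OF True] by (intro powr_mono2) auto
          then show ?thesis using True by (simp add: powr_mult ennreal_mult[symmetric] ennreal_leI)
        qed simp
      qed
      also have "\<dots> = ennreal ((L * A) powr q) * (\<integral>\<^sup>+z. indicator ?S z * ennreal (P z powr q) \<partial>lborel)"
      proof (rule nn_integral_cmult)
        have "P \<in> borel_measurable lborel"
          unfolding P_def[abs_def] by (rule lborel.borel_measurable_lebesgue_integral) measurable
        then show "(\<lambda>z. indicator ?S z * ennreal (P z powr q)) \<in> borel_measurable lborel" by measurable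
      qed
      also have "\<dots> \<le> ennreal ((L * A) powr q) * ennreal ((m * (2 * ?N)) powr q)" by (intro mult_left_mono PS) simp
      also have "\<dots> = ennreal ((L * A * (m * (2 * ?N))) powr q)" by (simp add: powr_mult ennreal_mult)
      also have "\<dots> \<le> ennreal ((D * (A * ?N)) powr q)"
      proof (intro ennreal_leI powr_mono2)
        have "L * A * m * ?N * 2 \<le> L * A * m * ?N * (C + 2)"
          using C L A m N0 by (intro mult_left_mono mult_nonneg_nonneg) auto
        then show "L * A * (m * (2 * ?N)) \<le> D * (A * ?N)" by (simp add: D_def ac_simps)
        show "0 \<le> L * A * (m * (2 * ?N))" using L A m N0 by (intro mult_nonneg_nonneg) auto
      qed (use q in simp)
      finally show ?thesis using False meas by (simp add: Lp_ball_def q_def)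
    qed
  qed
  then show ?thesis using D by blast
qed

section \<open>The periodic spaces fit the abstract cubic equation\<close>

text \<open>Pointwise convergence alone does not preserve holomorphy. The common bound makes the
  entire factors locally bounded, and Montel's theorem gives a subsequence with an entire limit,
  which must be the entire factor of \<open>f\<close>. The same bound gives the growth condition
  with exponent \<open>0\<close>.\<close>

lemma F_per_limit:
  assumes gs: "\<And>n::nat. gs n \<in> F_per \<gamma>" and bound: "\<And>n z. cmod (gs n z) \<le> K" and lim: "\<And>z. (\<lambda>n. gs n z) \<longlonglongrightarrow> f z"
  shows "f \<in> F_per \<gamma>"
proof -
  have "\<forall>n. \<exists>h. h holomorphic_on UNIV \<and> (\<forall>z. gs n z = complex_of_real (exp (- (cmod z)\<^sup>2 / 2)) * h z)"
    using gs by (simp add: F_per_def E_tilde_def)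
  then obtain h where h: "\<And>n. h n holomorphic_on UNIV" "\<And>n z. gs n z = complex_of_real (exp (- (cmod z)\<^sup>2 / 2)) * h n z"
    by metis
  have heq: "h n z = complex_of_real (exp ((cmod z)\<^sup>2 / 2)) * gs n z" for n z
  proof -
    have "complex_of_real (exp ((cmod z)\<^sup>2 / 2)) * complex_of_real (exp (- (cmod z)\<^sup>2 / 2)) = 1"
      by (simp flip: of_real_mult exp_add)
    then show ?thesis unfolding h(2) by (simp only: mult.assoc[symmetric] mult_1_left)
  qed
  obtain g r where g: "g holomorphic_on UNIV" "strict_mono (r :: nat \<Rightarrow> nat)" "\<And>x. x \<in> UNIV \<Longrightarrow> (\<lambda>n. h (r n) x) \<longlonglongrightarrow> g x"
  proof (rule Montel[of UNIV "range h" h])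
    show "k holomorphic_on UNIV" if "k \<in> range h" for k using that h by auto
    show "\<exists>B. \<forall>k\<in>range h. \<forall>z\<in>Q. norm (k z) \<le> B" if "compact Q" for Q
    proof -
      have "compact ((\<lambda>z. exp ((cmod z)\<^sup>2 / 2)) ` Q)"
        using that by (intro compact_continuous_image continuous_intros) auto
      then obtain B where B: "\<And>z. z \<in> Q \<Longrightarrow> exp ((cmod z)\<^sup>2 / 2) \<le> B"
        using compact_imp_bounded bounded_iff by (metis (mono_tags, lifting) abs_le_D1 imageI real_norm_def)
      have "norm (h n z) \<le> B * K" if "z \<in> Q" for n z
        unfolding heq norm_mult using B[OF that] bound[of n z] order_trans[OF norm_ge_zero bound[of n z]] order_trans[OF exp_ge_zero B[OF that]]
        by (intro mult_mono) auto
      then show ?thesis by blast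
    qed
  qed (use that in auto)
  have "f z = complex_of_real (exp (- (cmod z)\<^sup>2 / 2)) * g z" for z
  proof (rule LIMSEQ_unique)
    show "(\<lambda>n. gs (r n) z) \<longlonglongrightarrow> f z" using LIMSEQ_subseq_LIMSEQ[OF lim g(2)] by (simp add: o_def)
    show "(\<lambda>n. gs (r n) z) \<longlonglongrightarrow> complex_of_real (exp (- (cmod z)\<^sup>2 / 2)) * g z"
      unfolding h(2) by (intro tendsto_intros g(3)) simp
  qed
  moreover have "cmod (f z) \<le> K * bracket z powr 0" for z
    using tendsto_norm[OF lim[of z]] bound by (auto intro!: LIMSEQ_le_const2)
  ultimately have "f \<in> E_tilde" using g(1) unfolding E_tilde_def by blast
  moreover have "mag_trans (of_real \<gamma>) f z = f z" for z
  proof (rule LIMSEQ_unique[OF _ lim])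
    have "(\<lambda>n. mag_trans (of_real \<gamma>) (gs n) z) \<longlonglongrightarrow> mag_trans (of_real \<gamma>) f z"
      unfolding mag_trans_def by (intro tendsto_intros lim)
    then show "(\<lambda>n. gs n z) \<longlonglongrightarrow> mag_trans (of_real \<gamma>) f z" using gs by (simp add: F_per_def)
  qed
  ultimately show ?thesis by (auto simp: F_per_def)
qed

lemma cmod_le_im_weight: "0 \<le> \<alpha> \<Longrightarrow> im_weight \<alpha> z * cmod (u z) \<le> B \<Longrightarrow> cmod (u z) \<le> B"
  using mult_right_mono[OF im_weight_ge_1[of \<alpha> z], of "cmod (u z)"] by simp

lemma banach_fun_F_per:
  assumes \<alpha>: "0 \<le> \<alpha>" and p: "1 \<le> p" and C: "0 \<le> C"
    and sup: "\<And>u z. u \<in> F_per \<gamma> \<inter> wLp_space p \<alpha> (strip \<gamma>) \<Longrightarrow> im_weight \<alpha> z * cmod (u z) \<le> C * wLp_norm p \<alpha> (strip \<gamma>) u"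
  shows "banach_fun (F_per \<gamma> \<inter> wLp_space p \<alpha> (strip \<gamma>)) (wLp_norm p \<alpha> (strip \<gamma>)) (\<lambda>_. C)"
proof
  let ?S = "strip \<gamma>" and ?N = "wLp_norm p \<alpha> (strip \<gamma>)" and ?X = "F_per \<gamma> \<inter> wLp_space p \<alpha> (strip \<gamma>)"
  have zeroF: "0 \<in> F_per \<gamma>"
  proof -
    have "(\<lambda>z. 0) holomorphic_on UNIV" by simp
    moreover have "(0 :: complex \<Rightarrow> complex) z = complex_of_real (exp (- (cmod z)\<^sup>2 / 2)) * 0" "cmod ((0 :: complex \<Rightarrow> complex) z) \<le> 0 * bracket z powr 0" for z by simp_all
    ultimately have "(0 :: complex \<Rightarrow> complex) \<in> E_tilde" unfolding E_tilde_def by blast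
    then show ?thesis by (auto simp: F_per_def mag_trans_def fun_eq_iff)
  qed
  have cm: "(\<lambda>z. c * f z) \<in> ?X \<and> ?N (\<lambda>z. c * f z) \<le> cmod c * ?N f" if f: "f \<in> ?X" for f c
  proof -
    have F: "(\<lambda>z. c * f z) \<in> F_per \<gamma>" using F_per_lincomb[of f \<gamma> f c 0] f by simp
    have "Lp_ball p ?S (cmod c * ?N f) (weighted \<alpha> (\<lambda>z. c * f z))"
      using f F by (intro Lp_ball_mono[OF p wLp_ball[OF p]] weighted_measurable wLp_norm_nonneg)
        (auto simp: F_per_def cmod_weighted norm_mult)
    then show ?thesis using F wLp_ballD[OF p mult_nonneg_nonneg[OF norm_ge_zero wLp_norm_nonneg]] by blast
  qed
  have "weighted \<alpha> 0 = (\<lambda>z. 0)" by (auto simp: weighted_def)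
  then have "Lp_ball p ?S 0 (weighted \<alpha> 0)"
    using enn2real_ge_1[OF p] by (auto simp: Lp_ball_def)
  then show "0 \<in> ?X" using zeroF wLp_ballD[OF p] by blast
  fix f assume f: "f \<in> ?X"
  show "0 \<le> ?N f" by (rule wLp_norm_nonneg)
  show "(\<lambda>z. c * f z) \<in> ?X" "?N (\<lambda>z. c * f z) \<le> cmod c * ?N f" for c using cm[OF f] by auto
  show "cmod (f z) \<le> C * ?N f" for z by (rule cmod_le_im_weight[OF \<alpha> sup[OF f]])
  fix g assume g: "g \<in> ?X"
  have F: "f + g \<in> F_per \<gamma>" using F_per_lincomb[of f \<gamma> g 1 1] f g by (simp add: plus_fun_def)
  \<comment> \<open>\<open>Lp_ball_add\<close> wants positive radii, so each norm is enlarged by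
    \<open>e / 2\<close>; the slack disappears at the end.\<close>
  have "Lp_ball p ?S (?N f + ?N g + e) (weighted \<alpha> (f + g))" if e: "e > 0" for e
  proof -
    have pos: "0 < ?N f + e / 2" "0 < ?N g + e / 2"
      using e wLp_norm_nonneg[of p \<alpha> ?S f] wLp_norm_nonneg[of p \<alpha> ?S g] by linarith+
    have ball: "Lp_ball p ?S (?N u + e / 2) (weighted \<alpha> u)" if "u \<in> ?X" "0 < ?N u + e / 2" for u
      unfolding Lp_ball_iff[OF p less_imp_le[OF that(2)]] using that(1) e
      by (auto simp: wLp_space_def wLp_norm_def)
    have "Lp_ball p ?S ((?N f + e / 2) + (?N g + e / 2)) (\<lambda>z. weighted \<alpha> f z + weighted \<alpha> g z)"
      by (rule Lp_ball_add[OF p ball[OF f pos(1)] ball[OF g pos(2)] pos])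
    moreover have "(\<lambda>z. weighted \<alpha> f z + weighted \<alpha> g z) = weighted \<alpha> (f + g)" by (auto simp: weighted_def algebra_simps)
    moreover have "(?N f + e / 2) + (?N g + e / 2) = ?N f + ?N g + e" by simp
    ultimately show ?thesis by simp
  qed
  note ball = this
  have le: "f + g \<in> wLp_space p \<alpha> ?S \<and> ?N (f + g) \<le> ?N f + ?N g + e" if e: "e > 0" for e
  proof (rule wLp_ballD[OF p _ ball[OF e]])
    show "0 \<le> ?N f + ?N g + e"
      using e wLp_norm_nonneg[of p \<alpha> ?S f] wLp_norm_nonneg[of p \<alpha> ?S g] by linarith
  qed
  show "f + g \<in> ?X" using F le[of 1] by simp
  show "?N (f + g) \<le> ?N f + ?N g" by (rule field_le_epsilon) (use le in blast)
next
  let ?S = "strip \<gamma>" and ?N = "wLp_norm p \<alpha> (strip \<gamma>)" and ?X = "F_per \<gamma> \<inter> wLp_space p \<alpha> (strip \<gamma>)"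
  fix gs :: "nat \<Rightarrow> complex \<Rightarrow> complex" and B f
  assume gs: "\<And>n. gs n \<in> ?X" "\<And>n. ?N (gs n) \<le> B" and lim: "\<And>z. (\<lambda>n. gs n z) \<longlonglongrightarrow> f z"
  have B: "0 \<le> B" using gs(2)[of 0] wLp_norm_nonneg[of p \<alpha> ?S "gs 0"] by linarith
  have bd: "cmod (gs n z) \<le> C * B" for n z
  proof -
    have "cmod (gs n z) \<le> C * ?N (gs n)" by (rule cmod_le_im_weight[OF \<alpha> sup[OF gs(1)]])
    also have "\<dots> \<le> C * B" by (intro mult_left_mono gs C)
    finally show ?thesis .
  qed
  have F: "f \<in> F_per \<gamma>" by (rule F_per_limit[OF _ bd lim]) (use gs(1) in blast)
  have "Lp_ball p ?S B (weighted \<alpha> f)"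
  proof (rule Lp_ball_fatou[OF p])
    show "Lp_ball p ?S B (weighted \<alpha> (gs n))" for n
      using gs B Lp_ball_iff[OF p B] by (simp add: wLp_space_def wLp_norm_def)
    show "(\<lambda>n. weighted \<alpha> (gs n) z) \<longlonglongrightarrow> weighted \<alpha> f z" for z
      unfolding weighted_def by (intro tendsto_intros lim)
  qed
  then show "f \<in> ?X \<and> ?N f \<le> B" using F wLp_ballD[OF p B] by auto
qed

definition bargmann_trilinear :: "(complex \<Rightarrow> complex) \<Rightarrow> (complex \<Rightarrow> complex) \<Rightarrow> (complex \<Rightarrow> complex) \<Rightarrow> complex \<Rightarrow> complex" where
  "bargmann_trilinear u v w = bargmann_proj (\<lambda>z. u z * cnj (v z) * w z)"

lemma bargmann_proj_lincomb:
  assumes "continuous_on UNIV g" "\<And>z. cmod (g z) \<le> K" "continuous_on UNIV h" "\<And>z. cmod (h z) \<le> K'"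
  shows "bargmann_proj (\<lambda>z. a *\<^sub>R g z + b *\<^sub>R h z) = a *\<^sub>R bargmann_proj g + b *\<^sub>R bargmann_proj h"
proof
  fix z
  let ?e = "\<lambda>w. exp (cnj w * z - complex_of_real ((cmod w)\<^sup>2 / 2))"
  have c: "continuous_on UNIV (\<lambda>z. a *\<^sub>R g z + b *\<^sub>R h z)" by (intro continuous_intros assms)
  have bd: "cmod (a *\<^sub>R g z + b *\<^sub>R h z) \<le> \<bar>a\<bar> * K + \<bar>b\<bar> * K'" for z
    using assms(2,4) by (intro norm_triangle_le add_mono) (auto intro: mult_left_mono)
  have "(LINT w|lborel. ?e w * (a *\<^sub>R g w + b *\<^sub>R h w)) = (LINT w|lborel. a *\<^sub>R (?e w * g w) + b *\<^sub>R (?e w * h w))"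
    by (simp add: algebra_simps)
  also have "\<dots> = a *\<^sub>R (LINT w|lborel. ?e w * g w) + b *\<^sub>R (LINT w|lborel. ?e w * h w)"
  proof -
    have "integrable lborel (\<lambda>w. a *\<^sub>R (?e w * g w))" "integrable lborel (\<lambda>w. b *\<^sub>R (?e w * h w))"
      by (intro integrable_scaleR_right bargmann_integrable[OF assms(1,2)] bargmann_integrable[OF assms(3,4)])+
    from Bochner_Integration.integral_add[OF this] show ?thesis by (simp only: integral_scaleR_right)
  qed
  finally show "bargmann_proj (\<lambda>z. a *\<^sub>R g z + b *\<^sub>R h z) z = (a *\<^sub>R bargmann_proj g + b *\<^sub>R bargmann_proj h) z"
    unfolding bargmann_proj_lborel[OF c bd] plus_fun_apply scaleR_fun_apply
      bargmann_proj_lborel[OF assms(1,2)] bargmann_proj_lborel[OF assms(3,4)]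
    by (simp only: distrib_left mult_scaleR_right)
qed

lemma cubic_space_F_per:
  assumes \<gamma>: "\<gamma> > 0" and \<alpha>: "0 \<le> \<alpha>" and p: "1 \<le> p"
  shows "\<exists>E C. cubic_space (F_per \<gamma> \<inter> wLp_space p \<alpha> (strip \<gamma>)) (wLp_norm p \<alpha> (strip \<gamma>)) E bargmann_trilinear C"
proof -
  let ?S = "strip \<gamma>" and ?N = "wLp_norm p \<alpha> (strip \<gamma>)" and ?X = "F_per \<gamma> \<inter> wLp_space p \<alpha> (strip \<gamma>)"
  obtain C where C: "0 \<le> C" and sup: "\<And>u z. u \<in> ?X \<Longrightarrow> im_weight \<alpha> z * cmod (u z) \<le> C * ?N u"
    using F_per_sup_bound[OF \<gamma> \<alpha>] p by blast
  obtain D where D: "0 \<le> D" and proj: "\<And>u g A. u \<in> ?X \<Longrightarrow> continuous_on UNIV g \<Longrightarrow> 0 \<le> A \<Longrightarrow>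
    (\<And>z. cmod (g z) \<le> A * cmod (u z)) \<Longrightarrow> Lp_ball p ?S (D * (A * ?N u)) (weighted \<alpha> (bargmann_proj g))"
    using bargmann_proj_wLp_bound[OF \<gamma> \<alpha>] p by blast
  interpret banach_fun ?X ?N "\<lambda>_. C" by (rule banach_fun_F_per[OF \<alpha> p C sup])
  have le: "cmod (u z) \<le> C * ?N u" if "u \<in> ?X" for u z by (rule cmod_le_im_weight[OF \<alpha> sup[OF that]])
  have cont: "continuous_on UNIV u" if "u \<in> ?X" for u using that by (simp add: F_per_def E_tilde_continuous)
  let ?g = "\<lambda>u v w z. u z * cnj (v z) * w z"
  have gcont: "continuous_on UNIV (?g u v w)" if "u \<in> ?X" "v \<in> ?X" "w \<in> ?X" for u v w
    by (intro continuous_intros cont that)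
  have gu: "cmod (?g u v w z) \<le> (C * ?N v * (C * ?N w)) * cmod (u z)" if "u \<in> ?X" "v \<in> ?X" "w \<in> ?X" for u v w z
  proof -
    have "cmod (v z) * cmod (w z) \<le> C * ?N v * (C * ?N w)"
      using C wLp_norm_nonneg by (intro mult_mono le that) auto
    then have "cmod (u z) * (cmod (v z) * cmod (w z)) \<le> cmod (u z) * (C * ?N v * (C * ?N w))" by (intro mult_left_mono) auto
    then show ?thesis by (simp add: norm_mult ac_simps)
  qed
  have gbd: "cmod (?g u v w z) \<le> (C * ?N v * (C * ?N w)) * (C * ?N u)" if "u \<in> ?X" "v \<in> ?X" "w \<in> ?X" for u v w z
    using C wLp_norm_nonneg by (intro order_trans[OF gu[OF that]] mult_left_mono le that) auto
  have gper: "mag_trans (of_real \<gamma>) (?g u v w) = ?g u v w" if "u \<in> ?X" "v \<in> ?X" "w \<in> ?X" for u v w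
  proof
    fix z
    let ?e = "exp ((complex_of_real \<gamma> * cnj z - cnj (complex_of_real \<gamma>) * z) / 2)"
    have per: "?e * f (z + of_real \<gamma>) = f z" if "f \<in> ?X" for f
    proof -
      have "mag_trans (of_real \<gamma>) f z = f z" using that by (simp add: F_per_def)
      then show ?thesis by (simp only: mag_trans_def)
    qed
    \<comment> \<open>The phase in \<open>mag_trans\<close> is unimodular. Two factors contribute it
      and the conjugated one its inverse, so the product transforms with exactly one phase, like
      each factor.\<close>
    have "cmod ?e = 1" by (simp add: norm_exp_eq_Re)
    then have "?e * cnj ?e = 1" using complex_norm_square[of ?e] by simp
    then have "?e * (u (z + of_real \<gamma>) * cnj (v (z + of_real \<gamma>)) * w (z + of_real \<gamma>))
      = (?e * u (z + of_real \<gamma>)) * cnj (?e * v (z + of_real \<gamma>)) * (?e * w (z + of_real \<gamma>))"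
    proof -
      assume 1: "?e * cnj ?e = 1"
      have "(e * a) * cnj (e * b) * (e * c) = (e * cnj e) * (e * (a * cnj b * c))" for a b c e :: complex by simp
      from this[of ?e] show ?thesis unfolding 1 by simp
    qed
    then show "mag_trans (of_real \<gamma>) (?g u v w) z = ?g u v w z"
      unfolding mag_trans_def per[OF that(1)] per[OF that(2)] per[OF that(3)] .
  qed
  have T: "bargmann_trilinear u v w \<in> ?X \<and> ?N (bargmann_trilinear u v w) \<le> D * C\<^sup>2 * (?N u * ?N v * ?N w)"
    if "u \<in> ?X" "v \<in> ?X" "w \<in> ?X" for u v w
  proof -
    have A: "0 \<le> C * ?N v * (C * ?N w)" using C wLp_norm_nonneg by (intro mult_nonneg_nonneg) auto
    have "Lp_ball p ?S (D * ((C * ?N v * (C * ?N w)) * ?N u)) (weighted \<alpha> (bargmann_trilinear u v w))"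
      unfolding bargmann_trilinear_def by (rule proj[OF that(1) gcont[OF that] A gu[OF that]])
    then have "bargmann_trilinear u v w \<in> wLp_space p \<alpha> ?S \<and> ?N (bargmann_trilinear u v w) \<le> D * ((C * ?N v * (C * ?N w)) * ?N u)"
      using A D wLp_norm_nonneg by (intro wLp_ballD[OF p]) (auto intro!: mult_nonneg_nonneg)
    moreover have "bargmann_trilinear u v w \<in> F_per \<gamma>"
      unfolding bargmann_trilinear_def by (rule bargmann_proj_F_per[OF gcont[OF that] gbd[OF that] gper[OF that]])
    moreover have "D * ((C * ?N v * (C * ?N w)) * ?N u) = D * C\<^sup>2 * (?N u * ?N v * ?N w)"
      by (simp add: power2_eq_square)
    ultimately show ?thesis by simp
  qed
  have lin: "bargmann_trilinear f1 f2 f3 = a *\<^sub>R bargmann_trilinear u v w + b *\<^sub>R bargmann_trilinear u' v' w'"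
    if "u \<in> ?X" "v \<in> ?X" "w \<in> ?X" "u' \<in> ?X" "v' \<in> ?X" "w' \<in> ?X"
      "\<And>z. ?g f1 f2 f3 z = a *\<^sub>R ?g u v w z + b *\<^sub>R ?g u' v' w' z" for f1 f2 f3 u v w u' v' w' a b
    unfolding bargmann_trilinear_def that(7)
    by (rule bargmann_proj_lincomb[OF gcont[OF that(1-3)] gbd[OF that(1-3)] gcont[OF that(4-6)] gbd[OF that(4-6)]])
  have "cubic_space ?X ?N (\<lambda>_. C) bargmann_trilinear (D * C\<^sup>2)"
  proof
    fix u v w assume "u \<in> ?X" "v \<in> ?X" "w \<in> ?X"
    from T[OF this] show "bargmann_trilinear u v w \<in> ?X" "?N (bargmann_trilinear u v w) \<le> D * C\<^sup>2 * (?N u * ?N v * ?N w)"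
      by auto
  next
    show "0 \<le> D * C\<^sup>2" using D by simp
  qed (rule lin, assumption+, simp add: algebra_simps scaleR_conv_of_real)+
  then show ?thesis by blast
qed

lemma well_posed_wLp:
  assumes "\<gamma> > 0" "0 \<le> \<alpha>" "1 \<le> p"
  shows "locally_well_posed (F_per \<gamma> \<inter> wLp_space p \<alpha> (strip \<gamma>)) (wLp_norm p \<alpha> (strip \<gamma>)) cubic"
proof -
  obtain E C where "cubic_space (F_per \<gamma> \<inter> wLp_space p \<alpha> (strip \<gamma>)) (wLp_norm p \<alpha> (strip \<gamma>)) E bargmann_trilinear C"
    using cubic_space_F_per[OF assms] by blast
  then interpret cubic_space "F_per \<gamma> \<inter> wLp_space p \<alpha> (strip \<gamma>)" "wLp_norm p \<alpha> (strip \<gamma>)" E bargmann_trilinear C .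
  show ?thesis
    by (rule cubic_well_posed) (simp only: cubic_def bargmann_trilinear_def complex_norm_square)
qed

theorem proposition3p8:
  fixes \<gamma> :: real
  assumes "\<gamma> > 0"
  shows
    "(\<forall>p::ennreal. 1 \<le> p \<longrightarrow>
        locally_well_posed (F_per \<gamma> \<inter> Lp_space p (strip \<gamma>)) (Lp_norm p (strip \<gamma>)) cubic) \<and>
     (\<forall>(p::ennreal) (\<alpha>::real). 1 \<le> p \<and> 0 \<le> \<alpha> \<longrightarrow>
        locally_well_posed (F_per \<gamma> \<inter> wLp_space p \<alpha> (strip \<gamma>)) (wLp_norm p \<alpha> (strip \<gamma>)) cubic) \<and>
     (\<forall>\<alpha>::real. 0 \<le> \<alpha> \<longrightarrow>
        locally_well_posed (linf_space \<alpha>) (linf_norm \<alpha>) (cubic_coord \<gamma>))"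
proof -
  \<comment> \<open>The first claim is the case \<open>\<alpha> = 0\<close> of the second.\<close>
  have "weighted 0 u = u" for u by (simp add: weighted_def fun_eq_iff)
  then have "wLp_space p 0 S = Lp_space p S" "wLp_norm p 0 S = Lp_norm p S" for p S
    by (auto simp: wLp_space_def wLp_norm_def)
  then show ?thesis
    using well_posed_wLp[OF assms] well_posed_wLp[OF assms order_refl] well_posed_linf[OF assms] by auto
qed

end
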